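(* Let $P=\lambda_0M_0+\sum_{i=1}^t\lambda_iM_i$ be a quasi-identity of $M_n$, where $M_0,\dots,M_t$ are noncommutative monomials in the $x_k$ and $\lambda_0,\dots,\lambda_t\in\mathcal C$. If $M_1,\dots,M_t$ are $M_n$-locally linearly independent, then $P$ is a consequence of the Cayley–Hamilton identity, i.e. $P\in(Q_n)$.
   Context: $F$ is a field of characteristic $0$, $n\ge1$, $M_n=M_n(F)$, $\mathcal C=F[x^{(k)}_{ij}:1\le i,j\le n,\ k\ge1]$, $X=\{x_1,x_2,\dots\}$ noncommuting; $\mathcal C\langle X\rangle$ is the free $\mathcal C$-algebra (quasi-polynomials). A quasi-identity vanishes when each $x_k$ is replaced by any $A_k=(a^{(k)}_{ij})\in M_n$ and each $x^{(k)}_{ij}$ by $a^{(k)}_{ij}$. $M_1,\dots,M_t$ are $M_n$-locally linearly independent if there exist matrices at which their values are linearly independent. Generic matrices $\xi_k=(x^{(k)}_{ij})\in M_n(\mathcal C)$; $\mathrm{tr}(x_{i_1}\cdots x_{i_r}):=\mathrm{tr}(\xi_{i_1}\cdots\xi_{i_r})\in\mathcal C$. $Q_n=\sum_{\sigma\in S_{n+1}}\epsilon_\sigma\phi_\sigma(x_1,\dots,x_n)$, where for $\sigma=(i_1,\dots,i_{k_1})\cdots(u_1,\dots,u_h)(s_1,\dots,s_k,n+1)$ (disjoint cycles, the one containing $n+1$ last) $\phi_\sigma=\mathrm{tr}(x_{i_1}\cdots x_{i_{k_1}})\cdots\mathrm{tr}(x_{u_1}\cdots x_{u_h})x_{s_1}\cdots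 x_{s_k}$. A T-ideal is an ideal of $\mathcal C\langle X\rangle$ closed under simultaneous substitutions $x_k\mapsto H_k$, $x^{(k)}_{ij}\mapsto\Phi(H_k)_{ij}$, with $\Phi$ the $\mathcal C$-algebra map $x_k\mapsto\xi_k$; $(Q_n)$ is the T-ideal generated by $Q_n$. *)

theory Defs
  imports "HOL-Analysis.Analysis" "HOL-Library.Poly_Mapping"
begin

text \<open>Conventions. The size n of the matrices is CARD('n) for a finite type 'n
(which indexes rows and columns). The noncommuting variables x_1, x_2, ... are
indexed by natural numbers 0, 1, 2, ... (x_(k+1) corresponds to index k).
The commuting variable x^(k)_(ij) is the triple (k, i, j).\<close>

type_synonym ('a, 'n) cpoly = "((nat \<times> 'n \<times> 'n) \<Rightarrow>\<^sub>0 nat) \<Rightarrow>\<^sub>0 'a"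

text \<open>Quasi-polynomials: elements of the free C-algebra C<X>, i.e. finitely
supported C-linear combinations of words over X.\<close>
type_synonym ('a, 'n) qpoly = "nat list \<Rightarrow>\<^sub>0 ('a, 'n) cpoly"

definition cvar :: "nat \<times> 'n \<times> 'n \<Rightarrow> ('a::comm_ring_1, 'n) cpoly" where
  "cvar v = Poly_Mapping.single (Poly_Mapping.single v 1) 1"

definition cpeval :: "('v \<Rightarrow> 'b::comm_ring_1) \<Rightarrow> (('v \<Rightarrow>\<^sub>0 nat) \<Rightarrow>\<^sub>0 'a::comm_ring_1)
    \<Rightarrow> ('a \<Rightarrow> 'b) \<Rightarrow> 'b" where
  "cpeval s p emb = (\<Sum>m\<in>Poly_Mapping.keys p.
      emb (Poly_Mapping.lookup p m) * (\<Prod>v\<in>Poly_Mapping.keys m. s v ^ Poly_Mapping.lookup m v))"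

definition cconst :: "'a::comm_ring_1 \<Rightarrow> ('a, 'n) cpoly" where
  "cconst c = Poly_Mapping.single 0 c"

definition msmult :: "'b::times \<Rightarrow> 'b^'n^'n \<Rightarrow> 'b^'n^'n" where
  "msmult c A = (\<chi> i j. c * A $ i $ j)"

definition wordmat :: "(nat \<Rightarrow> 'b::semiring_1^'n^'n) \<Rightarrow> nat list \<Rightarrow> 'b^'n^'n" where
  "wordmat A w = foldr (\<lambda>k M. matrix_matrix_mult (A k) M) w (mat 1)"

definition qeval :: "(nat \<Rightarrow> 'a::field^'n^'n) \<Rightarrow> ('a, 'n::finite) qpoly \<Rightarrow> 'a^'n^'n" where
  "qeval A P = (\<Sum>w\<in>Poly_Mapping.keys P.
      msmult (cpeval (\<lambda>(k, i, j). A k $ i $ j) (Poly_Mapping.lookup P w) id) (wordmat A w))"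

definition quasi_identity :: "('a::field, 'n::finite) qpoly \<Rightarrow> bool" where
  "quasi_identity P \<longleftrightarrow> (\<forall>A. qeval A P = 0)"

definition loc_lin_indep :: "'n::finite itself \<Rightarrow> nat \<Rightarrow> (nat \<Rightarrow> nat list) \<Rightarrow> ('a::field) itself \<Rightarrow> bool" where
  "loc_lin_indep _ t M _ \<longleftrightarrow> (\<exists>A :: nat \<Rightarrow> 'a^'n^'n.
      \<forall>c :: nat \<Rightarrow> 'a. (\<Sum>i\<in>{1..t}. msmult (c i) (wordmat A (M i))) = 0 \<longrightarrow> (\<forall>i\<in>{1..t}. c i = 0))"

definition generic :: "nat \<Rightarrow> ('a::comm_ring_1, 'n::finite) cpoly^'n^'n" where
  "generic k = (\<chi> i j. cvar (k, i, j))"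

definition qmul :: "('a::comm_ring_1, 'n) qpoly \<Rightarrow> ('a, 'n) qpoly \<Rightarrow> ('a, 'n) qpoly" where
  "qmul p q = (\<Sum>u\<in>Poly_Mapping.keys p. \<Sum>v\<in>Poly_Mapping.keys q.
      Poly_Mapping.single (u @ v) (Poly_Mapping.lookup p u * Poly_Mapping.lookup q v))"

definition qone :: "('a::comm_ring_1, 'n) qpoly" where
  "qone = Poly_Mapping.single [] 1"

definition qword :: "(nat \<Rightarrow> ('a::comm_ring_1, 'n) qpoly) \<Rightarrow> nat list \<Rightarrow> ('a, 'n) qpoly" where
  "qword H w = foldr (\<lambda>k q. qmul (H k) q) w qone"

definition Phi :: "('a::comm_ring_1, 'n::finite) qpoly \<Rightarrow> ('a, 'n) cpoly^'n^'n" where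
  "Phi P = (\<Sum>w\<in>Poly_Mapping.keys P. msmult (Poly_Mapping.lookup P w) (wordmat generic w))"

definition qsubst :: "(nat \<Rightarrow> ('a::comm_ring_1, 'n::finite) qpoly) \<Rightarrow> ('a, 'n) qpoly \<Rightarrow> ('a, 'n) qpoly" where
  "qsubst H P = (\<Sum>w\<in>Poly_Mapping.keys P.
      qmul (Poly_Mapping.single []
              (cpeval (\<lambda>(k, i, j). Phi (H k) $ i $ j) (Poly_Mapping.lookup P w) cconst))
           (qword H w))"

definition T_ideal :: "('a::comm_ring_1, 'n::finite) qpoly set \<Rightarrow> bool" where
  "T_ideal I \<longleftrightarrow> 0 \<in> I \<and> (\<forall>p\<in>I. \<forall>q\<in>I. p + q \<in> I)
     \<and> (\<forall>p\<in>I. \<forall>a b. qmul (qmul a p) b \<in> I)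
     \<and> (\<forall>p\<in>I. \<forall>H. qsubst H p \<in> I)"

definition T_ideal_gen :: "('a::comm_ring_1, 'n::finite) qpoly \<Rightarrow> ('a, 'n) qpoly set" where
  "T_ideal_gen Q = \<Inter>{I. T_ideal I \<and> Q \<in> I}"

definition qtr :: "nat list \<Rightarrow> ('a::comm_ring_1, 'n::finite) cpoly" where
  "qtr w = trace (wordmat generic w)"

text \<open>Cycle structure of a permutation sigma of {0..n} (these stand for the
indices 1..n+1 of the paper; the distinguished point n+1 is n here).\<close>
definition orb :: "(nat \<Rightarrow> nat) \<Rightarrow> nat \<Rightarrow> nat set" where
  "orb \<sigma> i = range (\<lambda>j. (\<sigma> ^^ j) i)"

definition cycword :: "(nat \<Rightarrow> nat) \<Rightarrow> nat \<Rightarrow> nat list" where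
  "cycword \<sigma> i = map (\<lambda>j. (\<sigma> ^^ j) i) [0..<card (orb \<sigma> i)]"

text \<open>For the cycle (s_1, ..., s_k, n+1) the word s_1 ... s_k.\<close>
definition tailword :: "nat \<Rightarrow> (nat \<Rightarrow> nat) \<Rightarrow> nat list" where
  "tailword n \<sigma> = map (\<lambda>j. (\<sigma> ^^ j) n) [1..<card (orb \<sigma> n)]"

definition phi_sigma :: "nat \<Rightarrow> (nat \<Rightarrow> nat) \<Rightarrow> ('a::comm_ring_1, 'n::finite) qpoly" where
  "phi_sigma n \<sigma> = Poly_Mapping.single (tailword n \<sigma>)
     (\<Prod>Cy\<in>{orb \<sigma> i | i. i < n \<and> n \<notin> orb \<sigma> i}. qtr (cycword \<sigma> (Min Cy)))"

definition Qn :: "('a::comm_ring_1, 'n::finite) qpoly" where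
  "Qn = (\<Sum>\<sigma>\<in>{\<sigma>. \<sigma> permutes {0..CARD('n)}}.
          qmul (Poly_Mapping.single [] (of_int (sign \<sigma>))) (phi_sigma CARD('n) \<sigma>))"

end

theory Submission
  imports Defs "HOL-Computational_Algebra.Polynomial"
begin

text \<open>
  Since \<open>M\<^sub>1, \<dots>, M\<^sub>t\<close> are independent at some point, the coefficient tuples \<open>\<mu>\<close> with
  \<open>\<Sum> \<mu>\<^sub>s M\<^sub>s(\<xi>) = 0\<close> form a module of rank at most one over the factorial ring \<open>C\<close>, so all of them are multiples
  of a single tuple \<open>\<mu>\<close>. The infinitesimal conjugations preserve this module and the degree, hence
  \<open>\<mu>\<close> is a common eigenvector for them and therefore invariant. By the first fundamental theorem for
  matrices the \<open>\<mu>\<^sub>s\<close> are polynomials in traces of words. Thus \<open>\<Sum> \<mu>\<^sub>s M\<^sub>s\<close> is a trace identity and,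
  by the second fundamental theorem, a combination of alternating sums of trace monomials over
  \<open>n + 1\<close> positions. Each of these is obtained from \<open>Q\<^sub>n\<close> by substitution and multiplication.

  The first fundamental theorem rests on the double centraliser theorem for the place permutations of
  tensors. For the second one, a permutation without a decreasing sequence of length \<open>n + 1\<close> is isolated by
  a suitable pair of index tuples, and every other one can be straightened by an alternating sum.
\<close>

section \<open>Polynomials and homomorphisms\<close>

text \<open>The coefficients of P are invariant only after a common factor h has been removed, and h
  costs nothing because a T-ideal absorbs it. Conjugation enters through derivations only: a factor
  by which a derivation multiplies a nonzero polynomial without raising its degree must be a
  constant, so no group characters arise. The price is a first fundamental theorem that starts from
  Lie algebra invariance; it holds because in characteristic 0 the operators of gl generate every
  operator on tensors that commutes with place permutations. A term with traces and one open word, d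
  letters in all, is coded by a permutation of d + 1 positions, where position d closes the open
  word into a cycle. The matrix entries of such an expression then form a single operator on the
  (d+1)-st tensor power, the setting of the second theorem. There the alternating set has n + 1
  elements, one more than there are indices, but it may miss position d and many others. Passing to
  \<open>Qn\<close> means deleting the remaining positions from their cycles by merging words; the
  alternating permutations fix these positions, so one deletion serves all terms.\<close>

definition is_hom :: "('a::comm_ring_1 \<Rightarrow> 'b::comm_ring_1) \<Rightarrow> bool" where
  "is_hom h \<longleftrightarrow> h 0 = 0 \<and> h 1 = 1 \<and> (\<forall>x y. h (x + y) = h x + h y) \<and> (\<forall>x y. h (x * y) = h x * h y)"

lemma is_homD:
  assumes "is_hom h"
  shows "h 0 = 0" "h 1 = 1" "h (x + y) = h x + h y" "h (x * y) = h x * h y"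
  using assms by (auto simp: is_hom_def)

lemma is_hom_sum: "is_hom h \<Longrightarrow> h (\<Sum>x\<in>A. f x) = (\<Sum>x\<in>A. h (f x))"
  by (induction A rule: infinite_finite_induct) (auto simp: is_hom_def)

lemma is_hom_prod: "is_hom h \<Longrightarrow> h (\<Prod>x\<in>A. f x) = (\<Prod>x\<in>A. h (f x))"
  by (induction A rule: infinite_finite_induct) (auto simp: is_hom_def)

lemma is_hom_power: "is_hom h \<Longrightarrow> h (x ^ k) = h x ^ k"
  by (induction k) (auto simp: is_hom_def)

lemma is_hom_uminus: "is_hom h \<Longrightarrow> h (- x) = - h x"
  by (metis add_eq_0_iff2 add.right_inverse is_homD(1,3))

lemma is_hom_diff: "is_hom h \<Longrightarrow> h (x - y) = h x - h y"
  by (metis diff_conv_add_uminus is_homD(3) is_hom_uminus)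

lemma is_hom_comp: "is_hom g \<Longrightarrow> is_hom h \<Longrightarrow> is_hom (\<lambda>x. g (h x))"
  by (auto simp: is_hom_def)

lemma is_hom_id [simp]: "is_hom id" "is_hom (\<lambda>x. x)"
  by (auto simp: is_hom_def)

lemma is_hom_const_poly [simp]: "is_hom (\<lambda>c. [:c:])"
  by (auto simp: is_hom_def)

lemma is_hom_poly [simp]: "is_hom (\<lambda>p. poly p x)"
  by (auto simp: is_hom_def)

section \<open>Commuting polynomials and their evaluation\<close>

definition pvar :: "'v \<Rightarrow> ('v \<Rightarrow>\<^sub>0 nat) \<Rightarrow>\<^sub>0 'a::comm_ring_1" where
  "pvar v = Poly_Mapping.single (Poly_Mapping.single v 1) 1"

definition pconst :: "'a::comm_ring_1 \<Rightarrow> ('v \<Rightarrow>\<^sub>0 nat) \<Rightarrow>\<^sub>0 'a" where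
  "pconst c = Poly_Mapping.single 0 c"

lemma is_hom_pconst [simp]: "is_hom pconst"
  by (auto simp: is_hom_def pconst_def single_add mult_single)

lemma pconst_simps [simp]: "pconst 0 = 0" "pconst 1 = 1"
  by (auto simp: pconst_def)

definition mval :: "('v \<Rightarrow> 'b::comm_ring_1) \<Rightarrow> ('v \<Rightarrow>\<^sub>0 nat) \<Rightarrow> 'b" where
  "mval s m = (\<Prod>v\<in>Poly_Mapping.keys m. s v ^ Poly_Mapping.lookup m v)"

lemma mval_eq:
  assumes "finite K" "Poly_Mapping.keys m \<subseteq> K"
  shows "mval s m = (\<Prod>v\<in>K. s v ^ Poly_Mapping.lookup m v)"
  unfolding mval_def using assms
  by (intro prod.mono_neutral_left) (auto simp: in_keys_iff)

lemma mval_0 [simp]: "mval s 0 = 1"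
  by (simp add: mval_def)

lemma mval_single [simp]: "mval s (Poly_Mapping.single v k) = s v ^ k"
  by (cases "k = 0") (auto simp: mval_def)

lemma mval_add: "mval s (m + m') = mval s m * mval s m'"
proof -
  let ?K = "Poly_Mapping.keys m \<union> Poly_Mapping.keys m'"
  have "mval s (m + m') = (\<Prod>v\<in>?K. s v ^ Poly_Mapping.lookup (m + m') v)"
    by (intro mval_eq) (auto simp: in_keys_iff lookup_add)
  also have "\<dots> = (\<Prod>v\<in>?K. s v ^ Poly_Mapping.lookup m v) * (\<Prod>v\<in>?K. s v ^ Poly_Mapping.lookup m' v)"
    by (simp add: lookup_add power_add prod.distrib)
  also have "\<dots> = mval s m * mval s m'"
    by (subst (1 2) mval_eq[where K = ?K]) auto
  finally show ?thesis .
qed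

lemma cpeval_mval: "cpeval s p emb = (\<Sum>m\<in>Poly_Mapping.keys p. emb (Poly_Mapping.lookup p m) * mval s m)"
  by (simp add: cpeval_def mval_def)

lemma cpeval_eq:
  assumes "is_hom emb" "finite K" "Poly_Mapping.keys p \<subseteq> K"
  shows "cpeval s p emb = (\<Sum>m\<in>K. emb (Poly_Mapping.lookup p m) * mval s m)"
  unfolding cpeval_mval using assms
  by (intro sum.mono_neutral_left) (auto simp: in_keys_iff is_homD(1))

lemma cpeval_single: "is_hom emb \<Longrightarrow> cpeval s (Poly_Mapping.single m c) emb = emb c * mval s m"
  by (subst cpeval_eq[where K = "{m}"]) auto

lemma cpeval_add:
  assumes "is_hom emb"
  shows "cpeval s (p + q) emb = cpeval s p emb + cpeval s q emb"
proof -
  let ?K = "Poly_Mapping.keys p \<union> Poly_Mapping.keys q"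
  have "cpeval s (p + q) emb = (\<Sum>m\<in>?K. emb (Poly_Mapping.lookup (p + q) m) * mval s m)"
    by (intro cpeval_eq) (use assms in \<open>auto simp: in_keys_iff lookup_add\<close>)
  also have "\<dots> = (\<Sum>m\<in>?K. emb (Poly_Mapping.lookup p m) * mval s m)
      + (\<Sum>m\<in>?K. emb (Poly_Mapping.lookup q m) * mval s m)"
    by (simp add: lookup_add is_homD[OF assms] distrib_right sum.distrib)
  also have "\<dots> = cpeval s p emb + cpeval s q emb"
    by (subst (1 2) cpeval_eq[where K = ?K]) (use assms in auto)
  finally show ?thesis .
qed

lemma cpeval_zero [simp]: "cpeval s 0 emb = 0"
  by (simp add: cpeval_def)

lemma cpeval_sum: "is_hom emb \<Longrightarrow> cpeval s (\<Sum>x\<in>A. f x) emb = (\<Sum>x\<in>A. cpeval s (f x) emb)"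
  by (induction A rule: infinite_finite_induct) (auto simp: cpeval_add)

lemma poly_mapping_sum_singles:
  "p = (\<Sum>m\<in>Poly_Mapping.keys p. Poly_Mapping.single m (Poly_Mapping.lookup p m))"
proof (rule poly_mapping_eqI)
  fix k
  show "Poly_Mapping.lookup p k = Poly_Mapping.lookup
    (\<Sum>m\<in>Poly_Mapping.keys p. Poly_Mapping.single m (Poly_Mapping.lookup p m)) k"
    by (cases "k \<in> Poly_Mapping.keys p")
      (auto simp: lookup_sum lookup_single when_def in_keys_iff)
qed

lemma cpeval_mult:
  assumes "is_hom emb"
  shows "cpeval s (p * q) emb = cpeval s p emb * cpeval s q emb"
proof -
  have "p * q = (\<Sum>m\<in>Poly_Mapping.keys p. \<Sum>m'\<in>Poly_Mapping.keys q.
     Poly_Mapping.single (m + m') (Poly_Mapping.lookup p m * Poly_Mapping.lookup q m'))"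
    by (subst poly_mapping_sum_singles[of p], subst poly_mapping_sum_singles[of q])
      (simp add: sum_product mult_single)
  hence "cpeval s (p * q) emb = (\<Sum>m\<in>Poly_Mapping.keys p. \<Sum>m'\<in>Poly_Mapping.keys q.
      emb (Poly_Mapping.lookup p m * Poly_Mapping.lookup q m') * mval s (m + m'))"
    by (simp add: cpeval_sum cpeval_single assms)
  also have "\<dots> = cpeval s p emb * cpeval s q emb"
    by (simp add: mval_add is_homD[OF assms] cpeval_mval sum_product mult_ac)
  finally show ?thesis .
qed

lemma is_hom_cpeval [simp]: "is_hom emb \<Longrightarrow> is_hom (\<lambda>p. cpeval s p emb)"
  unfolding is_hom_def[of "\<lambda>p. cpeval s p emb"]
  using cpeval_single[of emb s 0 1]
  by (auto simp: cpeval_add cpeval_mult is_homD)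

lemma cpeval_pvar [simp]: "is_hom emb \<Longrightarrow> cpeval s (pvar v) emb = s v"
  by (simp add: cpeval_single is_homD pvar_def)

lemma cpeval_pconst [simp]: "is_hom emb \<Longrightarrow> cpeval s (pconst c) emb = emb c"
  by (simp add: cpeval_single is_homD pconst_def)

lemma single_prod_pvar: "Poly_Mapping.single m (1::'a::comm_ring_1) = mval pvar m"
proof -
  have p: "pvar v ^ k = Poly_Mapping.single (Poly_Mapping.single v k) (1::'a)" for v :: 'b and k
    by (induction k) (auto simp: mult_single pvar_def simp flip: single_add)
  have "(\<Prod>v\<in>A. Poly_Mapping.single (g v) (1::'a)) = Poly_Mapping.single (\<Sum>v\<in>A. g v) 1"
    for A and g :: "'b \<Rightarrow> 'b \<Rightarrow>\<^sub>0 nat"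
    by (induction A rule: infinite_finite_induct) (auto simp: mult_single)
  thus ?thesis unfolding mval_def p
    by (simp flip: poly_mapping_sum_singles)
qed

lemma single_pconst_mult: "Poly_Mapping.single m c = pconst c * mval pvar m"
  by (simp flip: single_prod_pvar add: mult_single pconst_def)

lemma mpoly_induct [case_names const var add mult]:
  assumes "\<And>c. P (pconst c)" "\<And>v. P (pvar v)" "\<And>p q. P p \<Longrightarrow> P q \<Longrightarrow> P (p + q)"
    "\<And>p q. P p \<Longrightarrow> P q \<Longrightarrow> P (p * q)"
  shows "P p"
proof -
  have 1: "P 1" using assms(1)[of 1] by simp
  have 0: "P 0" using assms(1)[of 0] by simp
  have pw: "P (q ^ k)" if "P q" for q k
    by (induction k) (auto intro: assms 1 that)
  have pr: "P (\<Prod>v\<in>A. f v)" if "\<And>v. P (f v)" for A and f :: "'v \<Rightarrow> _"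
    by (induction A rule: infinite_finite_induct) (auto intro: assms 1 that)
  have sm: "P (\<Sum>v\<in>A. f v)" if "\<And>v. P (f v)" for A and f :: "('v \<Rightarrow>\<^sub>0 nat) \<Rightarrow> _"
    by (induction A rule: infinite_finite_induct) (auto intro: assms 0 that)
  show ?thesis
    by (subst poly_mapping_sum_singles, rule sm, subst single_pconst_mult, unfold mval_def)
      (intro assms pr pw)
qed

text \<open>Universal property of the polynomial ring. Identities between evaluation maps are
  checked on constants and variables through it, whatever the target ring.\<close>

lemma is_hom_unique:
  assumes "is_hom g" "is_hom h" "\<And>c. g (pconst c) = h (pconst c)" "\<And>v. g (pvar v) = h (pvar v)"
  shows "g p = h p"
  by (induction p rule: mpoly_induct) (auto simp: assms is_homD[OF assms(1)] is_homD[OF assms(2)])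

section \<open>Factoriality of polynomial rings\<close>

text \<open>Variables indexed by natural numbers come first: their order makes monomials comparable,
  so the ring is an integral domain, and there is a next variable to induct on. Other countable
  index types are reached by renaming.\<close>

type_synonym 'a npoly = "(nat \<Rightarrow>\<^sub>0 nat) \<Rightarrow>\<^sub>0 'a"

definition vars_below :: "nat \<Rightarrow> 'a::field npoly set" where
  "vars_below k = {f. \<forall>m\<in>Poly_Mapping.keys f. Poly_Mapping.keys m \<subseteq> {..<k}}"

lemma vars_below_add: "f \<in> vars_below k \<Longrightarrow> g \<in> vars_below k \<Longrightarrow> f + g \<in> vars_below k"
  unfolding vars_below_def using keys_add[of f g] by blast

lemma vars_below_uminus: "f \<in> vars_below k \<Longrightarrow> - f \<in> vars_below k"
  by (auto simp: vars_below_def in_keys_iff)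

lemma vars_below_diff: "f \<in> vars_below k \<Longrightarrow> g \<in> vars_below k \<Longrightarrow> f - g \<in> vars_below k"
  by (metis diff_conv_add_uminus vars_below_add vars_below_uminus)

lemma vars_below_mult:
  assumes "f \<in> vars_below k" "g \<in> vars_below k"
  shows "f * g \<in> vars_below k"
  unfolding vars_below_def
proof safe
  fix m v assume "m \<in> Poly_Mapping.keys (f * g)" "v \<in> Poly_Mapping.keys m"
  then obtain a b where "m = a + b" "a \<in> Poly_Mapping.keys f" "b \<in> Poly_Mapping.keys g"
    using keys_mult[of f g] by blast
  thus "v < k" using assms keys_add[of a b] \<open>v \<in> Poly_Mapping.keys m\<close> unfolding vars_below_def by blast
qed

lemma vars_below_pconst [simp]: "pconst c \<in> vars_below k"
  by (auto simp: vars_below_def pconst_def)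

lemma vars_below_0 [simp]: "0 \<in> vars_below k"
  by (auto simp: vars_below_def)

lemma vars_below_1 [simp]: "1 \<in> vars_below k"
  using vars_below_pconst[of 1] by simp

lemma vars_below_pvar: "v < k \<Longrightarrow> pvar v \<in> vars_below k"
  by (auto simp: vars_below_def pvar_def)

lemma vars_below_sum: "(\<And>x. x \<in> A \<Longrightarrow> f x \<in> vars_below k) \<Longrightarrow> sum f A \<in> vars_below k"
  by (induction A rule: infinite_finite_induct) (auto intro: vars_below_add)

lemma vars_below_prod: "(\<And>x. x \<in> A \<Longrightarrow> f x \<in> vars_below k) \<Longrightarrow> prod f A \<in> vars_below k"
  by (induction A rule: infinite_finite_induct) (auto intro: vars_below_mult)

lemma vars_below_power: "f \<in> vars_below k \<Longrightarrow> f ^ j \<in> vars_below k"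
  by (induction j) (auto intro: vars_below_mult)

lemma vars_below_mono: "j \<le> k \<Longrightarrow> vars_below j \<subseteq> vars_below k"
  by (force simp: vars_below_def)

lemma vars_below_ex: "\<exists>k. f \<in> vars_below k"
proof -
  have "finite (\<Union>m\<in>Poly_Mapping.keys f. Poly_Mapping.keys m)" by auto
  then obtain k where "\<forall>v\<in>(\<Union>m\<in>Poly_Mapping.keys f. Poly_Mapping.keys m). v < k"
    using finite_nat_set_iff_bounded by blast
  thus ?thesis by (intro exI[of _ k]) (auto simp: vars_below_def)
qed

lemma vars_below_0_iff: "f \<in> vars_below 0 \<longleftrightarrow> f = pconst (Poly_Mapping.lookup f 0)"
proof
  assume "f \<in> vars_below 0"
  hence "Poly_Mapping.keys f \<subseteq> {0}" by (auto simp: vars_below_def)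
  thus "f = pconst (Poly_Mapping.lookup f 0)"
    by (intro poly_mapping_eqI) (auto simp: pconst_def lookup_single when_def in_keys_iff)
next
  assume "f = pconst (Poly_Mapping.lookup f 0)"
  thus "f \<in> vars_below 0" by (metis vars_below_pconst)
qed

definition coeffs_below :: "nat \<Rightarrow> 'a::field npoly poly set" where
  "coeffs_below k = {p. \<forall>i. coeff p i \<in> vars_below k}"

lemma coeffs_below_add: "f \<in> coeffs_below k \<Longrightarrow> g \<in> coeffs_below k \<Longrightarrow> f + g \<in> coeffs_below k"
  by (auto simp: coeffs_below_def intro: vars_below_add)

lemma coeffs_below_mult: "f \<in> coeffs_below k \<Longrightarrow> g \<in> coeffs_below k \<Longrightarrow> f * g \<in> coeffs_below k"
  by (auto simp: coeffs_below_def coeff_mult intro!: vars_below_sum vars_below_mult)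

lemma coeffs_below_const: "c \<in> vars_below k \<Longrightarrow> [:c:] \<in> coeffs_below k"
  by (auto simp: coeffs_below_def coeff_pCons split: nat.splits)

lemma coeffs_below_sum: "(\<And>x. x \<in> A \<Longrightarrow> f x \<in> coeffs_below k) \<Longrightarrow> sum f A \<in> coeffs_below k"
  by (induction A rule: infinite_finite_induct) (auto intro: coeffs_below_add coeffs_below_const[of 0, simplified])

lemma coeffs_below_prod: "(\<And>x. x \<in> A \<Longrightarrow> f x \<in> coeffs_below k) \<Longrightarrow> prod f A \<in> coeffs_below k"
  by (induction A rule: infinite_finite_induct)
    (auto intro: coeffs_below_mult simp: one_pCons coeffs_below_const)

lemma coeffs_below_power: "f \<in> coeffs_below k \<Longrightarrow> f ^ j \<in> coeffs_below k"
  by (induction j) (auto intro: coeffs_below_mult simp: one_pCons coeffs_below_const)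

text \<open>The coefficient ring stays the full ring of polynomials. That the coefficients really
  involve fewer variables is recorded by \<open>coeffs_below\<close>, which avoids one type for each
  number of variables.\<close>

definition main_var :: "nat \<Rightarrow> 'a::field npoly \<Rightarrow> 'a npoly poly" where
  "main_var k f = cpeval (\<lambda>i. if i = k then [:0, 1:] else [:pvar i:]) f (\<lambda>c. [:pconst c:])"

text \<open>The degree of \<open>scale_above k f\<close> is the total degree of \<open>f\<close> in the variables of index at least \<open>k\<close>.\<close>
definition scale_above :: "nat \<Rightarrow> 'a::field npoly \<Rightarrow> 'a npoly poly" where
  "scale_above k f = cpeval (\<lambda>i. if i < k then [:pvar i:] else [:0, pvar i:]) f (\<lambda>c. [:pconst c:])"

lemma is_hom_pconst_poly [simp]: "is_hom (\<lambda>c. [:pconst c:])"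
  by (rule is_hom_comp[of "\<lambda>c. [:c:]"]) auto

lemma is_hom_main_var [simp]: "is_hom (main_var k)"
  unfolding main_var_def by simp

lemma is_hom_scale_above [simp]: "is_hom (scale_above k)"
  unfolding scale_above_def by simp

lemma poly_main_var: "poly (main_var k f) (pvar k) = f"
  by (rule is_hom_unique[of "\<lambda>f. poly (main_var k f) (pvar k)" "\<lambda>f. f"])
    (simp_all add: is_hom_comp[of "\<lambda>p. poly p (pvar k)"], simp_all add: main_var_def)

lemma poly_scale_above: "poly (scale_above k f) 1 = f"
  by (rule is_hom_unique[of "\<lambda>f. poly (scale_above k f) 1" "\<lambda>f. f"])
    (simp_all add: is_hom_comp[of "\<lambda>p. poly p 1"], simp_all add: scale_above_def)

lemma cpeval_vars_below:
  assumes "f \<in> vars_below k" "is_hom h" "is_hom emb" "\<And>c. h (pconst c) = emb c" "\<And>v. v < k \<Longrightarrow> h (pvar v) = s v"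
  shows "cpeval s f emb = h f"
proof -
  have "cpeval s f emb = cpeval (\<lambda>v. h (pvar v)) f emb"
    unfolding cpeval_def using assms(1,5)
    by (intro sum.cong prod.cong arg_cong2[of _ _ _ _ "(*)"] arg_cong2[of _ _ _ _ "(^)"] refl)
      (force simp: vars_below_def)
  also have "\<dots> = h f"
    by (rule is_hom_unique[of "\<lambda>f. cpeval (\<lambda>v. h (pvar v)) f emb" h]) (auto simp: assms)
  finally show ?thesis .
qed

lemma main_var_below: "f \<in> vars_below k \<Longrightarrow> main_var k f = [:f:]"
  unfolding main_var_def by (rule cpeval_vars_below[where h = "\<lambda>f. [:f:]"]) auto

lemma scale_above_below: "f \<in> vars_below k \<Longrightarrow> scale_above k f = [:f:]"
  unfolding scale_above_def by (rule cpeval_vars_below[where h = "\<lambda>f. [:f:]"]) auto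

lemma main_var_pvar: "main_var k (pvar k) = [:0, 1:]"
  by (simp add: main_var_def)

lemma coeffs_below_main_var:
  assumes "f \<in> vars_below (Suc k)"
  shows "main_var k f \<in> coeffs_below k"
proof -
  have [simp]: "[:0, 1:] \<in> coeffs_below k" by (auto simp: coeffs_below_def coeff_pCons split: nat.splits)
  have "(if i = k then [:0, 1:] else [:pvar i:]) \<in> coeffs_below k"
    if "m \<in> Poly_Mapping.keys f" "i \<in> Poly_Mapping.keys m" for m i
  proof -
    have "i < Suc k" using that assms by (force simp: vars_below_def)
    thus ?thesis by (auto intro!: coeffs_below_const vars_below_pvar)
  qed
  thus ?thesis
    unfolding main_var_def cpeval_def
    by (intro coeffs_below_sum coeffs_below_mult coeffs_below_prod coeffs_below_power)
      (blast intro: coeffs_below_const vars_below_pconst)+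
qed

lemma scale_above_eq_0_iff [simp]: "scale_above k f = 0 \<longleftrightarrow> f = 0"
  using poly_scale_above[of k f] by (auto simp: is_homD(1)[OF is_hom_scale_above])

lemma main_var_eq_0_iff [simp]: "main_var k f = 0 \<longleftrightarrow> f = 0"
  using poly_main_var[of k f] by (auto simp: is_homD(1)[OF is_hom_main_var])

lemma degree_scale_above_mult:
  "f \<noteq> 0 \<Longrightarrow> g \<noteq> 0 \<Longrightarrow> degree (scale_above k (f * g)) = degree (scale_above k f) + degree (scale_above k g)"
  by (simp add: is_homD[OF is_hom_scale_above] degree_mult_eq)

lemma degree_scale_above_eq_0:
  assumes "degree (scale_above k f) = 0"
  shows "f \<in> vars_below k"
proof -
  have "f = poly (scale_above k f) 0"
    using poly_scale_above[of k f] assms by (auto elim!: degree_eq_zeroE)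
  also have "\<dots> = cpeval (\<lambda>i. if i < k then pvar i else 0) f pconst"
    by (rule is_hom_unique[of "\<lambda>f. poly (scale_above k f) 0"])
      (simp_all add: is_hom_comp[of "\<lambda>p. poly p 0"], simp_all add: scale_above_def)
  also have "\<dots> \<in> vars_below k"
    unfolding cpeval_def
    by (intro vars_below_sum vars_below_mult vars_below_prod vars_below_power) (auto intro: vars_below_pvar)
  finally show ?thesis .
qed

text \<open>The degree in the variables from k on is additive, so if it is zero for a nonzero
  product, it is zero for both factors.\<close>

lemma vars_below_divisor:
  assumes "f * g \<in> vars_below k" "f * g \<noteq> 0"
  shows "f \<in> vars_below k" "g \<in> vars_below k"
  using assms degree_scale_above_mult[of f g k] scale_above_below[OF assms(1)]
  by (auto intro!: degree_scale_above_eq_0)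

abbreviation ntdeg :: "'a::field npoly \<Rightarrow> nat" where
  "ntdeg f \<equiv> degree (scale_above 0 f)"

lemma ntdeg_0_unit:
  assumes "f \<noteq> 0" "ntdeg f = 0"
  shows "f dvd 1"
proof -
  define c where "c = Poly_Mapping.lookup f 0"
  have f: "f = pconst c" using degree_scale_above_eq_0[OF assms(2)] by (simp add: vars_below_0_iff c_def)
  hence "c \<noteq> 0" using assms(1) by auto
  hence "f * pconst (inverse c) = 1" unfolding f by (simp flip: is_homD(4)[OF is_hom_pconst])
  thus ?thesis by (metis dvd_triv_left)
qed

lemma unit_ntdeg_0: "f dvd 1 \<Longrightarrow> ntdeg f = 0"
proof -
  assume "f dvd 1"
  then obtain g where "f * g = 1" by (metis dvdE)
  moreover have "ntdeg (1 :: 'a npoly) = 0" by (simp add: is_homD[OF is_hom_scale_above])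
  ultimately show ?thesis using degree_scale_above_mult[of f g 0] by (metis add_is_0 mult_zero_left mult_zero_right zero_neq_one)
qed

lemma ex_irreducible_dvd:
  "a \<noteq> 0 \<Longrightarrow> \<not> a dvd 1 \<Longrightarrow> \<exists>p. irreducible p \<and> p dvd a" for a :: "'a::field npoly"
proof (induction "ntdeg a" arbitrary: a rule: less_induct)
  case less
  show ?case
  proof (cases "irreducible a")
    case False
    then obtain x y where xy: "a = x * y" "\<not> x dvd 1" "\<not> y dvd 1"
      using less.prems by (auto simp: irreducible_def)
    have nz: "x \<noteq> 0" "y \<noteq> 0" using xy less.prems by auto
    have "ntdeg x < ntdeg a"
      using nz xy degree_scale_above_mult[of x y 0] ntdeg_0_unit[of y] by auto
    thus ?thesis using less.hyps[of x] nz xy by auto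
  qed auto
qed

text \<open>Primality of irreducibles is the half of factoriality that calls for induction on the
  number of variables; irreducible factors exist by total degree alone. Irreducibility refers to the
  full ring, which agrees with irreducibility in k variables by
  \<open>vars_below_divisor\<close>.\<close>

definition irred_prime_below :: "'a::field itself \<Rightarrow> nat \<Rightarrow> bool" where
  "irred_prime_below _ k \<longleftrightarrow> (\<forall>p\<in>vars_below k :: 'a npoly set. irreducible p \<longrightarrow>
     (\<forall>a\<in>vars_below k. \<forall>b\<in>vars_below k. p dvd a * b \<longrightarrow> p dvd a \<or> p dvd b))"

lemma dvd_main_var:
  "p \<in> vars_below k \<Longrightarrow> p dvd f \<longleftrightarrow> (\<forall>i. p dvd coeff (main_var k f) i)"
proof -
  assume p: "p \<in> vars_below k"
  have "p dvd f \<longleftrightarrow> [:p:] dvd main_var k f"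
  proof
    assume "p dvd f"
    thus "[:p:] dvd main_var k f"
      by (auto elim!: dvdE simp: is_homD[OF is_hom_main_var] main_var_below p simp del: mult_pCons_left)
  next
    assume "[:p:] dvd main_var k f"
    then obtain q where "main_var k f = [:p:] * q" by (elim dvdE)
    hence "poly (main_var k f) (pvar k) = p * poly q (pvar k)" by simp
    thus "p dvd f" by (simp add: poly_main_var)
  qed
  thus ?thesis by (simp add: const_poly_dvd_iff)
qed

text \<open>Gauss's lemma: a prime of the coefficient ring remains prime after adjoining a
  variable.\<close>

lemma irred_prime_below_lift:
  fixes p :: "'a::field npoly"
  assumes "irred_prime_below TYPE('a) k" "p \<in> vars_below k" "irreducible p"
    "f \<in> vars_below (Suc k)" "g \<in> vars_below (Suc k)" "p dvd f * g"
  shows "p dvd f \<or> p dvd g"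
proof (rule ccontr)
  assume neg: "\<not> (p dvd f \<or> p dvd g)"
  let ?F = "main_var k f" and ?G = "main_var k g"
  \<comment> \<open>First coefficients of the two factors that p does not divide. In the coefficient
    of index i + j of the product, every term except the product of these two contains an earlier
    coefficient and is divisible by p.\<close>
  define i where "i = (LEAST i. \<not> p dvd coeff ?F i)"
  define j where "j = (LEAST i. \<not> p dvd coeff ?G i)"
  have ex: "\<exists>i. \<not> p dvd coeff ?F i" "\<exists>i. \<not> p dvd coeff ?G i"
    using neg dvd_main_var[OF assms(2), of f] dvd_main_var[OF assms(2), of g] by blast+
  have i: "\<not> p dvd coeff ?F i" "\<And>l. l < i \<Longrightarrow> p dvd coeff ?F l"
    unfolding i_def using LeastI_ex[OF ex(1)] not_less_Least by blast+
  have j: "\<not> p dvd coeff ?G j" "\<And>l. l < j \<Longrightarrow> p dvd coeff ?G l"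
    unfolding j_def using LeastI_ex[OF ex(2)] not_less_Least by blast+
  have "p dvd coeff (?F * ?G) (i + j)"
    using iffD1[OF dvd_main_var[OF assms(2)] assms(6), rule_format, of "i + j"]
    by (simp add: is_homD[OF is_hom_main_var])
  hence "p dvd (\<Sum>l\<le>i+j. coeff ?F l * coeff ?G (i + j - l))" by (simp add: coeff_mult)
  also have "(\<Sum>l\<le>i+j. coeff ?F l * coeff ?G (i + j - l)) = coeff ?F i * coeff ?G j
      + (\<Sum>l\<in>{..i+j} - {i}. coeff ?F l * coeff ?G (i + j - l))"
    by (subst sum.remove[of _ i]) auto
  finally have "p dvd coeff ?F i * coeff ?G j + (\<Sum>l\<in>{..i+j} - {i}. coeff ?F l * coeff ?G (i + j - l))" .
  moreover have "p dvd (\<Sum>l\<in>{..i+j} - {i}. coeff ?F l * coeff ?G (i + j - l))"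
  proof (rule dvd_sum)
    fix l assume "l \<in> {..i+j} - {i}"
    hence "l < i \<or> i + j - l < j" by auto
    thus "p dvd coeff ?F l * coeff ?G (i + j - l)" using i(2) j(2) by auto
  qed
  ultimately have "p dvd coeff ?F i * coeff ?G j" by (simp add: dvd_add_left_iff)
  thus False
    using assms(1-3) i(1) j(1) coeffs_below_main_var[OF assms(4)] coeffs_below_main_var[OF assms(5)]
    unfolding irred_prime_below_def coeffs_below_def by blast
qed

text \<open>Stands in for the fraction field of the coefficient ring: c is a denominator and m is
  primitive. By Gauss's lemma each irreducible factor of c divides q, so the factors can be
  cancelled one at a time until c is a unit.\<close>

lemma dvd_cancel_below:
  fixes c f q m :: "'a::field npoly"
  assumes "irred_prime_below TYPE('a) k" "m \<in> vars_below (Suc k)"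
    "\<And>p. p \<in> vars_below k \<Longrightarrow> irreducible p \<Longrightarrow> \<not> p dvd m"
  shows "c \<in> vars_below k \<Longrightarrow> c \<noteq> 0 \<Longrightarrow> q \<in> vars_below (Suc k) \<Longrightarrow> c * f = q * m \<Longrightarrow> m dvd f"
proof (induction "ntdeg c" arbitrary: c q rule: less_induct)
  case less
  show ?case
  proof (cases "c dvd 1")
    case True
    then obtain d where "1 = c * d" by (elim dvdE)
    hence "f = d * q * m" using less.prems(4) by (metis mult.assoc mult.commute mult_1)
    thus ?thesis by simp
  next
    case False
    then obtain p where p: "irreducible p" "p dvd c" using ex_irreducible_dvd less.prems by blast
    then obtain c' where c': "c = p * c'" by (elim dvdE)
    have below: "p \<in> vars_below k" "c' \<in> vars_below k"
      using vars_below_divisor[of p c' k] less.prems c' by auto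
    have nz: "p \<noteq> 0" "c' \<noteq> 0" using less.prems c' by auto
    have "p dvd q * m" using less.prems(4) c' by (metis dvd_triv_left mult.assoc)
    hence "p dvd q" using irred_prime_below_lift[OF assms(1) below(1) p(1) less.prems(3) assms(2)] assms(3) below p by blast
    then obtain q' where q': "q = p * q'" by (elim dvdE)
    have "q' \<in> vars_below (Suc k)"
      by (cases "q' = 0") (use vars_below_divisor[of p q' "Suc k"] less.prems q' nz in auto)
    moreover have "c' * f = q' * m" using less.prems(4) nz unfolding c' q' by (simp add: mult.assoc)
    moreover have "ntdeg c' < ntdeg c"
      using nz c' degree_scale_above_mult[of p c' 0] ntdeg_0_unit[of p] p(1) by (auto simp: irreducible_def)
    ultimately show ?thesis using less.hyps[of c' q'] below nz by auto
  qed
qed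

text \<open>Division with remainder over the fraction field of the coefficients, with the
  denominator c cleared. Multiplying f by the leading coefficient of m allows its leading term to be
  cancelled.\<close>

lemma pseudo_division:
  fixes m :: "'a::field npoly"
  assumes "m \<in> vars_below (Suc k)" "m \<noteq> 0"
  shows "f \<in> vars_below (Suc k) \<Longrightarrow> \<exists>c q r. c \<in> vars_below k \<and> c \<noteq> 0 \<and> q \<in> vars_below (Suc k) \<and> r \<in> vars_below (Suc k)
    \<and> c * f = q * m + r \<and> (r = 0 \<or> degree (main_var k r) < degree (main_var k m))"
proof (induction "degree (main_var k f)" arbitrary: f rule: less_induct)
  case less
  let ?d = "\<lambda>f. degree (main_var k f)"
  have below: "x \<in> vars_below (Suc k)" if "x \<in> vars_below k" for x :: "'a npoly"
    using that vars_below_mono[of k "Suc k"] by auto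
  show ?case
  proof (cases "f = 0 \<or> ?d f < ?d m")
    case True
    thus ?thesis using less.prems by - (rule exI[of _ 1], rule exI[of _ 0], rule exI[of _ f], auto)
  next
    case False
    define lm where "lm = lead_coeff (main_var k m)"
    define lf where "lf = lead_coeff (main_var k f)"
    define e where "e = ?d f - ?d m"
    define g where "g = lm * f - lf * pvar k ^ e * m"
    have lmb: "lm \<in> vars_below k" "lf \<in> vars_below k"
      using coeffs_below_main_var assms less.prems by (auto simp: lm_def lf_def coeffs_below_def)
    have nz: "lm \<noteq> 0" "lf \<noteq> 0" using assms False by (auto simp: lm_def lf_def)
    have gb: "g \<in> vars_below (Suc k)"
      unfolding g_def by (intro vars_below_diff vars_below_mult vars_below_power below lmb less.prems assms vars_below_pvar) auto
    have lb: "lf * pvar k ^ e \<in> vars_below (Suc k)"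
      using lmb below by (intro vars_below_mult vars_below_power vars_below_pvar) auto
    have mg: "main_var k g = smult lm (main_var k f) - smult lf (monom 1 e * main_var k m)"
      unfolding g_def
      by (simp add: is_homD[OF is_hom_main_var] is_hom_diff[OF is_hom_main_var] is_hom_power[OF is_hom_main_var]
           main_var_below lmb main_var_pvar monom_altdef)
    have dg: "g = 0 \<or> ?d g < ?d f"
    proof (cases "g = 0")
      case False
      hence nz': "main_var k g \<noteq> 0" by simp
      have "coeff (main_var k g) (?d f) = lm * lf - lf * lm"
        using \<open>\<not> (f = 0 \<or> ?d f < ?d m)\<close>
        by (simp add: mg coeff_monom_mult e_def lm_def lf_def)
      hence c0: "coeff (main_var k g) (?d f) = 0" by simp
      have "?d g \<le> ?d f" unfolding mg
        using \<open>\<not> (f = 0 \<or> ?d f < ?d m)\<close>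
        by (intro degree_diff_le) (auto simp: degree_smult_le intro: order.trans[OF degree_smult_le]
           order.trans[OF degree_mult_le] simp: degree_monom_eq e_def)
      moreover have "?d g \<noteq> ?d f" using c0 nz' by (metis leading_coeff_0_iff)
      ultimately show ?thesis by auto
    qed auto
    show ?thesis
    proof (cases "g = 0")
      case True
      hence "lm * f = lf * pvar k ^ e * m + 0" by (simp add: g_def)
      thus ?thesis using lmb nz
        by - (rule exI[of _ lm], rule exI[of _ "lf * pvar k ^ e"], rule exI[of _ 0], simp add: lb)
    next
      case False
      then obtain c q r where IH: "c \<in> vars_below k" "c \<noteq> 0" "q \<in> vars_below (Suc k)" "r \<in> vars_below (Suc k)"
        "c * g = q * m + r" "r = 0 \<or> ?d r < ?d m"
        using less.hyps[of g] gb dg by blast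
      have "c * lm * f = (q + c * (lf * pvar k ^ e)) * m + r"
        using IH(5) by (simp add: g_def algebra_simps)
      thus ?thesis using IH nz lmb
        by - (rule exI[of _ "c * lm"], rule exI[of _ "q + c * (lf * pvar k ^ e)"], rule exI[of _ r],
            simp add: lb vars_below_add vars_below_mult below)
    qed
  qed
qed

text \<open>If p is free of the new variable, this is Gauss's lemma. Otherwise consider the y with
  \<open>p dvd a * y\<close>: over the fraction field of the coefficients they form a principal
  ideal, and a primitive generator m divides each such y already in the ring. As p and b are among
  them, m divides both; m is not a unit since p does not divide a, so it is associated to p.\<close>

lemma irred_prime_below_Suc:
  assumes IH: "irred_prime_below TYPE('a::field) k"
  shows "irred_prime_below TYPE('a) (Suc k)"
  unfolding irred_prime_below_def
proof (intro ballI impI)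
  fix p a b :: "'a npoly"
  assume p: "p \<in> vars_below (Suc k)" "irreducible p" and a: "a \<in> vars_below (Suc k)"
    and b: "b \<in> vars_below (Suc k)" and dvd: "p dvd a * b"
  let ?d = "\<lambda>f. degree (main_var k f)"
  show "p dvd a \<or> p dvd b"
  proof (cases "p \<in> vars_below k")
    case True
    thus ?thesis using irred_prime_below_lift[OF IH True] p a b dvd by blast
  next
    case pk: False
    have "p dvd b" if na: "\<not> p dvd a"
    proof -
      have a0: "a \<noteq> 0" using na by auto
      define J where "J = (\<lambda>y. y \<in> vars_below (Suc k) \<and> y \<noteq> 0 \<and> p dvd a * y)"
      have "J p" using p by (auto simp: J_def irreducible_def)
      then obtain m0 where m0: "J m0" "\<And>y. J y \<Longrightarrow> ?d m0 \<le> ?d y"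
        using ex_has_least_nat[of J p ?d] by auto
      hence "J m0 \<and> ?d m0 = ?d m0" by simp
      \<comment> \<open>Degree in the new variable is minimised first, total degree second. The
        first makes m a generator up to denominators; the second makes it primitive, since an
        irreducible factor free of the new variable could be divided out and would lower the total
        degree.\<close>
      then obtain m where m: "J m" "?d m = ?d m0" "\<And>y. J y \<Longrightarrow> ?d y = ?d m0 \<Longrightarrow> ntdeg m \<le> ntdeg y"
        using ex_has_least_nat[of "\<lambda>y. J y \<and> ?d y = ?d m0" m0 ntdeg] by auto
      have mb: "m \<in> vars_below (Suc k)" "m \<noteq> 0" "p dvd a * m" using m by (auto simp: J_def)
      have prim: "\<not> q dvd m" if q: "q \<in> vars_below k" "irreducible q" for q
      proof
        assume "q dvd m"
        then obtain m' where m': "m = q * m'" by (elim dvdE)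
        obtain z where z: "a * m = p * z" using mb(3) by (elim dvdE)
        have zb: "z \<in> vars_below (Suc k)"
          using vars_below_divisor[of p z "Suc k"] vars_below_mult[OF a mb(1)] a0 mb(2) z
          by (metis mult_eq_0_iff)
        have q0: "q \<noteq> 0" using q by auto
        have "q dvd p * z" using z m' by (metis dvd_triv_left dvd_mult)
        hence "q dvd p \<or> q dvd z"
          using irred_prime_below_lift[OF IH q p(1) zb] by blast
        moreover have "\<not> q dvd p"
        proof
          assume "q dvd p"
          then obtain u where u: "p = q * u" by (elim dvdE)
          hence "u dvd 1" using p(2) q(2) by (metis irreducibleD irreducible_not_unit)
          hence "u \<in> vars_below 0" using degree_scale_above_eq_0 unit_ntdeg_0 by blast
          hence "u \<in> vars_below k" using vars_below_mono[of 0 k] by auto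
          thus False using pk u vars_below_mult[OF q(1)] by blast
        qed
        ultimately obtain z' where "z = q * z'" by (auto elim!: dvdE)
        hence "a * m' = p * z'" using z m' q0 by simp
        moreover have "m' \<noteq> 0" "m' \<in> vars_below (Suc k)"
          using mb m' vars_below_divisor[of q m' "Suc k"] by auto
        ultimately have J: "J m'" by (auto simp: J_def)
        have "?d m = ?d m'" using m' mb(2) q
          by (simp add: is_homD[OF is_hom_main_var] main_var_below)
        moreover have "ntdeg m' < ntdeg m"
          using mb m' degree_scale_above_mult[of q m' 0] ntdeg_0_unit[of q] q(2) by (auto simp: irreducible_def)
        ultimately show False using m(2,3) J by fastforce
      qed
      have mdvd: "m dvd y" if y: "y \<in> vars_below (Suc k)" "p dvd a * y" for y
      proof -
        obtain c q r where c: "c \<in> vars_below k" "c \<noteq> 0" "q \<in> vars_below (Suc k)" "r \<in> vars_below (Suc k)"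
           "c * y = q * m + r" "r = 0 \<or> ?d r < ?d m"
          using pseudo_division[OF mb(1,2) y(1)] by blast
        have "a * r = c * (a * y) - q * (a * m)" using c(5) by (simp add: algebra_simps)
        hence "p dvd a * r" using y(2) mb(3) by (simp add: dvd_diff)
        hence "r = 0" using c(4,6) m0(2)[of r] m(2) unfolding J_def by (metis leD)
        thus ?thesis using dvd_cancel_below[OF IH mb(1) prim c(1,2,3)] c(5) by auto
      qed
      obtain u where u: "p = m * u" using mdvd[OF p(1)] by (auto elim: dvdE)
      hence "m dvd 1 \<or> u dvd 1" using p(2) by (auto simp: irreducible_def)
      moreover have "\<not> m dvd 1" proof
        assume "m dvd 1"
        hence "a * m dvd a * 1" by (intro mult_dvd_mono) auto
        thus False using mb(3) na by (metis dvd_trans mult_1_right)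
      qed
      ultimately have "u dvd 1" by simp
      then obtain u' where "1 = u * u'" by (elim dvdE)
      hence "m = p * u'" using u by (simp add: mult.assoc)
      thus "p dvd b" using mdvd[OF b dvd] by auto
    qed
    thus ?thesis by blast
  qed
qed

lemma irred_prime_below: "irred_prime_below TYPE('a::field) k"
proof (induction k)
  case 0
  show ?case unfolding irred_prime_below_def
  proof (intro ballI impI)
    fix p a b :: "'a npoly"
    assume "p \<in> vars_below 0" "irreducible p"
    thus "p dvd a \<or> p dvd b"
      using scale_above_below[of p 0] ntdeg_0_unit[of p] by (auto simp: irreducible_def)
  qed
qed (rule irred_prime_below_Suc)

lemma irreducible_prime:
  fixes p :: "'a::field npoly"
  assumes "irreducible p" "p dvd a * b"
  shows "p dvd a \<or> p dvd b"
proof -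
  obtain i j l where "p \<in> vars_below i" "a \<in> vars_below j" "b \<in> vars_below l" using vars_below_ex by metis
  hence "p \<in> vars_below (i + j + l)" "a \<in> vars_below (i + j + l)" "b \<in> vars_below (i + j + l)"
    using vars_below_mono[of i "i + j + l"] vars_below_mono[of j "i + j + l"] vars_below_mono[of l "i + j + l"] by auto
  thus ?thesis using irred_prime_below[where 'a = 'a, of "i + j + l"] assms unfolding irred_prime_below_def by blast
qed

lemma coprime_dvd_cancel:
  fixes a b :: "'a::field npoly"
  shows "b \<noteq> 0 \<Longrightarrow> (\<And>p. irreducible p \<Longrightarrow> p dvd a \<Longrightarrow> \<not> p dvd b) \<Longrightarrow> b dvd a * x \<Longrightarrow> b dvd x"
proof (induction "ntdeg b" arbitrary: b x rule: less_induct)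
  case less
  show ?case
  proof (cases "b dvd 1")
    case False
    then obtain p where p: "irreducible p" "p dvd b" using ex_irreducible_dvd less.prems by blast
    then obtain b' where b': "b = p * b'" by (elim dvdE)
    have nz: "p \<noteq> 0" "b' \<noteq> 0" using less.prems b' by auto
    have "p dvd a * x" using less.prems(3) p(2) by auto
    hence "p dvd x" using irreducible_prime p less.prems(2) by blast
    then obtain x' where x': "x = p * x'" by (elim dvdE)
    have "b' dvd a * x'" using less.prems(3) nz unfolding b' x' by (simp add: mult.left_commute)
    moreover have "ntdeg b' < ntdeg b"
      using nz b' degree_scale_above_mult[of p b' 0] ntdeg_0_unit[of p] p(1) by (auto simp: irreducible_def)
    ultimately have "b' dvd x'" using less.hyps[of b' x'] nz less.prems(2) unfolding b' by (metis dvd_mult)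
    thus ?thesis unfolding b' x' by simp
  qed (auto intro: dvd_trans[of _ 1])
qed

text \<open>The generator is b divided by the greatest common divisor of a and b, reached by
  cancelling common irreducible factors. Everything later draws on factoriality only in this
  form.\<close>

lemma colon_ideal_principal_npoly:
  fixes a b :: "'a::field npoly"
  shows "b \<noteq> 0 \<Longrightarrow> \<exists>m. \<forall>x. b dvd a * x \<longleftrightarrow> m dvd x"
proof (induction "ntdeg b" arbitrary: a b rule: less_induct)
  case less
  show ?case
  proof (cases "\<exists>p. irreducible p \<and> p dvd a \<and> p dvd b")
    case False
    hence "b dvd a * x \<longleftrightarrow> b dvd x" for x using coprime_dvd_cancel[of b a x] less.prems by auto
    thus ?thesis by blast
  next
    case True
    then obtain p a' b' where p: "irreducible p" "a = p * a'" "b = p * b'" by (auto elim!: dvdE)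
    have nz: "p \<noteq> 0" "b' \<noteq> 0" using less.prems p by auto
    have "ntdeg b' < ntdeg b"
      using nz p degree_scale_above_mult[of p b' 0] ntdeg_0_unit[of p] by (auto simp: irreducible_def)
    then obtain m where "\<forall>x. b' dvd a' * x \<longleftrightarrow> m dvd x" using less.hyps[of b' a'] nz by auto
    thus ?thesis using nz unfolding p by (auto simp: mult.assoc)
  qed
qed

text \<open>A field of characteristic 0 is infinite, so the last variable can be specialised to all
  values and the coefficients treated by induction.\<close>

lemma npoly_eq_0:
  fixes f :: "'a::field_char_0 npoly"
  shows "f \<in> vars_below k \<Longrightarrow> (\<And>s. cpeval s f id = 0) \<Longrightarrow> f = 0"
proof (induction k arbitrary: f)
  case 0
  then obtain c where "f = pconst c" by (metis vars_below_0_iff)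
  thus ?case using "0.prems"(2)[of "\<lambda>_. 0"] by simp
next
  case (Suc k)
  have cb: "coeff (main_var k f) i \<in> vars_below k" for i
    using coeffs_below_main_var[OF Suc.prems(1)] by (auto simp: coeffs_below_def)
  have "coeff (main_var k f) i = 0" for i
  proof (rule Suc.IH[OF cb])
    fix s :: "nat \<Rightarrow> 'a"
    let ?p = "map_poly (\<lambda>c. cpeval s c id) (main_var k f)"
    have "poly ?p y = 0" for y
    proof -
      let ?e = "\<lambda>c. cpeval (s(k := y)) c id"
      have hom: "is_hom ?e" by simp
      have e: "?e c = cpeval s c id" if "c \<in> vars_below k" for c
        by (rule cpeval_vars_below[OF that]) auto
      have "0 = ?e (poly (main_var k f) (pvar k))" unfolding poly_main_var Suc.prems(2) ..
      also have "\<dots> = (\<Sum>i\<le>degree (main_var k f). ?e (coeff (main_var k f) i) * y ^ i)"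
        unfolding poly_altdef by (simp add: is_hom_sum[OF hom] is_homD[OF hom] is_hom_power[OF hom])
      also have "\<dots> = (\<Sum>i\<le>degree (main_var k f). coeff ?p i * y ^ i)"
        by (simp add: e cb coeff_map_poly)
      also have "\<dots> = poly ?p y"
        unfolding poly_altdef
        by (intro sum.mono_neutral_right) (auto simp: coeff_eq_0 map_poly_degree_leq)
      finally show ?thesis by simp
    qed
    hence "?p = 0" using poly_all_0_iff_0[of ?p] by simp
    hence "coeff ?p i = 0" by simp
    thus "cpeval s (coeff (main_var k f) i) id = 0" by (simp add: coeff_map_poly)
  qed
  hence "main_var k f = 0" by (intro poly_eqI) simp
  thus ?case by simp
qed

section \<open>Polynomials in an arbitrary countable set of variables\<close>

type_synonym ('v, 'a) mpoly = "('v \<Rightarrow>\<^sub>0 nat) \<Rightarrow>\<^sub>0 'a"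

definition to_np :: "('v::countable, 'a::comm_ring_1) mpoly \<Rightarrow> 'a npoly" where
  "to_np f = cpeval (\<lambda>v. pvar (to_nat v)) f pconst"

text \<open>Only a left inverse of \<open>to_np\<close>, as \<open>to_nat\<close> need not be onto.
  Divisibility is therefore pulled back along \<open>to_np\<close>, while quotients and generators
  are brought back by this map.\<close>

definition of_np :: "'a::comm_ring_1 npoly \<Rightarrow> ('v::countable, 'a) mpoly" where
  "of_np f = cpeval (\<lambda>i. pvar (from_nat i)) f pconst"

lemma is_hom_to_np [simp]: "is_hom to_np" and is_hom_of_np [simp]: "is_hom of_np"
  unfolding to_np_def[abs_def] of_np_def[abs_def] by simp_all

lemma of_to_np [simp]: "of_np (to_np f) = f"
  by (rule is_hom_unique[of "\<lambda>f. of_np (to_np f)" "\<lambda>f. f"])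
    (simp_all add: is_hom_comp[of of_np], simp_all add: to_np_def of_np_def)

lemma to_np_eq_0_iff [simp]: "to_np f = 0 \<longleftrightarrow> f = 0"
  by (metis of_to_np is_homD(1) is_hom_to_np)

lemma mpoly_no_zero_divisors:
  fixes a b :: "('v::countable, 'a::field) mpoly"
  assumes "a * b = 0"
  shows "a = 0 \<or> b = 0"
  using assms is_homD(4)[OF is_hom_to_np, of a b] by (metis mult_eq_0_iff to_np_eq_0_iff)

lemma mpoly_mult_left_cancel:
  fixes a b c :: "('v::countable, 'a::field) mpoly"
  assumes "a * b = a * c" "a \<noteq> 0"
  shows "b = c"
  using mpoly_no_zero_divisors[of a "b - c"] assms by (auto simp: algebra_simps)

lemma to_np_dvd_iff: "to_np a dvd to_np b \<longleftrightarrow> a dvd b"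
proof
  assume "to_np a dvd to_np b"
  then obtain c where "to_np b = to_np a * c" by (elim dvdE)
  hence "b = a * of_np c" by (metis is_homD(4) is_hom_of_np of_to_np)
  thus "a dvd b" by simp
qed (auto elim!: dvdE simp: is_homD[OF is_hom_to_np])

lemma colon_ideal_principal:
  fixes a b :: "('v::countable, 'a::field) mpoly"
  assumes "b \<noteq> 0"
  shows "\<exists>m. \<forall>x. b dvd a * x \<longleftrightarrow> m dvd x"
proof -
  obtain M where M: "\<And>x. to_np b dvd to_np a * x \<longleftrightarrow> M dvd x"
    using colon_ideal_principal_npoly[of "to_np b" "to_np a"] assms by auto
  have *: "b dvd a * x \<longleftrightarrow> M dvd to_np x" for x
    using M[of "to_np x"] by (simp flip: is_homD(4)[OF is_hom_to_np] add: to_np_dvd_iff)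
  have "M dvd to_np x \<longleftrightarrow> of_np M dvd x" for x :: "('v, 'a) mpoly"
  proof
    assume "M dvd to_np x"
    then obtain c where "to_np x = M * c" by (elim dvdE)
    hence "x = of_np M * of_np c" by (metis is_homD(4) is_hom_of_np of_to_np)
    thus "of_np M dvd x" by simp
  next
    assume "of_np M dvd x"
    \<comment> \<open>\<open>to_np (of_np M)\<close> may differ from M. It is still a multiple of M:
      applying \<open>of_np\<close> to the relation below shows that \<open>of_np M\<close> lies in
      the colon ideal, and \<open>to_np\<close> carries this back.\<close>
    have "to_np b dvd to_np a * M" using M by simp
    then obtain c where "to_np a * M = to_np b * c" by (elim dvdE)
    hence "(of_np (to_np a * M) :: ('v, 'a) mpoly) = of_np (to_np b * c)" by simp
    hence "a * of_np M = b * of_np c" by (simp add: is_homD[OF is_hom_of_np])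
    hence "M dvd to_np (of_np M :: ('v, 'a) mpoly)" using *[of "of_np M"] by auto
    also have "to_np (of_np M :: ('v, 'a) mpoly) dvd to_np x" using \<open>of_np M dvd x\<close> by (simp add: to_np_dvd_iff)
    finally show "M dvd to_np x" .
  qed
  thus ?thesis using * by blast
qed

lemma mpoly_eq_0:
  fixes f :: "('v::countable, 'a::field_char_0) mpoly"
  assumes "\<And>s. cpeval s f id = 0"
  shows "f = 0"
proof -
  have "cpeval s (to_np f) id = cpeval (\<lambda>v. s (to_nat v)) f id" for s
    by (rule is_hom_unique[of "\<lambda>f. cpeval s (to_np f) id"])
      (simp_all add: is_hom_comp[of "\<lambda>f. cpeval s f id" to_np], simp_all add: to_np_def)
  thus ?thesis using npoly_eq_0[of "to_np f"] vars_below_ex[of "to_np f"] assms by auto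
qed

text \<open>Scaling all variables by a parameter; the coefficients of the resulting polynomial in
  that parameter are the homogeneous components of f.\<close>

definition homogenise :: "('v, 'a::comm_ring_1) mpoly \<Rightarrow> ('v, 'a) mpoly poly" where
  "homogenise f = cpeval (\<lambda>v. [:0, pvar v:]) f (\<lambda>c. [:pconst c:])"

lemma is_hom_homogenise [simp]: "is_hom homogenise"
  unfolding homogenise_def[abs_def] by simp

lemma poly_homogenise_1: "poly (homogenise f) 1 = f"
  by (rule is_hom_unique[of "\<lambda>f. poly (homogenise f) 1" "\<lambda>f. f"])
    (simp_all add: is_hom_comp[of "\<lambda>p. poly p 1"], simp_all add: homogenise_def)

lemma poly_homogenise_0: "poly (homogenise f) 0 = pconst (cpeval (\<lambda>_. 0) f id)"
  by (rule is_hom_unique[of "\<lambda>f. poly (homogenise f) 0" "\<lambda>f. pconst (cpeval (\<lambda>_. 0) f id)"])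
    (simp_all add: is_hom_comp[of "\<lambda>p. poly p 0"] is_hom_comp[of pconst "\<lambda>f. cpeval (\<lambda>_. 0) f id"],
     simp_all add: homogenise_def)

abbreviation tdeg :: "('v, 'a::comm_ring_1) mpoly \<Rightarrow> nat" where
  "tdeg f \<equiv> degree (homogenise f)"

lemma homogenise_eq_0_iff: "homogenise f = 0 \<longleftrightarrow> f = 0"
  using poly_homogenise_1[of f] by (auto simp: is_homD(1)[OF is_hom_homogenise])

lemma tdeg_mult:
  fixes f g :: "('v::countable, 'a::field) mpoly"
  assumes "f \<noteq> 0" "g \<noteq> 0"
  shows "tdeg (f * g) = tdeg f + tdeg g"
proof -
  have "coeff (homogenise f * homogenise g) (tdeg f + tdeg g) \<noteq> 0"
    unfolding coeff_mult_degree_sum using assms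
    by (auto dest!: mpoly_no_zero_divisors simp: homogenise_eq_0_iff)
  hence "tdeg f + tdeg g \<le> degree (homogenise f * homogenise g)" by (rule le_degree)
  moreover have "degree (homogenise f * homogenise g) \<le> tdeg f + tdeg g" by (rule degree_mult_le)
  ultimately show ?thesis by (simp add: is_homD[OF is_hom_homogenise])
qed

lemma tdeg_0: "tdeg f = 0 \<Longrightarrow> \<exists>c. f = pconst c"
  using poly_homogenise_1[of f] poly_homogenise_0[of f] by (auto elim!: degree_eq_zeroE)

text \<open>The derivation with \<open>pvar v \<mapsto> d v\<close> is the first-order part of a homomorphism to the dual numbers.\<close>
definition deriv_by :: "('v \<Rightarrow> ('v, 'a::comm_ring_1) mpoly) \<Rightarrow> ('v, 'a) mpoly \<Rightarrow> ('v, 'a) mpoly" where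
  "deriv_by d f = coeff (cpeval (\<lambda>v. [:pvar v, d v:]) f (\<lambda>c. [:pconst c:])) 1"

lemma deriv_by_pvar [simp]: "deriv_by d (pvar v) = d v"
  by (simp add: deriv_by_def)

lemma deriv_by_pconst [simp]: "deriv_by d (pconst c) = 0"
  by (simp add: deriv_by_def)

lemma deriv_by_0 [simp]: "deriv_by d 0 = 0" and deriv_by_1 [simp]: "deriv_by d 1 = 0"
  using deriv_by_pconst[of d 0] deriv_by_pconst[of d 1] by simp_all

lemma deriv_by_add: "deriv_by d (f + g) = deriv_by d f + deriv_by d g"
  by (simp add: deriv_by_def cpeval_add)

lemma deriv_by_mult: "deriv_by d (f * g) = deriv_by d f * g + f * deriv_by d g"
proof -
  let ?h = "\<lambda>f. cpeval (\<lambda>v. [:pvar v, d v:]) f (\<lambda>c. [:pconst c:])"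
  have "poly (?h f) 0 = f" for f
    by (rule is_hom_unique[of "\<lambda>f. poly (?h f) 0" "\<lambda>f. f"])
      (simp_all add: is_hom_comp[of "\<lambda>p. poly p 0" ?h])
  hence 0: "coeff (?h f) 0 = f" for f by (simp add: poly_0_coeff_0)
  have "coeff (?h f * ?h g) 1 = coeff (?h f) 0 * coeff (?h g) 1 + coeff (?h f) 1 * coeff (?h g) 0"
    by (simp add: coeff_mult)
  thus ?thesis unfolding deriv_by_def by (simp add: cpeval_mult 0)
qed

lemma deriv_by_uminus: "deriv_by d (- f) = - deriv_by d f"
  by (metis deriv_by_0 deriv_by_add add.right_inverse neg_eq_iff_add_eq_0)

lemma deriv_by_diff: "deriv_by d (f - g) = deriv_by d f - deriv_by d g"
  by (metis diff_conv_add_uminus deriv_by_add deriv_by_uminus)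

lemma deriv_by_sum: "deriv_by d (\<Sum>x\<in>A. f x) = (\<Sum>x\<in>A. deriv_by d (f x))"
  by (induction A rule: infinite_finite_induct) (auto simp: deriv_by_add)

lemma deriv_by_prod:
  "finite A \<Longrightarrow> deriv_by d (\<Prod>x\<in>A. f x) = (\<Sum>x\<in>A. deriv_by d (f x) * (\<Prod>y\<in>A - {x}. f y))"
proof (induction A rule: finite_induct)
  case (insert x A)
  have "f x * (deriv_by d (f y) * (\<Prod>z\<in>A - {y}. f z)) = deriv_by d (f y) * (\<Prod>z\<in>insert x A - {y}. f z)"
    if "y \<in> A" for y
  proof -
    have "insert x A - {y} = insert x (A - {y})" using insert that by auto
    thus ?thesis using insert by (simp add: mult_ac)
  qed
  moreover have "insert x A - {x} = A" using insert by auto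
  ultimately show ?case using insert
    by (simp add: deriv_by_mult sum_distrib_left)
qed auto

text \<open>A derivation that sends variables to linear forms maps each homogeneous component to one
  of the same degree.\<close>

lemma tdeg_deriv_by:
  assumes "\<And>v k. coeff (homogenise (d v)) k = (if k = 1 then d v else 0)"
  shows "tdeg (deriv_by d f) \<le> tdeg f"
proof -
  have "coeff (homogenise (deriv_by d f)) k = deriv_by d (coeff (homogenise f) k)" for k
  proof (induction f arbitrary: k rule: mpoly_induct)
    case (const c)
    have "homogenise (pconst c :: ('a, 'b) mpoly) = [:pconst c:]" by (simp add: homogenise_def)
    thus ?case by (cases k) (auto simp: is_homD(1)[OF is_hom_homogenise])
  next
    case (var v)
    have *: "homogenise (pvar v :: ('a, 'b) mpoly) = [:0, pvar v:]" by (simp add: homogenise_def)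
    show ?case by (auto simp: assms * coeff_pCons split: nat.splits)
  next
    case (add p q)
    thus ?case by (simp add: deriv_by_add is_homD[OF is_hom_homogenise])
  next
    case (mult p q)
    thus ?case
      by (simp add: deriv_by_mult is_homD[OF is_hom_homogenise] coeff_mult deriv_by_sum sum.distrib)
  qed
  thus ?thesis by (intro degree_le) (auto simp: coeff_eq_0)
qed

section \<open>Relations between words in generic matrices\<close>

lemma cvar_pvar: "cvar = pvar"
  by (auto simp: cvar_def pvar_def)

lemma cconst_pconst: "cconst = pconst"
  by (auto simp: cconst_def pconst_def)

lemma wordmat_Nil [simp]: "wordmat A [] = mat 1"
  by (simp add: wordmat_def)

lemma wordmat_Cons [simp]: "wordmat A (k # w) = A k ** wordmat A w"
  by (simp add: wordmat_def)

lemma is_hom_wordmat: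
  assumes "is_hom h" "\<And>k i j. h (A k $ i $ j) = B k $ i $ j"
  shows "h (wordmat A w $ i $ j) = wordmat B w $ i $ j"
proof (induction w arbitrary: i j)
  case Nil
  show ?case by (simp add: mat_def is_homD[OF assms(1)])
next
  case (Cons k w)
  thus ?case
    by (simp add: matrix_matrix_mult_def is_hom_sum[OF assms(1)] is_homD[OF assms(1)] assms(2))
qed

abbreviation qentry :: "nat list \<Rightarrow> 'n \<Rightarrow> 'n \<Rightarrow> ('a::comm_ring_1, 'n::finite) cpoly" where
  "qentry w i j \<equiv> wordmat generic w $ i $ j"

definition is_relation :: "nat \<Rightarrow> (nat \<Rightarrow> nat list) \<Rightarrow> (nat \<Rightarrow> ('a::comm_ring_1, 'n::finite) cpoly) \<Rightarrow> bool" where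
  "is_relation t M \<mu> \<longleftrightarrow> (\<forall>i j. (\<Sum>s\<in>{0..t}. \<mu> s * qentry (M s) i j) = 0)"

definition point :: "(nat \<Rightarrow> 'a^'n^'n) \<Rightarrow> nat \<times> 'n \<times> 'n \<Rightarrow> 'a" where
  "point A = (\<lambda>(k, i, j). A k $ i $ j)"

lemma cpeval_qentry:
  "is_hom emb \<Longrightarrow> cpeval (point A) (qentry w i j) emb = wordmat A w $ i $ j"
  by (rule is_hom_wordmat) (auto simp: generic_def cvar_pvar point_def)

lemma qeval_eq:
  assumes "finite K" "Poly_Mapping.keys P \<subseteq> K"
  shows "qeval A P $ i $ j = (\<Sum>w\<in>K. cpeval (point A) (Poly_Mapping.lookup P w) id * wordmat A w $ i $ j)"
proof -
  have "qeval A P $ i $ j = (\<Sum>w\<in>Poly_Mapping.keys P. cpeval (point A) (Poly_Mapping.lookup P w) id * wordmat A w $ i $ j)"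
    by (simp add: qeval_def msmult_def point_def)
  also have "\<dots> = (\<Sum>w\<in>K. cpeval (point A) (Poly_Mapping.lookup P w) id * wordmat A w $ i $ j)"
    using assms by (intro sum.mono_neutral_left) (auto simp: in_keys_iff)
  finally show ?thesis .
qed

lemma qeval_sum_single:
  assumes "finite S"
  shows "qeval A (\<Sum>s\<in>S. Poly_Mapping.single (M s) (\<mu> s)) $ i $ j
    = (\<Sum>s\<in>S. cpeval (point A) (\<mu> s) id * wordmat A (M s) $ i $ j)"
proof -
  let ?e = "\<lambda>p. cpeval (point A) p id"
  \<comment> \<open>The words \<open>M s\<close> may coincide (\<open>M 0\<close> can equal another
    one), so the sum is grouped by the fibres of M.\<close>
  have "qeval A (\<Sum>s\<in>S. Poly_Mapping.single (M s) (\<mu> s)) $ i $ j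
     = (\<Sum>w\<in>M ` S. ?e (\<Sum>s\<in>S. Poly_Mapping.lookup (Poly_Mapping.single (M s) (\<mu> s)) w) * wordmat A w $ i $ j)"
    using assms keys_sum[of "\<lambda>s. Poly_Mapping.single (M s) (\<mu> s)" S]
    by (subst qeval_eq[where K = "M ` S"]) (auto simp: lookup_sum split: if_splits)
  also have "\<dots> = (\<Sum>w\<in>M ` S. \<Sum>s\<in>S. ?e (if M s = w then \<mu> s else 0) * wordmat A w $ i $ j)"
    by (simp add: cpeval_sum sum_distrib_right lookup_single when_def)
  also have "\<dots> = (\<Sum>s\<in>S. \<Sum>w\<in>M ` S. if M s = w then ?e (\<mu> s) * wordmat A w $ i $ j else 0)"
    by (subst sum.swap) (intro sum.cong; simp)
  also have "\<dots> = (\<Sum>s\<in>S. ?e (\<mu> s) * wordmat A (M s) $ i $ j)"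
    using assms by (intro sum.cong) auto
  finally show ?thesis .
qed

lemma ex_point: "\<exists>A. s = point A"
  by (rule exI[of _ "\<lambda>k. \<chi> i j. s (k, i, j)"]) (auto simp: point_def)

lemma quasi_identity_imp_relation:
  fixes \<mu> :: "nat \<Rightarrow> ('a::field_char_0, 'n::finite) cpoly"
  assumes "quasi_identity (\<Sum>s\<in>{0..t}. Poly_Mapping.single (M s) (\<mu> s))"
  shows "is_relation t M \<mu>"
  unfolding is_relation_def
proof (intro allI mpoly_eq_0)
  fix i j and s :: "nat \<times> 'n \<times> 'n \<Rightarrow> 'a"
  obtain A where s: "s = point A" using ex_point by blast
  have "cpeval s (\<Sum>s\<in>{0..t}. \<mu> s * qentry (M s) i j) id
     = qeval A (\<Sum>s\<in>{0..t}. Poly_Mapping.single (M s) (\<mu> s)) $ i $ j"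
    unfolding s by (subst qeval_sum_single) (simp_all add: cpeval_sum cpeval_mult cpeval_qentry)
  also have "\<dots> = 0" using assms by (simp add: quasi_identity_def)
  finally show "cpeval s (\<Sum>s\<in>{0..t}. \<mu> s * qentry (M s) i j) id = 0" .
qed

text \<open>A relation among polynomial multiples of curves that are independent at \<open>0\<close> can be divided
  by the parameter indefinitely.\<close>
lemma poly_relation_trivial:
  fixes p :: "nat \<Rightarrow> 'a::field poly" and W :: "nat \<Rightarrow> 'i \<Rightarrow> 'a poly"
  assumes indep: "\<And>c. (\<And>i. (\<Sum>s\<in>S. c s * poly (W s i) 0) = 0) \<Longrightarrow> \<forall>s\<in>S. c s = 0"
    and "\<And>i. (\<Sum>s\<in>S. p s * W s i) = 0" "s0 \<in> S"
  shows "p s0 = 0"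
  using assms(2)
proof (induction "degree (p s0)" arbitrary: p rule: less_induct)
  case less
  have "(\<Sum>s\<in>S. poly (p s) 0 * poly (W s i) 0) = 0" for i
    using arg_cong[OF less.prems[of i], of "\<lambda>p. poly p 0"] by (simp add: poly_sum)
  hence "\<forall>s\<in>S. poly (p s) 0 = 0" by (rule indep)
  hence "\<forall>s\<in>S. \<exists>q. p s = [:0, 1:] * q"
    by (auto simp: poly_eq_0_iff_dvd dvd_def)
  then obtain q where q: "\<And>s. s \<in> S \<Longrightarrow> p s = [:0, 1:] * q s" by metis
  have "[:0, 1:] * (\<Sum>s\<in>S. q s * W s i) = 0" for i
    using less.prems[of i] q by (simp add: sum_distrib_left mult.assoc del: mult_pCons_left)
  hence rel: "(\<Sum>s\<in>S. q s * W s i) = 0" for i by simp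
  show ?case
  proof (rule ccontr)
    assume nz: "p s0 \<noteq> 0"
    hence "q s0 \<noteq> 0" using q[OF assms(3)] by auto
    moreover from this have "degree (q s0) < degree (p s0)"
      using q[OF assms(3)] by (simp add: degree_pCons_eq)
    ultimately show False using less.hyps[of q] rel by simp
  qed
qed

text \<open>Independence is known at a single point A only. To reach an arbitrary point b, the
  relation is restricted to the line from A to b, along which the words become polynomial curves
  that are independent at parameter 0.\<close>

lemma relation_trivial:
  fixes \<mu> :: "nat \<Rightarrow> ('a::field_char_0, 'n::finite) cpoly"
  assumes "is_relation t M \<mu>" "loc_lin_indep TYPE('n) t M TYPE('a)" "\<mu> 0 = 0" "s0 \<in> {0..t}"
  shows "\<mu> s0 = 0"
proof (cases "s0 = 0")
  case False
  obtain A :: "nat \<Rightarrow> 'a^'n^'n" where A: "\<And>c :: nat \<Rightarrow> 'a.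
     (\<Sum>i\<in>{1..t}. msmult (c i) (wordmat A (M i))) = 0 \<Longrightarrow> (\<forall>i\<in>{1..t}. c i = 0)"
    using assms(2) unfolding loc_lin_indep_def by blast
  show ?thesis
  proof (rule mpoly_eq_0)
    fix b :: "nat \<times> 'n \<times> 'n \<Rightarrow> 'a"
    define l where "l = (\<lambda>f. cpeval (\<lambda>v. [:point A v, b v - point A v:]) f (\<lambda>c. [:c:]))"
    have l: "is_hom l" unfolding l_def by simp
    have l0: "poly (l f) 0 = cpeval (point A) f id" for f
      by (rule is_hom_unique[of "\<lambda>f. poly (l f) 0"]) (simp_all add: is_hom_comp[of "\<lambda>p. poly p 0" l] l, simp_all add: l_def)
    have l1: "poly (l f) 1 = cpeval b f id" for f
      by (rule is_hom_unique[of "\<lambda>f. poly (l f) 1"]) (simp_all add: is_hom_comp[of "\<lambda>p. poly p 1" l] l, simp_all add: l_def)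
    have "l (\<mu> s0) = 0"
    proof (rule poly_relation_trivial[where S = "{1..t}" and W = "\<lambda>s (i, j). l (qentry (M s) i j)" and p = "\<lambda>s. l (\<mu> s)"])
      fix c :: "nat \<Rightarrow> 'a"
      assume "\<And>i. (\<Sum>s\<in>{1..t}. c s * poly (case i of (i, j) \<Rightarrow> l (qentry (M s) i j)) 0) = 0"
      from this[of "(_, _)"] have "(\<Sum>s\<in>{1..t}. c s * wordmat A (M s) $ i $ j) = 0" for i j
        by (simp add: l0 cpeval_qentry)
      hence "(\<Sum>i\<in>{1..t}. msmult (c i) (wordmat A (M i))) = 0"
        by (simp add: vec_eq_iff msmult_def)
      thus "\<forall>s\<in>{1..t}. c s = 0" by (rule A)
    next
      fix ij :: "'n \<times> 'n"
      obtain i j where ij: "ij = (i, j)" by (cases ij)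
      have "0 = (\<Sum>s\<in>{0..t}. \<mu> s * qentry (M s) i j)" using assms(1) by (simp add: is_relation_def)
      also have "\<dots> = (\<Sum>s\<in>{1..t}. \<mu> s * qentry (M s) i j)"
        using assms(3) by (intro sum.mono_neutral_right) (auto simp: not_le)
      finally have "l (\<Sum>s\<in>{1..t}. \<mu> s * qentry (M s) i j) = 0" using is_homD(1)[OF l] by simp
      thus "(\<Sum>s\<in>{1..t}. l (\<mu> s) * (case ij of (i, j) \<Rightarrow> l (qentry (M s) i j))) = 0"
        by (simp add: ij is_hom_sum[OF l] is_homD[OF l])
    qed (use False assms(4) in auto)
    thus "cpeval b (\<mu> s0) id = 0" by (simp flip: l1)
  qed
qed (use assms in auto)

text \<open>The cross combination of the two relations is a relation whose entry 0 vanishes, hence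
  it is trivial.\<close>

lemma relation_proportional:
  fixes \<mu> \<nu> :: "nat \<Rightarrow> ('a::field_char_0, 'n::finite) cpoly"
  assumes "is_relation t M \<mu>" "is_relation t M \<nu>" "loc_lin_indep TYPE('n) t M TYPE('a)" "s \<in> {0..t}"
  shows "\<nu> 0 * \<mu> s = \<mu> 0 * \<nu> s"
proof -
  have "is_relation t M (\<lambda>s. \<nu> 0 * \<mu> s - \<mu> 0 * \<nu> s)"
    unfolding is_relation_def
  proof (intro allI)
    fix i j
    have "(\<Sum>s\<in>{0..t}. (\<nu> 0 * \<mu> s - \<mu> 0 * \<nu> s) * qentry (M s) i j)
      = \<nu> 0 * (\<Sum>s\<in>{0..t}. \<mu> s * qentry (M s) i j) - \<mu> 0 * (\<Sum>s\<in>{0..t}. \<nu> s * qentry (M s) i j)"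
      by (simp add: sum_distrib_left sum_subtractf left_diff_distrib mult.assoc)
    thus "(\<Sum>s\<in>{0..t}. (\<nu> 0 * \<mu> s - \<mu> 0 * \<nu> s) * qentry (M s) i j) = 0"
      using assms(1,2) by (simp add: is_relation_def)
  qed
  from relation_trivial[OF this assms(3) _ assms(4)] show ?thesis by simp
qed

text \<open>This is where factoriality enters: rank one gives only proportionality, and divisibility
  must be extracted from it. A relation whose entry 0 is nonzero of least degree has no common
  factor left.\<close>

lemma relation_generator:
  fixes lam :: "nat \<Rightarrow> ('a::field_char_0, 'n::finite) cpoly"
  assumes "is_relation t M lam" "loc_lin_indep TYPE('n) t M TYPE('a)" "lam 0 \<noteq> 0"
  obtains \<mu> :: "nat \<Rightarrow> ('a, 'n) cpoly" where "is_relation t M \<mu>" "\<mu> 0 \<noteq> 0"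
    "\<And>\<nu>. is_relation t M \<nu> \<Longrightarrow> \<exists>h. \<forall>s\<in>{0..t}. \<nu> s = h * \<mu> s"
proof -
  obtain \<mu> :: "nat \<Rightarrow> ('a, 'n) cpoly" where \<mu>: "is_relation t M \<mu>" "\<mu> 0 \<noteq> 0"
    and least: "\<And>\<nu> :: nat \<Rightarrow> ('a, 'n) cpoly. is_relation t M \<nu> \<Longrightarrow> \<nu> 0 \<noteq> 0 \<Longrightarrow> tdeg (\<mu> 0) \<le> tdeg (\<nu> 0)"
    using ex_has_least_nat[of "\<lambda>\<nu> :: nat \<Rightarrow> ('a, 'n) cpoly. is_relation t M \<nu> \<and> \<nu> 0 \<noteq> 0" lam "\<lambda>\<nu>. tdeg (\<nu> 0)"] assms by auto
  show ?thesis
  proof (rule that[OF \<mu>])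
    fix \<nu> :: "nat \<Rightarrow> ('a, 'n) cpoly" assume \<nu>: "is_relation t M \<nu>"
    have propor: "\<nu> 0 * \<mu> s = \<mu> 0 * \<nu> s" if "s \<in> {0..t}" for s
      using relation_proportional[OF \<mu>(1) \<nu> assms(2) that] .
    \<comment> \<open>By proportionality \<open>\<mu> 0\<close> divides every
      \<open>\<nu> 0 * \<mu> s\<close>, so m divides every \<open>\<mu> s\<close>. Dividing by m
      leaves a relation, hence m is a constant by minimality of the degree, and taking 1 for x shows
      that \<open>\<mu> 0\<close> divides \<open>\<nu> 0\<close>.\<close>
    obtain m where m: "\<And>x. \<mu> 0 dvd \<nu> 0 * x \<longleftrightarrow> m dvd x"
      using colon_ideal_principal[of "\<mu> 0" "\<nu> 0"] \<mu>(2) by blast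
    have "\<forall>s\<in>{0..t}. \<exists>k. \<mu> s = m * k"
      using m propor by (metis dvdE dvd_triv_left)
    then obtain \<kappa> where \<kappa>: "\<And>s. s \<in> {0..t} \<Longrightarrow> \<mu> s = m * \<kappa> s" by metis
    have m0: "m \<noteq> 0" "\<kappa> 0 \<noteq> 0" using \<kappa>[of 0] \<mu>(2) by auto
    have "m * (\<Sum>s\<in>{0..t}. \<kappa> s * qentry (M s) i j) = 0" for i j
      using \<mu>(1) \<kappa> by (simp add: is_relation_def sum_distrib_left flip: mult.assoc)
    hence "is_relation t M \<kappa>" using m0 mpoly_no_zero_divisors unfolding is_relation_def by blast
    hence "tdeg (\<mu> 0) \<le> tdeg (\<kappa> 0)" using least m0 by blast
    hence "tdeg m = 0" using \<kappa>[of 0] tdeg_mult[OF m0] by simp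
    then obtain c where c: "m = pconst c" using tdeg_0 by blast
    hence "c \<noteq> 0" using m0 by auto
    hence "m * pconst (inverse c) = 1" unfolding c by (simp flip: is_homD(4)[OF is_hom_pconst])
    hence "\<mu> 0 dvd \<nu> 0" using m[of 1] by (metis dvd_triv_left mult_1_right)
    then obtain h where h: "\<nu> 0 = \<mu> 0 * h" by (elim dvdE)
    have "\<nu> s = h * \<mu> s" if "s \<in> {0..t}" for s
      by (rule mpoly_mult_left_cancel[of "\<mu> 0"]) (use propor[OF that] h \<mu>(2) in \<open>simp_all add: mult_ac\<close>)
    thus "\<exists>h. \<forall>s\<in>{0..t}. \<nu> s = h * \<mu> s" by blast
  qed
qed

text \<open>The infinitesimal conjugation \<open>\<xi> \<mapsto> Y \<xi> - \<xi> Y\<close>.\<close>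
definition ad_gen :: "('n \<Rightarrow> 'n \<Rightarrow> 'a::comm_ring_1) \<Rightarrow> nat \<times> 'n \<times> 'n \<Rightarrow> ('a, 'n::finite) cpoly" where
  "ad_gen Y = (\<lambda>(k, i, j). (\<Sum>l\<in>UNIV. pconst (Y i l) * pvar (k, l, j)) - (\<Sum>l\<in>UNIV. pvar (k, i, l) * pconst (Y l j)))"

abbreviation ad :: "('n \<Rightarrow> 'n \<Rightarrow> 'a::comm_ring_1) \<Rightarrow> ('a, 'n::finite) cpoly \<Rightarrow> ('a, 'n) cpoly" where
  "ad Y \<equiv> deriv_by (ad_gen Y)"

text \<open>The commutator with Y is a derivation of matrix products: in the Leibniz rule the terms
  with Y between two letters cancel in pairs.\<close>

lemma ad_qentry:
  "ad Y (qentry w i j) = (\<Sum>l\<in>UNIV. pconst (Y i l) * qentry w l j) - (\<Sum>l\<in>UNIV. qentry w i l * pconst (Y l j))"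
proof (induction w arbitrary: i j)
  case Nil
  have 1: "(\<Sum>l\<in>UNIV. pconst (Y i l) * qentry [] l j) = (\<Sum>l\<in>UNIV. if l = j then pconst (Y i j) else 0)"
    by (intro sum.cong) (auto simp: mat_def)
  have 2: "(\<Sum>l\<in>UNIV. qentry [] i l * pconst (Y l j)) = (\<Sum>l\<in>UNIV. if l = i then pconst (Y i j) else 0)"
    by (intro sum.cong) (auto simp: mat_def)
  show ?case unfolding 1 2 by (simp add: mat_def)
next
  case (Cons k w)
  let ?x = "\<lambda>i j. pvar (k, i, j)" and ?w = "\<lambda>i j. qentry w i j"
  have x: "qentry (k # w) i j = (\<Sum>m\<in>UNIV. ?x i m * ?w m j)" for i j
    by (simp add: matrix_matrix_mult_def generic_def cvar_pvar)
  have "ad Y (qentry (k # w) i j) = (\<Sum>m\<in>UNIV. \<Sum>l\<in>UNIV. pconst (Y i l) * ?x l m * ?w m j)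
     - (\<Sum>m\<in>UNIV. \<Sum>l\<in>UNIV. ?x i l * pconst (Y l m) * ?w m j)
     + (\<Sum>m\<in>UNIV. \<Sum>l\<in>UNIV. ?x i m * pconst (Y m l) * ?w l j)
     - (\<Sum>m\<in>UNIV. \<Sum>l\<in>UNIV. ?x i m * ?w m l * pconst (Y l j))"
    unfolding x deriv_by_sum deriv_by_mult Cons.IH
    by (simp add: ad_gen_def left_diff_distrib right_diff_distrib sum_distrib_left sum_distrib_right
        sum_subtractf sum.distrib mult.assoc)
  also have "(\<Sum>m\<in>UNIV. \<Sum>l\<in>UNIV. ?x i l * pconst (Y l m) * ?w m j)
     = (\<Sum>m\<in>UNIV. \<Sum>l\<in>UNIV. ?x i m * pconst (Y m l) * ?w l j)" by (rule sum.swap)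
  also have "(\<Sum>m\<in>UNIV. \<Sum>l\<in>UNIV. pconst (Y i l) * ?x l m * ?w m j) = (\<Sum>l\<in>UNIV. pconst (Y i l) * qentry (k # w) l j)"
    unfolding x by (subst sum.swap) (simp add: sum_distrib_left mult.assoc)
  also have "(\<Sum>m\<in>UNIV. \<Sum>l\<in>UNIV. ?x i m * ?w m l * pconst (Y l j)) = (\<Sum>l\<in>UNIV. qentry (k # w) i l * pconst (Y l j))"
    unfolding x by (subst sum.swap) (simp add: sum_distrib_right mult.assoc)
  finally show ?case by simp
qed

text \<open>Differentiating a relation produces, besides the differentiated coefficients, the
  commutator of Y with the matrix of the relation, and that matrix is zero.\<close>

lemma ad_relation:
  assumes "is_relation t M \<mu>"
  shows "is_relation t M (\<lambda>s. ad Y (\<mu> s))"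
  unfolding is_relation_def
proof (intro allI)
  fix i j
  have R: "(\<Sum>s\<in>{0..t}. \<mu> s * qentry (M s) i j) = 0" for i j using assms by (simp add: is_relation_def)
  have "0 = ad Y (\<Sum>s\<in>{0..t}. \<mu> s * qentry (M s) i j)" unfolding R by simp
  also have "\<dots> = (\<Sum>s\<in>{0..t}. ad Y (\<mu> s) * qentry (M s) i j) + (\<Sum>s\<in>{0..t}. \<mu> s * ad Y (qentry (M s) i j))"
    by (simp add: deriv_by_sum deriv_by_mult sum.distrib)
  also have "(\<Sum>s\<in>{0..t}. \<mu> s * ad Y (qentry (M s) i j)) =
     (\<Sum>s\<in>{0..t}. \<Sum>l\<in>UNIV. pconst (Y i l) * (\<mu> s * qentry (M s) l j))
     - (\<Sum>s\<in>{0..t}. \<Sum>l\<in>UNIV. \<mu> s * qentry (M s) i l * pconst (Y l j))"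
    unfolding ad_qentry by (simp add: right_diff_distrib sum_subtractf sum_distrib_left mult_ac)
  also have "(\<Sum>s\<in>{0..t}. \<Sum>l\<in>UNIV. pconst (Y i l) * (\<mu> s * qentry (M s) l j)) = 0"
    by (subst sum.swap) (simp flip: sum_distrib_left add: R)
  also have "(\<Sum>s\<in>{0..t}. \<Sum>l\<in>UNIV. \<mu> s * qentry (M s) i l * pconst (Y l j)) = 0"
    by (subst sum.swap) (simp flip: sum_distrib_right add: R)
  finally show "(\<Sum>s\<in>{0..t}. ad Y (\<mu> s) * qentry (M s) i j) = 0" by simp
qed

lemma tdeg_ad:
  fixes f :: "('a::comm_ring_1, 'b::finite) cpoly"
  shows "tdeg (ad Y f) \<le> tdeg f"
proof (rule tdeg_deriv_by)
  have c: "homogenise (pconst c :: ('a, 'b) cpoly) = [:pconst c:]" for c by (simp add: homogenise_def)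
  have v: "homogenise (pvar v :: ('a, 'b) cpoly) = [:0, pvar v:]" for v by (simp add: homogenise_def)
  fix v :: "nat \<times> 'b \<times> 'b" and k
  obtain m i j where [simp]: "v = (m, i, j)" by (metis prod.exhaust)
  note h = is_homD[OF is_hom_homogenise] is_hom_sum[OF is_hom_homogenise] is_hom_diff[OF is_hom_homogenise]
  consider "k = 0" | "k = 1" | k' where "k = Suc (Suc k')" by (metis One_nat_def not0_implies_Suc)
  thus "coeff (homogenise (ad_gen Y v)) k = (if k = 1 then ad_gen Y v else 0)"
    by cases (simp_all add: ad_gen_def h c v coeff_sum mult.commute)
qed

text \<open>The commutator of two derivations is a derivation, so comparing on variables
  suffices.\<close>

lemma deriv_by_bracket:
  assumes "\<And>v. deriv_by d1 (d2 v) - deriv_by d2 (d1 v) = d3 v"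
  shows "deriv_by d1 (deriv_by d2 f) - deriv_by d2 (deriv_by d1 f) = deriv_by d3 f"
proof (induction f rule: mpoly_induct)
  case (mult p q)
  have "deriv_by d1 (deriv_by d2 (p * q)) - deriv_by d2 (deriv_by d1 (p * q))
     = (deriv_by d1 (deriv_by d2 p) - deriv_by d2 (deriv_by d1 p)) * q
     + p * (deriv_by d1 (deriv_by d2 q) - deriv_by d2 (deriv_by d1 q))"
    by (simp add: deriv_by_mult deriv_by_add algebra_simps)
  thus ?case using mult by (simp add: deriv_by_mult)
next
  case (add p q)
  have "deriv_by d1 (deriv_by d2 (p + q)) - deriv_by d2 (deriv_by d1 (p + q))
     = (deriv_by d1 (deriv_by d2 p) - deriv_by d2 (deriv_by d1 p))
     + (deriv_by d1 (deriv_by d2 q) - deriv_by d2 (deriv_by d1 q))"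
    by (simp add: deriv_by_add)
  thus ?case using add by (simp add: deriv_by_add)
qed (auto simp: assms)

definition unit_mat :: "'n \<Rightarrow> 'n \<Rightarrow> 'n \<Rightarrow> 'n \<Rightarrow> 'a::comm_ring_1" where
  "unit_mat a b i j = (if i = a \<and> j = b then 1 else 0)"

lemma ad_gen_unit_mat:
  "ad_gen (unit_mat a b) (k, i, j) = (if i = a then pvar (k, b, j) else 0) - (if j = b then pvar (k, i, a) else 0)"
proof -
  have 1: "(\<Sum>l\<in>UNIV. pconst (unit_mat a b i l) * pvar (k, l, j)) = (\<Sum>l\<in>UNIV. if l = b then (if i = a then pvar (k, b, j) else 0) else 0)"
    by (intro sum.cong) (auto simp: unit_mat_def)
  have 2: "(\<Sum>l\<in>UNIV. pvar (k, i, l) * pconst (unit_mat a b l j)) = (\<Sum>l\<in>UNIV. if l = a then (if j = b then pvar (k, i, a) else 0) else 0)"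
    by (intro sum.cong) (auto simp: unit_mat_def)
  show ?thesis unfolding ad_gen_def prod.case 1 2 by simp
qed

lemma deriv_by_gen_add:
  "deriv_by (\<lambda>v. \<Sum>x\<in>X. d x v) f = (\<Sum>x\<in>X. deriv_by (d x) f)"
  by (induction f rule: mpoly_induct)
    (auto simp: deriv_by_add deriv_by_mult sum.distrib sum_distrib_left sum_distrib_right)

lemma deriv_by_gen_diff: "deriv_by (\<lambda>v. d v - d' v) f = deriv_by d f - deriv_by d' f"
  by (induction f rule: mpoly_induct)
    (simp_all add: deriv_by_add deriv_by_mult left_diff_distrib right_diff_distrib)

text \<open>An eigenvector of the adjoint action has weight zero, since \<open>gl\<^sub>n\<close> is spanned by commutators
  and the identity matrix, which acts by zero.\<close>
lemma ad_eigenvector_invariant: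
  fixes f :: "('a::field_char_0, 'n::finite) cpoly"
  assumes eig: "\<And>a b. ad (unit_mat a b) f = pconst (c a b) * f"
  shows "ad (unit_mat a b) f = 0"
proof -
  \<comment> \<open>On a common eigenvector these operators commute, so each of their brackets
    annihilates f.\<close>
  have comm: "ad (unit_mat a b) (ad (unit_mat a' b') f) = ad (unit_mat a' b') (ad (unit_mat a b) f)" for a b a' b'
    by (simp add: eig deriv_by_mult mult.left_commute)
  note g = ad_gen_unit_mat
  have off: "ad (unit_mat a b) f = 0" if "a \<noteq> b" for a b
  proof -
    have "deriv_by (ad_gen (unit_mat a b)) (ad_gen (unit_mat a a) v) - deriv_by (ad_gen (unit_mat a a)) (ad_gen (unit_mat a b) v)
         = ad_gen (unit_mat a b) v" for v :: "nat \<times> 'n \<times> 'n"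
      using that by (cases v) (auto simp: g deriv_by_diff)
    from deriv_by_bracket[OF this, of f] show ?thesis using comm by simp
  qed
  have diag: "ad (unit_mat a a) f = ad (unit_mat b b) f" for a b
  proof (cases "a = b")
    case False
    have "deriv_by (ad_gen (unit_mat b a)) (ad_gen (unit_mat a b) v) - deriv_by (ad_gen (unit_mat a b)) (ad_gen (unit_mat b a) v)
         = ad_gen (unit_mat a a) v - ad_gen (unit_mat b b) v" for v :: "nat \<times> 'n \<times> 'n"
      using False by (cases v) (auto simp: g deriv_by_diff)
    from deriv_by_bracket[OF this, of f] show ?thesis using comm by (simp add: deriv_by_gen_diff)
  qed auto
  \<comment> \<open>The identity matrix commutes with everything, so the diagonal units act with sum
    zero. Since they all act on f alike, CARD('n) times each single action vanishes.\<close>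
  have "(\<lambda>v :: nat \<times> 'n \<times> 'n. \<Sum>a\<in>UNIV. ad_gen (unit_mat a a) v :: ('a, 'n) cpoly) = (\<lambda>_. 0)"
    by (auto simp: fun_eq_iff g sum_subtractf)
  hence "(\<Sum>a\<in>UNIV. ad (unit_mat a a) f) = deriv_by (\<lambda>_. 0) f" by (simp flip: deriv_by_gen_add)
  also have "\<dots> = 0"
    by (induction f rule: mpoly_induct) (auto simp: deriv_by_add deriv_by_mult)
  finally have "(\<Sum>a\<in>UNIV. ad (unit_mat a a) f) = 0" .
  moreover have "(\<Sum>b\<in>UNIV. ad (unit_mat b b) f) = (\<Sum>b\<in>(UNIV :: 'n set). ad (unit_mat a a) f)" for a
    by (intro sum.cong refl diag)
  ultimately have "of_nat CARD('n) * ad (unit_mat a a) f = 0" for a by simp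
  moreover have "of_nat CARD('n) \<noteq> (0 :: ('a, 'n) cpoly)" by simp
  ultimately have "ad (unit_mat a a) f = 0" for a using mpoly_no_zero_divisors by blast
  thus ?thesis using off by (cases "a = b") auto
qed

lemma invariant_relation_generator:
  fixes lam :: "nat \<Rightarrow> ('a::field_char_0, 'n::finite) cpoly"
  assumes "is_relation t M lam" "loc_lin_indep TYPE('n) t M TYPE('a)" "lam 0 \<noteq> 0"
  obtains \<mu> :: "nat \<Rightarrow> ('a, 'n) cpoly" and h where "is_relation t M \<mu>" "\<And>s. s \<in> {0..t} \<Longrightarrow> lam s = h * \<mu> s"
    "\<And>a b s. s \<in> {0..t} \<Longrightarrow> ad (unit_mat a b) (\<mu> s) = 0"
proof -
  obtain \<mu> :: "nat \<Rightarrow> ('a, 'n) cpoly" where \<mu>: "is_relation t M \<mu>" "\<mu> 0 \<noteq> 0"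
    "\<And>\<nu>. is_relation t M \<nu> \<Longrightarrow> \<exists>h. \<forall>s\<in>{0..t}. \<nu> s = h * \<mu> s"
    by (rule relation_generator[OF assms]) blast
  have "\<exists>c. \<forall>s\<in>{0..t}. ad Y (\<mu> s) = pconst c * \<mu> s" for Y
  proof -
    obtain h where h: "\<And>s. s \<in> {0..t} \<Longrightarrow> ad Y (\<mu> s) = h * \<mu> s"
      using \<mu>(3)[OF ad_relation[OF \<mu>(1)]] by blast
    have "\<exists>c. h = pconst c"
    proof (cases "h = 0")
      case True
      thus ?thesis by (intro exI[of _ 0]) simp
    next
      case False
      \<comment> \<open>The factor h is a polynomial a priori; comparing degrees at entry 0, which
        is nonzero, makes it a constant.\<close>
      have "tdeg h + tdeg (\<mu> 0) = tdeg (ad Y (\<mu> 0))" using h[of 0] tdeg_mult[OF False \<mu>(2)] by simp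
      also have "\<dots> \<le> tdeg (\<mu> 0)" by (rule tdeg_ad)
      finally show ?thesis by (intro tdeg_0) simp
    qed
    thus ?thesis using h by blast
  qed
  hence "\<forall>Y. \<exists>c. \<forall>s\<in>{0..t}. ad Y (\<mu> s) = pconst c * \<mu> s" by blast
  from choice[OF this] obtain c where "\<And>Y s. s \<in> {0..t} \<Longrightarrow> ad Y (\<mu> s) = pconst (c Y) * \<mu> s" by blast
  hence inv: "\<And>a b s. s \<in> {0..t} \<Longrightarrow> ad (unit_mat a b) (\<mu> s) = 0"
    by (intro ad_eigenvector_invariant[where c = "\<lambda>a b. c (unit_mat a b)"])
  obtain h where "\<forall>s\<in>{0..t}. lam s = h * \<mu> s" using \<mu>(3)[OF assms(1)] by blast
  thus ?thesis using that[OF \<mu>(1), of h] inv by blast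
qed

section \<open>Invariants of infinitesimal conjugation\<close>

text \<open>With the vectors \<open>v k\<close> as rows of a matrix V, this is a matrix d with V d^T
  V = V; equivalently, the right-hand side defines a projection onto their span. It gives a linear
  retraction onto a span whose spanning vectors may be dependent.\<close>

lemma ex_generalised_inverse:
  fixes v :: "'k \<Rightarrow> 'x \<Rightarrow> 'a::field"
  assumes "finite K" "finite X"
  shows "\<exists>d. \<forall>k'\<in>K. \<forall>y\<in>X. v k' y = (\<Sum>k\<in>K. (\<Sum>x\<in>X. d k x * v k' x) * v k y)"
  using assms(1)
proof (induction K rule: finite_induct)
  case (insert w K)
  then obtain d where d: "\<And>k' y. k' \<in> K \<Longrightarrow> y \<in> X \<Longrightarrow> v k' y = (\<Sum>k\<in>K. (\<Sum>x\<in>X. d k x * v k' x) * v k y)"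
    by blast
  define p where "p = (\<lambda>z y. \<Sum>k\<in>K. (\<Sum>x\<in>X. d k x * z x) * v k y)"
  have p: "p (v k') y = v k' y" if "k' \<in> K" "y \<in> X" for k' y
    using d[OF that] by (simp add: p_def)
  show ?case
  proof (cases "\<forall>y\<in>X. p (v w) y = v w y")
    case True
    define d' where "d' = (\<lambda>k x. if k = w then 0 else d k x)"
    have "(\<Sum>k\<in>insert w K. (\<Sum>x\<in>X. d' k x * z x) * v k y) = p z y" for z y
      using insert by (auto simp: p_def d'_def intro!: sum.cong)
    thus ?thesis using p True by (intro exI[of _ d']) auto
  next
    case False
    then obtain y0 where y0: "y0 \<in> X" "p (v w) y0 \<noteq> v w y0" by blast
    define e where "e = v w y0 - p (v w) y0"
    have e: "e \<noteq> 0" using y0 by (simp add: e_def)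
    \<comment> \<open>This functional vanishes on the old vectors and takes the value 1 on
      \<open>v w\<close>, so adding l times the defect of \<open>v w\<close> under p extends the
      projection to the new vector.\<close>
    define l where "l = (\<lambda>x. ((if x = y0 then 1 else 0) - (\<Sum>k\<in>K. d k x * v k y0)) / e)"
    define d' where "d' = (\<lambda>k x. if k = w then l x else d k x - (\<Sum>x'\<in>X. d k x' * v w x') * l x)"
    have l: "(\<Sum>x\<in>X. l x * z x) = (z y0 - p z y0) / e" for z
    proof -
      have "(\<Sum>x\<in>X. l x * z x) = (\<Sum>x\<in>X. ((if x = y0 then z x else 0) - (\<Sum>k\<in>K. d k x * z x * v k y0))) / e"
        unfolding sum_divide_distrib
      proof (intro sum.cong refl)
        fix x
        show "l x * z x = ((if x = y0 then z x else 0) - (\<Sum>k\<in>K. d k x * z x * v k y0)) / e"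
          by (cases "x = y0") (simp_all add: l_def right_diff_distrib sum_distrib_left mult_ac)
      qed
      also have "(\<Sum>x\<in>X. ((if x = y0 then z x else 0) - (\<Sum>k\<in>K. d k x * z x * v k y0))) = z y0 - p z y0"
        using y0(1) assms(2) by (simp add: sum_subtractf p_def sum_distrib_right) (subst sum.swap, simp)
      finally show ?thesis .
    qed
    have eq: "(\<Sum>k\<in>insert w K. (\<Sum>x\<in>X. d' k x * z x) * v k y)
        = p z y + (z y0 - p z y0) / e * (v w y - p (v w) y)" for z y
    proof -
      define L where "L = (\<Sum>x\<in>X. l x * z x)"
      have "(\<Sum>x\<in>X. d' k x * z x) = (\<Sum>x\<in>X. d k x * z x) - (\<Sum>x\<in>X. d k x * v w x) * L" if "k \<in> K" for k
      proof -
        have "k \<noteq> w" using that insert by auto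
        thus ?thesis
          by (simp add: L_def d'_def left_diff_distrib sum_subtractf sum_distrib_left mult.assoc)
      qed
      hence "(\<Sum>k\<in>K. (\<Sum>x\<in>X. d' k x * z x) * v k y)
          = (\<Sum>k\<in>K. ((\<Sum>x\<in>X. d k x * z x) - (\<Sum>x\<in>X. d k x * v w x) * L) * v k y)"
        by (intro sum.cong) simp_all
      also have "\<dots> = p z y - L * p (v w) y"
      proof -
        have "(\<Sum>k\<in>K. (A k - B k * L) * v k y) = (\<Sum>k\<in>K. A k * v k y) - L * (\<Sum>k\<in>K. B k * v k y)" for A B
          unfolding sum_distrib_left sum_subtractf[symmetric]
          by (intro sum.cong refl) (simp add: algebra_simps)
        thus ?thesis unfolding p_def .
      qed
      finally have "(\<Sum>k\<in>K. (\<Sum>x\<in>X. d' k x * z x) * v k y) = p z y - L * p (v w) y" .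
      moreover have "(\<Sum>x\<in>X. d' w x * z x) = L" by (simp add: d'_def L_def)
      ultimately have "(\<Sum>k\<in>insert w K. (\<Sum>x\<in>X. d' k x * z x) * v k y) = L * v w y + (p z y - L * p (v w) y)"
        using insert by simp
      thus ?thesis unfolding L_def l by (simp add: right_diff_distrib)
    qed
    have "v k' y = (\<Sum>k\<in>insert w K. (\<Sum>x\<in>X. d' k x * v k' x) * v k y)" if "k' \<in> insert w K" "y \<in> X" for k' y
      unfolding eq using that e y0 p by (auto simp: e_def)
    thus ?thesis by blast
  qed
qed auto

section \<open>The double centraliser of place permutations\<close>

abbreviation tuples :: "nat \<Rightarrow> (nat \<Rightarrow> 'n::finite) set" where
  "tuples r \<equiv> PiE {..<r} (\<lambda>_. UNIV)"

abbreviation perms :: "nat \<Rightarrow> (nat \<Rightarrow> nat) set" where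
  "perms r \<equiv> {\<sigma>. \<sigma> permutes {..<r}}"

lemma PiE_comp_perm:
  assumes "v \<in> PiE {..<r} (\<lambda>_. V)" "\<sigma> permutes {..<r}"
  shows "v \<circ> \<sigma> \<in> PiE {..<r} (\<lambda>_. V)"
proof (rule PiE_I)
  fix p assume "p \<in> {..<r}"
  hence "\<sigma> p \<in> {..<r}" using assms(2) by (metis permutes_in_image)
  thus "(v \<circ> \<sigma>) p \<in> V" using assms(1) by auto
next
  fix p assume "p \<notin> {..<r}"
  thus "(v \<circ> \<sigma>) p = undefined" using assms by (auto simp: permutes_def)
qed

lemma comp_perm_cancel:
  assumes "\<sigma> permutes A"
  shows "i \<circ> \<sigma> = j \<circ> \<sigma> \<longleftrightarrow> i = j"
proof
  assume *: "i \<circ> \<sigma> = j \<circ> \<sigma>"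
  have "i x = j x" for x
    using fun_cong[OF *, of "inv \<sigma> x"] permutes_inverses(1)[OF assms] by simp
  thus "i = j" by auto
qed auto

lemma finite_tuples [simp]: "finite (tuples r :: (nat \<Rightarrow> 'n::finite) set)"
  by (intro finite_PiE) auto

lemma finite_perms [simp]: "finite (perms r)"
  by (rule finite_permutations) auto

lemma sum_swap3: "(\<Sum>x\<in>A. \<Sum>y\<in>B. \<Sum>z\<in>C. F x y z) = (\<Sum>z\<in>C. \<Sum>x\<in>A. \<Sum>y\<in>B. F x y z)"
proof -
  have "(\<Sum>x\<in>A. \<Sum>y\<in>B. \<Sum>z\<in>C. F x y z) = (\<Sum>x\<in>A. \<Sum>z\<in>C. \<Sum>y\<in>B. F x y z)"
    by (intro sum.cong refl sum.swap)
  also have "\<dots> = (\<Sum>z\<in>C. \<Sum>x\<in>A. \<Sum>y\<in>B. F x y z)" by (rule sum.swap)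
  finally show ?thesis .
qed

text \<open>A Maschke argument. The generalised inverse yields a linear retraction d from all
  operators onto the span of the place permutations. Averaging over the group turns its coefficients
  into operators \<open>b j l\<close> that are invariant under simultaneous permutations; that a
  commutes with them then expresses a through permutations.\<close>

lemma double_centraliser_tuples:
  fixes a :: "(nat \<Rightarrow> 'n::finite) \<Rightarrow> (nat \<Rightarrow> 'n) \<Rightarrow> 'a::field_char_0"
  assumes comm: "\<And>b i h. (\<And>\<sigma> i j. \<sigma> permutes {..<r} \<Longrightarrow> i \<in> tuples r \<Longrightarrow> j \<in> tuples r \<Longrightarrow> b (i \<circ> \<sigma>) (j \<circ> \<sigma>) = b i j)
     \<Longrightarrow> i \<in> tuples r \<Longrightarrow> h \<in> tuples r \<Longrightarrow> (\<Sum>k\<in>tuples r. a i k * b k h) = (\<Sum>k\<in>tuples r. b i k * a k h)"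
  shows "\<exists>c. \<forall>i\<in>tuples r. \<forall>j\<in>tuples r. a i j = (\<Sum>\<sigma>\<in>perms r. c \<sigma> * (if j = i \<circ> \<sigma> then 1 else 0))"
proof -
  let ?I = "tuples r :: (nat \<Rightarrow> 'n) set" and ?G = "perms r"
  define v :: "(nat \<Rightarrow> nat) \<Rightarrow> (nat \<Rightarrow> 'n) \<times> (nat \<Rightarrow> 'n) \<Rightarrow> 'a" where
    "v = (\<lambda>\<sigma> (i, j). if j = i \<circ> \<sigma> then 1 else 0)"
  obtain d where d: "\<And>\<sigma> y. \<sigma> \<in> ?G \<Longrightarrow> y \<in> ?I \<times> ?I \<Longrightarrow> v \<sigma> y = (\<Sum>\<tau>\<in>?G. (\<Sum>x\<in>?I \<times> ?I. d \<tau> x * v \<sigma> x) * v \<tau> y)"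
    using ex_generalised_inverse[of ?G "?I \<times> ?I" v] by auto
  have inI: "i \<circ> \<sigma> \<in> ?I" if "i \<in> ?I" "\<sigma> \<in> ?G" for i \<sigma> using PiE_comp_perm[OF that(1)] that(2) by auto
  define b where "b = (\<lambda>j l i k. \<Sum>\<sigma>\<in>?G. \<Sum>\<tau>\<in>?G. d \<tau> (k \<circ> \<sigma>, l) * v \<tau> (i \<circ> \<sigma>, j))"
  have binv: "b j l (i \<circ> \<rho>) (k \<circ> \<rho>) = b j l i k" if "\<rho> permutes {..<r}" for j l i k \<rho>
  proof -
    let ?f = "\<lambda>\<sigma>. \<Sum>\<tau>\<in>?G. d \<tau> (k \<circ> \<sigma>, l) * v \<tau> (i \<circ> \<sigma>, j)"
    have "b j l (i \<circ> \<rho>) (k \<circ> \<rho>) = (\<Sum>\<sigma>\<in>?G. ?f (\<rho> \<circ> \<sigma>))" by (simp add: b_def comp_assoc)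
    also have "\<dots> = (\<Sum>\<sigma>\<in>?G. ?f \<sigma>)" using setum_permutations_compose_left[OF that, of ?f] by simp
    finally show ?thesis by (simp add: b_def)
  qed
  define e where "e = (\<lambda>\<sigma> \<tau>. \<Sum>l\<in>?I. \<Sum>k\<in>?I. d \<tau> (k \<circ> \<sigma>, l) * a k l)"
  \<comment> \<open>Both sides evaluate the sum over l of the entry (i, l) of the product of a and
    \<open>b j l\<close>. In one order the retraction property yields a multiple of
    \<open>a i j\<close>, in the other order a combination of place permutations appears.\<close>
  have main: "of_nat (card ?G) * a i j = (\<Sum>\<sigma>\<in>?G. \<Sum>\<tau>\<in>?G. e \<sigma> \<tau> * (if j = i \<circ> (\<sigma> \<circ> \<tau>) then 1 else 0))"
    if ij: "i \<in> ?I" "j \<in> ?I" for i j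
  proof -
    have vinv: "v (inv \<sigma>) (k, l) = (if k = l \<circ> \<sigma> then 1 else 0)" if "\<sigma> \<in> ?G" for \<sigma> k l
    proof -
      have s: "\<sigma> permutes {..<r}" using that by simp
      have "l = k \<circ> inv \<sigma> \<longleftrightarrow> l \<circ> \<sigma> = (k \<circ> inv \<sigma>) \<circ> \<sigma>" using comp_perm_cancel[OF s] by metis
      also have "(k \<circ> inv \<sigma>) \<circ> \<sigma> = k" using permutes_inv_o(2)[OF s] by (simp add: comp_assoc)
      finally have "(l = k \<circ> inv \<sigma>) = (k = l \<circ> \<sigma>)" by (simp only: eq_commute)
      thus ?thesis unfolding v_def by (simp only: prod.case)
    qed
    have one: "(\<Sum>\<tau>\<in>?G. (\<Sum>l\<in>?I. d \<tau> (l \<circ> \<sigma>, l)) * v \<tau> (k \<circ> \<sigma>, j)) = (if k = j then 1 else 0)"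
      if s: "\<sigma> \<in> ?G" and k: "k \<in> ?I" for \<sigma> k
    proof -
      have inv: "inv \<sigma> \<in> ?G" using s permutes_inv by auto
      have "(\<Sum>x\<in>?I \<times> ?I. d \<tau> x * v (inv \<sigma>) x) = (\<Sum>l\<in>?I. d \<tau> (l \<circ> \<sigma>, l))" for \<tau>
      proof -
        have "(\<Sum>x\<in>?I \<times> ?I. d \<tau> x * v (inv \<sigma>) x) = (\<Sum>k\<in>?I. \<Sum>l\<in>?I. d \<tau> (k, l) * v (inv \<sigma>) (k, l))"
          by (simp add: sum.cartesian_product)
        also have "\<dots> = (\<Sum>l\<in>?I. \<Sum>k\<in>?I. if k = l \<circ> \<sigma> then d \<tau> (k, l) else 0)"
          using s by (subst sum.swap) (intro sum.cong refl, simp add: vinv)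
        also have "\<dots> = (\<Sum>l\<in>?I. d \<tau> (l \<circ> \<sigma>, l))" using inI s by (intro sum.cong) auto
        finally show ?thesis .
      qed
      with d[OF inv, of "(k \<circ> \<sigma>, j)"] have "v (inv \<sigma>) (k \<circ> \<sigma>, j) = (\<Sum>\<tau>\<in>?G. (\<Sum>l\<in>?I. d \<tau> (l \<circ> \<sigma>, l)) * v \<tau> (k \<circ> \<sigma>, j))"
        using inI[OF k s] ij by simp
      moreover have "k \<circ> \<sigma> = j \<circ> \<sigma> \<longleftrightarrow> k = j" using s comp_perm_cancel by auto
      ultimately show ?thesis using vinv[OF s] by simp
    qed
    have "(\<Sum>l\<in>?I. \<Sum>k\<in>?I. a i k * b j l k l) = (\<Sum>k\<in>?I. a i k * (\<Sum>\<sigma>\<in>?G. \<Sum>\<tau>\<in>?G. (\<Sum>l\<in>?I. d \<tau> (l \<circ> \<sigma>, l)) * v \<tau> (k \<circ> \<sigma>, j)))"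
      unfolding b_def
      by (subst sum.swap, intro sum.cong refl, subst sum_distrib_left[symmetric], rule arg_cong[where f = "(*) _"],
          subst sum.swap, intro sum.cong refl, subst sum.swap, intro sum.cong refl, simp add: sum_distrib_right)
    also have "\<dots> = (\<Sum>k\<in>?I. a i k * (\<Sum>\<sigma>\<in>?G. if k = j then 1 else 0))"
      by (intro sum.cong refl arg_cong2[where f = "(*)"]) (use one in auto)
    also have "\<dots> = (\<Sum>k\<in>?I. if k = j then of_nat (card ?G) * a i j else 0)"
      by (intro sum.cong) auto
    also have "\<dots> = of_nat (card ?G) * a i j" using ij by simp
    finally have L: "(\<Sum>l\<in>?I. \<Sum>k\<in>?I. a i k * b j l k l) = of_nat (card ?G) * a i j" .
    have "(\<Sum>l\<in>?I. \<Sum>k\<in>?I. a i k * b j l k l) = (\<Sum>l\<in>?I. \<Sum>k\<in>?I. b j l i k * a k l)"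
      by (rule sum.cong[OF refl], rule comm, rule binv, assumption, rule ij)
    also have "\<dots> = (\<Sum>l\<in>?I. \<Sum>k\<in>?I. \<Sum>\<sigma>\<in>?G. \<Sum>\<tau>\<in>?G. (d \<tau> (k \<circ> \<sigma>, l) * a k l) * v \<tau> (i \<circ> \<sigma>, j))"
      unfolding b_def by (simp add: sum_distrib_left sum_distrib_right mult_ac)
    also have "\<dots> = (\<Sum>\<sigma>\<in>?G. \<Sum>\<tau>\<in>?G. \<Sum>l\<in>?I. \<Sum>k\<in>?I. (d \<tau> (k \<circ> \<sigma>, l) * a k l) * v \<tau> (i \<circ> \<sigma>, j))"
      by (subst sum_swap3, rule sum.cong[OF refl], rule sum_swap3)
    also have "\<dots> = (\<Sum>\<sigma>\<in>?G. \<Sum>\<tau>\<in>?G. e \<sigma> \<tau> * (if j = i \<circ> (\<sigma> \<circ> \<tau>) then 1 else 0))"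
      by (simp add: e_def v_def sum_distrib_right comp_assoc)
    finally show ?thesis using L by simp
  qed
  define c where "c = (\<lambda>\<rho>. (\<Sum>\<sigma>\<in>?G. e \<sigma> (inv \<sigma> \<circ> \<rho>)) / of_nat (card ?G))"
  have "a i j = (\<Sum>\<rho>\<in>?G. c \<rho> * (if j = i \<circ> \<rho> then 1 else 0))" if ij: "i \<in> ?I" "j \<in> ?I" for i j
  proof -
    have "id \<in> ?G" by (simp add: permutes_id)
    hence ne: "?G \<noteq> {}" by blast
    have g: "of_nat (card ?G) \<noteq> (0::'a)" using ne finite_perms by (metis card_0_eq of_nat_eq_0_iff)
    have "of_nat (card ?G) * a i j = (\<Sum>\<sigma>\<in>?G. \<Sum>\<tau>\<in>?G. e \<sigma> \<tau> * (if j = i \<circ> (\<sigma> \<circ> \<tau>) then 1 else 0))"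
      by (rule main[OF ij])
    also have "\<dots> = (\<Sum>\<sigma>\<in>?G. \<Sum>\<rho>\<in>?G. e \<sigma> (inv \<sigma> \<circ> \<rho>) * (if j = i \<circ> \<rho> then 1 else 0))"
    proof (rule sum.cong[OF refl])
      fix \<sigma> assume "\<sigma> \<in> ?G"
      hence s: "\<sigma> permutes {..<r}" by simp
      have "inv \<sigma> \<circ> (\<sigma> \<circ> \<tau>) = \<tau>" for \<tau> :: "nat \<Rightarrow> nat" using permutes_inv_o(2)[OF s] by (simp flip: comp_assoc)
      hence "(\<Sum>\<tau>\<in>?G. e \<sigma> \<tau> * (if j = i \<circ> (\<sigma> \<circ> \<tau>) then 1 else 0))
         = (\<Sum>\<tau>\<in>?G. e \<sigma> (inv \<sigma> \<circ> (\<sigma> \<circ> \<tau>)) * (if j = i \<circ> (\<sigma> \<circ> \<tau>) then 1 else 0))" by (simp only:)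
      also have "\<dots> = (\<Sum>\<rho>\<in>?G. e \<sigma> (inv \<sigma> \<circ> \<rho>) * (if j = i \<circ> \<rho> then 1 else 0))"
        by (rule setum_permutations_compose_left[OF s, of "\<lambda>\<rho>. e \<sigma> (inv \<sigma> \<circ> \<rho>) * (if j = i \<circ> \<rho> then 1 else 0)", symmetric])
      finally show "(\<Sum>\<tau>\<in>?G. e \<sigma> \<tau> * (if j = i \<circ> (\<sigma> \<circ> \<tau>) then 1 else 0))
         = (\<Sum>\<rho>\<in>?G. e \<sigma> (inv \<sigma> \<circ> \<rho>) * (if j = i \<circ> \<rho> then 1 else 0))" .
    qed
    also have "\<dots> = of_nat (card ?G) * (\<Sum>\<rho>\<in>?G. c \<rho> * (if j = i \<circ> \<rho> then 1 else 0))"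
    proof -
      have "of_nat (card ?G) * c \<rho> = (\<Sum>\<sigma>\<in>?G. e \<sigma> (inv \<sigma> \<circ> \<rho>))" for \<rho> using g by (simp add: c_def)
      thus ?thesis unfolding sum_distrib_left mult.assoc[symmetric]
        by (subst sum.swap) (simp only: sum_distrib_right)
    qed
    finally show ?thesis using mult_left_cancel[OF g] by blast
  qed
  thus ?thesis by blast
qed

section \<open>Operators commuting with place permutations are generated by gl\<close>

definition pairs :: "nat \<Rightarrow> (nat \<Rightarrow> 'x) \<Rightarrow> (nat \<Rightarrow> 'y) \<Rightarrow> ('x \<times> 'y) multiset" where
  "pairs r i j = image_mset (\<lambda>p. (i p, j p)) (mset_set {..<r})"

definition commutes :: "nat \<Rightarrow> ((nat \<Rightarrow> 'n::finite) \<Rightarrow> (nat \<Rightarrow> 'n) \<Rightarrow> 'a::field_char_0) \<Rightarrow> ((nat \<Rightarrow> 'n) \<Rightarrow> (nat \<Rightarrow> 'n) \<Rightarrow> 'a) \<Rightarrow> bool" where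
  "commutes r a b \<longleftrightarrow> (\<forall>i\<in>tuples r. \<forall>j\<in>tuples r. (\<Sum>k\<in>tuples r. a i k * b k j) = (\<Sum>k\<in>tuples r. b i k * a k j))"

lemma commutes_sum:
  assumes "\<And>x. x \<in> A \<Longrightarrow> commutes r a (b x)"
  shows "commutes r a (\<lambda>i j. \<Sum>x\<in>A. c x * b x i j)"
  unfolding commutes_def
proof (intro ballI)
  fix i j :: "nat \<Rightarrow> 'b" assume ij: "i \<in> tuples r" "j \<in> tuples r"
  have "(\<Sum>k\<in>tuples r. a i k * (\<Sum>x\<in>A. c x * b x k j)) = (\<Sum>x\<in>A. c x * (\<Sum>k\<in>tuples r. a i k * b x k j))"
    by (simp add: sum_distrib_left mult_ac sum.swap[of _ A])
  also have "\<dots> = (\<Sum>x\<in>A. c x * (\<Sum>k\<in>tuples r. b x i k * a k j))"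
    using assms ij by (intro sum.cong refl) (auto simp: commutes_def)
  also have "\<dots> = (\<Sum>k\<in>tuples r. (\<Sum>x\<in>A. c x * b x i k) * a k j)"
    by (simp add: sum_distrib_left sum_distrib_right mult_ac sum.swap[of _ A])
  finally show "(\<Sum>k\<in>tuples r. a i k * (\<Sum>x\<in>A. c x * b x k j)) = (\<Sum>k\<in>tuples r. (\<Sum>x\<in>A. c x * b x i k) * a k j)" .
qed

lemma commutes_cong:
  assumes "commutes r a b" "\<And>i j. i \<in> tuples r \<Longrightarrow> j \<in> tuples r \<Longrightarrow> b i j = b' i j"
  shows "commutes r a b'"
  using assms by (simp add: commutes_def cong: sum.cong)

text \<open>Infinitesimal conjugation invariance of the tensor \<open>a\<close>.\<close>
definition gl_invariant :: "nat \<Rightarrow> ((nat \<Rightarrow> 'n::finite) \<Rightarrow> (nat \<Rightarrow> 'n) \<Rightarrow> 'a::field_char_0) \<Rightarrow> bool" where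
  "gl_invariant r a \<longleftrightarrow> (\<forall>u w. \<forall>i\<in>tuples r. \<forall>j\<in>tuples r.
     (\<Sum>p<r. if i p = w then a (i(p := u)) j else 0) = (\<Sum>p<r. if j p = u then a i (j(p := w)) else 0))"

lemma tuples_upd: "i \<in> tuples r \<Longrightarrow> p < r \<Longrightarrow> i(p := u) \<in> tuples r"
  by (auto simp: PiE_def extensional_def)

lemma sum_tuples_upd:
  assumes "p < r"
  shows "(\<Sum>h\<in>tuples r. if h p = w then F (h(p := u)) h else 0) = (\<Sum>h\<in>tuples r. if h p = u then F h (h(p := w)) else 0)"
proof -
  have "(\<Sum>h\<in>tuples r. if h p = w then F (h(p := u)) h else 0) = (\<Sum>h\<in>{h\<in>tuples r. h p = w}. F (h(p := u)) h)"
    by (intro sum.mono_neutral_cong_right) auto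
  also have "\<dots> = (\<Sum>h\<in>{h\<in>tuples r. h p = u}. F h (h(p := w)))"
    by (rule sum.reindex_bij_witness[of _ "\<lambda>h. h(p := w)" "\<lambda>h. h(p := u)"]) (use assms in \<open>simp_all add: tuples_upd fun_upd_idem\<close>)
  also have "\<dots> = (\<Sum>h\<in>tuples r. if h p = u then F h (h(p := w)) else 0)"
    by (intro sum.mono_neutral_cong_left) auto
  finally show ?thesis .
qed

lemma sum_swap_if:
  "(\<Sum>k\<in>A. \<Sum>p\<in>B. if P p then f p k else 0) = (\<Sum>p\<in>B. if P p then \<Sum>k\<in>A. f p k else 0)"
  by (subst sum.swap) (intro sum.cong refl, simp)

text \<open>The new operator is the product of the action of the matrix unit at (u, w) on tensors
  with b. Invariance says that a commutes with the first factor, and it commutes with b by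
  assumption.\<close>

lemma commutes_gl_step:
  assumes "gl_invariant r a" "commutes r a b"
  shows "commutes r a (\<lambda>i j. \<Sum>p<r. if i p = u then b (i(p := w)) j else 0)"
  unfolding commutes_def
proof (intro ballI)
  fix i j :: "nat \<Rightarrow> 'a" assume ij: "i \<in> tuples r" "j \<in> tuples r"
  have "(\<Sum>k\<in>tuples r. (\<Sum>p<r. if i p = u then b (i(p := w)) k else 0) * a k j)
     = (\<Sum>p<r. if i p = u then (\<Sum>k\<in>tuples r. b (i(p := w)) k * a k j) else 0)"
    by (simp add: sum_distrib_right if_distrib[of "\<lambda>x. x * _"] sum_swap_if cong: if_cong)
  also have "\<dots> = (\<Sum>p<r. if i p = u then (\<Sum>k\<in>tuples r. a (i(p := w)) k * b k j) else 0)"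
    using assms(2) ij tuples_upd[OF ij(1)] by (intro sum.cong refl) (auto simp: commutes_def)
  also have "\<dots> = (\<Sum>k\<in>tuples r. (\<Sum>p<r. if i p = u then a (i(p := w)) k else 0) * b k j)"
    by (simp add: sum_distrib_right if_distrib[of "\<lambda>x. x * _"] sum_swap_if cong: if_cong)
  also have "\<dots> = (\<Sum>k\<in>tuples r. (\<Sum>p<r. if k p = w then a i (k(p := u)) else 0) * b k j)"
    using assms(1) ij by (intro sum.cong refl) (auto simp: gl_invariant_def)
  also have "\<dots> = (\<Sum>p<r. \<Sum>k\<in>tuples r. if k p = w then a i (k(p := u)) * b k j else 0)"
    by (simp add: sum_distrib_right if_distrib[of "\<lambda>x. x * _"] cong: if_cong) (rule sum.swap)
  also have "\<dots> = (\<Sum>p<r. \<Sum>k\<in>tuples r. if k p = u then a i k * b (k(p := w)) j else 0)"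
    by (rule sum.cong[OF refl], rule sum_tuples_upd[of _ r w "\<lambda>x y. a i x * b y j" u]) simp
  also have "\<dots> = (\<Sum>k\<in>tuples r. a i k * (\<Sum>p<r. if k p = u then b (k(p := w)) j else 0))"
    by (simp add: sum_distrib_left if_distrib[of "\<lambda>x. _ * x"] cong: if_cong) (rule sum.swap)
  finally show "(\<Sum>k\<in>tuples r. a i k * (\<Sum>p<r. if k p = u then b (k(p := w)) j else 0))
    = (\<Sum>k\<in>tuples r. (\<Sum>p<r. if i p = u then b (i(p := w)) k else 0) * a k j)" by simp
qed

lemma pairs_upd:
  assumes "p < r"
  shows "pairs r (i(p := w)) j = pairs r i j - {#(i p, j p)#} + {#(w, j p)#}"
proof -
  have s: "mset_set {..<r} = add_mset p (mset_set ({..<r} - {p}))"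
    using assms by (simp add: mset_set.remove)
  have "image_mset (\<lambda>q. ((i(p := w)) q, j q)) (mset_set ({..<r} - {p})) = image_mset (\<lambda>q. (i q, j q)) (mset_set ({..<r} - {p}))"
    by (intro image_mset_cong) auto
  thus ?thesis by (simp add: pairs_def s)
qed

lemma count_pairs: "count (pairs r i j) (x, y) = card {p. p < r \<and> i p = x \<and> j p = y}"
proof -
  have "count (pairs r i j) (x, y) = card ({p. (i p, j p) = (x, y)} \<inter> {..<r})"
    by (simp add: pairs_def count_image_mset vimage_def)
  also have "{p. (i p, j p) = (x, y)} \<inter> {..<r} = {p. p < r \<and> i p = x \<and> j p = y}" by auto
  finally show ?thesis .
qed

definition off_diag :: "('n \<times> 'n) multiset \<Rightarrow> nat" where
  "off_diag m = size (filter_mset (\<lambda>(x, y). x \<noteq> y) m)"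

text \<open>\<open>pairs\<close> is a complete invariant of two tuples under simultaneous place
  permutations, so these are the indicator matrices of the orbits. They span the operators that
  commute with all place permutations.\<close>

abbreviation pairs_eq :: "nat \<Rightarrow> ('n \<times> 'n) multiset \<Rightarrow> (nat \<Rightarrow> 'n) \<Rightarrow> (nat \<Rightarrow> 'n) \<Rightarrow> 'a::field_char_0" where
  "pairs_eq r m i j \<equiv> (if pairs r i j = m then 1 else 0)"

text \<open>Changing one index of i from u to w replaces one pair (u, x) by (w, x); the multiplicity
  counts the positions at which this can be done.\<close>

lemma gl_step_pairs_eq:
  fixes i j :: "nat \<Rightarrow> 'n::finite"
  shows "(\<Sum>p<r. if i p = u then pairs_eq r m (i(p := w)) j else (0::'a::field_char_0))
    = (\<Sum>x\<in>UNIV. of_nat (count (pairs r i j) (u, x)) * (if pairs r i j - {#(u, x)#} + {#(w, x)#} = m then 1 else 0))"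
proof -
  have "(\<Sum>p<r. if i p = u then pairs_eq r m (i(p := w)) j else (0::'a))
    = (\<Sum>p<r. \<Sum>x\<in>UNIV. if i p = u \<and> j p = x then (if pairs r i j - {#(u, x)#} + {#(w, x)#} = m then 1 else 0) else 0)"
  proof (intro sum.cong refl)
    fix p assume "p \<in> {..<r}"
    hence p: "p < r" by simp
    have "(\<Sum>x\<in>UNIV. if i p = u \<and> j p = x then (if pairs r i j - {#(u, x)#} + {#(w, x)#} = m then 1 else 0) else (0::'a))
       = (\<Sum>x\<in>UNIV. if x = j p then (if i p = u then (if pairs r i j - {#(u, x)#} + {#(w, x)#} = m then 1 else 0) else 0) else 0)"
      by (intro sum.cong) auto
    also have "\<dots> = (if i p = u then (if pairs r i j - {#(u, j p)#} + {#(w, j p)#} = m then 1 else 0) else 0)" by simp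
    finally show "(if i p = u then pairs_eq r m (i(p := w)) j else (0::'a)) = (\<Sum>x\<in>UNIV. if i p = u \<and> j p = x
         then (if pairs r i j - {#(u, x)#} + {#(w, x)#} = m then 1 else 0) else 0)"
      using pairs_upd[OF p, of i w j] by auto
  qed
  also have "\<dots> = (\<Sum>x\<in>UNIV. \<Sum>p<r. if i p = u \<and> j p = x then (if pairs r i j - {#(u, x)#} + {#(w, x)#} = m then 1 else 0) else 0)"
    by (rule sum.swap)
  also have "\<dots> = (\<Sum>x\<in>UNIV. of_nat (card {p. p < r \<and> i p = u \<and> j p = x}) * (if pairs r i j - {#(u, x)#} + {#(w, x)#} = m then 1 else 0))"
  proof (intro sum.cong refl)
    fix x
    have "(\<Sum>p<r. if i p = u \<and> j p = x then c else 0) = (\<Sum>p\<in>{p. p < r \<and> i p = u \<and> j p = x}. c)" for c :: 'a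
      by (intro sum.mono_neutral_cong_right) auto
    thus "(\<Sum>p<r. if i p = u \<and> j p = x then (if pairs r i j - {#(u, x)#} + {#(w, x)#} = m then 1 else 0) else (0::'a))
      = of_nat (card {p. p < r \<and> i p = u \<and> j p = x}) * (if pairs r i j - {#(u, x)#} + {#(w, x)#} = m then 1 else 0)" by simp
  qed
  finally show ?thesis by (simp add: count_pairs)
qed

text \<open>Induction on the number of off-diagonal pairs. For such a pair (u, w) in m let m1 arise
  by replacing it with (w, w). The matrix unit at (u, w) applied to the indicator of m1 is a
  multiple of the indicator of m plus indicators with fewer off-diagonal pairs. The multiple is a
  multiplicity and is nonzero in characteristic 0.\<close>

lemma gl_invariant_commutes_pairs_eq:
  fixes a :: "(nat \<Rightarrow> 'n::finite) \<Rightarrow> (nat \<Rightarrow> 'n) \<Rightarrow> 'a::field_char_0"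
  assumes inv: "gl_invariant r a"
  shows "commutes r a (pairs_eq r m)"
proof (induction "off_diag m" arbitrary: m rule: less_induct)
  case less
  show ?case
  proof (cases "off_diag m = 0")
    case True
    have eq: "i = j" if "pairs r i j = m" "i \<in> tuples r" "j \<in> tuples r" for i j :: "nat \<Rightarrow> 'n"
    proof (rule PiE_ext[OF that(2,3)])
      fix p assume "p \<in> {..<r}"
      hence "(i p, j p) \<in># m" using that(1) by (auto simp: pairs_def)
      thus "i p = j p" using True by (auto simp: off_diag_def filter_mset_eq_mempty_iff)
    qed
    \<comment> \<open>Without off-diagonal pairs the indicator is a diagonal matrix that depends
      only on how often each index occurs. Invariance for u = w, a comparison of weights, shows that
      nonzero entries of a join only tuples with equal contents.\<close>
    have "pairs r i i = pairs r j j" if nz: "a i j \<noteq> 0" and ij: "i \<in> tuples r" "j \<in> tuples r" for i j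
    proof -
      have cnt: "card {p. p < r \<and> i p = u} = card {p. p < r \<and> j p = u}" for u
      proof -
        have c: "(\<Sum>p<r. if k p = u then a i j else 0) = of_nat (card {p. p < r \<and> k p = u}) * a i j" for k
        proof -
          have "(\<Sum>p<r. if k p = u then a i j else 0) = (\<Sum>p\<in>{p. p < r \<and> k p = u}. a i j)"
            by (intro sum.mono_neutral_cong_right) auto
          thus ?thesis by simp
        qed
        have "(\<Sum>p<r. if i p = u then a i j else 0) = (\<Sum>p<r. if i p = u then a (i(p := u)) j else 0)"
          by (intro sum.cong refl) (metis fun_upd_triv)
        also have "\<dots> = (\<Sum>p<r. if j p = u then a i (j(p := u)) else 0)"
          using inv ij by (simp add: gl_invariant_def)
        also have "\<dots> = (\<Sum>p<r. if j p = u then a i j else 0)"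
          by (intro sum.cong refl) (metis fun_upd_triv)
        finally show ?thesis using nz by (simp add: c)
      qed
      show ?thesis
      proof (rule multiset_eqI)
        fix xy :: "'n \<times> 'n"
        obtain x y where [simp]: "xy = (x, y)" by (cases xy)
        show "count (pairs r i i) xy = count (pairs r j j) xy"
        proof (cases "x = y")
          case False
          thus ?thesis by (auto simp: count_pairs intro!: arg_cong[where f = card])
        qed (use cnt[of x] in \<open>simp add: count_pairs\<close>)
      qed
    qed
    hence sw: "a i j * pairs_eq r m j j = pairs_eq r m i i * a i j" if "i \<in> tuples r" "j \<in> tuples r" for i j
      using that by (cases "a i j = 0") auto
    show ?thesis unfolding commutes_def
    proof (intro ballI)
      fix i j :: "nat \<Rightarrow> 'n" assume ij: "i \<in> tuples r" "j \<in> tuples r"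
      have "(\<Sum>k\<in>tuples r. a i k * pairs_eq r m k j) = (\<Sum>k\<in>tuples r. if k = j then a i j * pairs_eq r m j j else 0)"
        using eq ij by (intro sum.cong) auto
      moreover have "(\<Sum>k\<in>tuples r. pairs_eq r m i k * a k j) = (\<Sum>k\<in>tuples r. if k = i then pairs_eq r m i i * a i j else 0)"
        using eq ij by (intro sum.cong) auto
      ultimately show "(\<Sum>k\<in>tuples r. a i k * pairs_eq r m k j) = (\<Sum>k\<in>tuples r. pairs_eq r m i k * a k j)"
        using ij sw[OF ij] by simp
    qed
  next
    case False
    then obtain u w where uw: "(u, w) \<in># m" "u \<noteq> w"
      by (auto simp: off_diag_def filter_mset_eq_mempty_iff)
    then obtain m0 where m0: "m = add_mset (u, w) m0" by (metis insert_DiffM)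
    define m1 where "m1 = add_mset (w, w) m0"
    define mx where "mx = (\<lambda>x. m1 - {#(w, x)#} + {#(u, x)#})"
    define X where "X = {x. x \<noteq> w \<and> (w, x) \<in># m1}"
    have od: "off_diag m = Suc (off_diag m1)" using uw by (simp add: m0 m1_def off_diag_def)
    have odx: "off_diag (mx x) < off_diag m" if "x \<in> X" for x
    proof -
      have "(w, x) \<in># m1" "x \<noteq> w" using that by (auto simp: X_def)
      then obtain m2 where m2: "m1 = add_mset (w, x) m2" by (metis insert_DiffM)
      hence "mx x = add_mset (u, x) m2" by (simp add: mx_def)
      thus ?thesis using \<open>x \<noteq> w\<close> unfolding od by (simp add: m2 off_diag_def)
    qed
    let ?c = "\<lambda>x. of_nat (count (mx x) (u, x)) :: 'a"
    have termx: "of_nat (count (pairs r i j) (u, x)) * (if pairs r i j - {#(u, x)#} + {#(w, x)#} = m1 then 1 else (0::'a))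
       = (if (w, x) \<in># m1 then ?c x * pairs_eq r (mx x) i j else 0)" for i j :: "nat \<Rightarrow> 'n" and x
    proof (cases "(u, x) \<in># pairs r i j \<and> pairs r i j - {#(u, x)#} + {#(w, x)#} = m1")
      case True
      then obtain m2 where "pairs r i j = add_mset (u, x) m2" by (metis insert_DiffM)
      hence "pairs r i j = mx x" "(w, x) \<in># m1" using True by (auto simp: mx_def)
      thus ?thesis using True by simp
    next
      case False
      have "\<not> (pairs r i j = mx x \<and> (w, x) \<in># m1)"
      proof
        assume *: "pairs r i j = mx x \<and> (w, x) \<in># m1"
        then obtain m2 where "m1 = add_mset (w, x) m2" by (metis insert_DiffM)
        thus False using False * by (auto simp: mx_def)
      qed
      moreover have "count (pairs r i j) (u, x) = 0 \<or> pairs r i j - {#(u, x)#} + {#(w, x)#} \<noteq> m1"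
        using False by (auto simp: not_in_iff)
      ultimately show ?thesis by auto
    qed
    have mxw: "mx w = m" by (simp add: mx_def m1_def m0)
    have step: "(\<Sum>p<r. if i p = u then pairs_eq r m1 (i(p := w)) j else (0::'a))
       = ?c w * pairs_eq r m i j + (\<Sum>x\<in>X. ?c x * pairs_eq r (mx x) i j)" for i j
    proof -
      have "(\<Sum>p<r. if i p = u then pairs_eq r m1 (i(p := w)) j else (0::'a))
        = (\<Sum>x\<in>UNIV. if (w, x) \<in># m1 then ?c x * pairs_eq r (mx x) i j else 0)"
        unfolding gl_step_pairs_eq termx ..
      also have "\<dots> = (\<Sum>x\<in>{x. (w, x) \<in># m1}. ?c x * pairs_eq r (mx x) i j)"
        by (intro sum.mono_neutral_cong_right) auto
      also have "{x. (w, x) \<in># m1} = insert w X" by (auto simp: X_def m1_def)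
      also have "(\<Sum>x\<in>insert w X. ?c x * pairs_eq r (mx x) i j) = ?c w * pairs_eq r m i j + (\<Sum>x\<in>X. ?c x * pairs_eq r (mx x) i j)"
        by (subst sum.insert) (auto simp: X_def mxw)
      finally show ?thesis .
    qed
    have cw: "?c w \<noteq> 0" using uw by (simp add: mxw)
    have eq: "pairs_eq r m i j = (\<Sum>x\<in>insert None (Some ` X). (case x of None \<Rightarrow> 1 / ?c w | Some x \<Rightarrow> - ?c x / ?c w) *
       (case x of None \<Rightarrow> (\<lambda>i j. \<Sum>p<r. if i p = u then pairs_eq r m1 (i(p := w)) j else 0) | Some x \<Rightarrow> pairs_eq r (mx x)) i j)" for i j
    proof -
      let ?Q = "\<Sum>x\<in>X. ?c x * pairs_eq r (mx x) i j"
      have "(\<Sum>x\<in>insert None (Some ` X). (case x of None \<Rightarrow> 1 / ?c w | Some x \<Rightarrow> - ?c x / ?c w) *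
         (case x of None \<Rightarrow> (\<lambda>i j. \<Sum>p<r. if i p = u then pairs_eq r m1 (i(p := w)) j else 0) | Some x \<Rightarrow> pairs_eq r (mx x)) i j)
         = 1 / ?c w * (?c w * pairs_eq r m i j + ?Q) + (\<Sum>x\<in>X. - ?c x / ?c w * pairs_eq r (mx x) i j)"
        unfolding step[symmetric] by (subst sum.insert) (simp_all add: sum.reindex image_iff)
      also have "(\<Sum>x\<in>X. - ?c x / ?c w * pairs_eq r (mx x) i j) = - (?Q / ?c w)"
        unfolding sum_divide_distrib sum_negf[symmetric] by (intro sum.cong refl) simp
      finally show ?thesis using cw by (simp add: add_divide_distrib distrib_left)
    qed
    have "commutes r a (\<lambda>i j. \<Sum>x\<in>insert None (Some ` X). (case x of None \<Rightarrow> 1 / ?c w | Some x \<Rightarrow> - ?c x / ?c w) *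
       (case x of None \<Rightarrow> (\<lambda>i j. \<Sum>p<r. if i p = u then pairs_eq r m1 (i(p := w)) j else 0) | Some x \<Rightarrow> pairs_eq r (mx x)) i j)"
    proof (rule commutes_sum)
      fix x assume "x \<in> insert None (Some ` X)"
      thus "commutes r a (case x of None \<Rightarrow> (\<lambda>i j. \<Sum>p<r. if i p = u then pairs_eq r m1 (i(p := w)) j else 0) | Some x \<Rightarrow> pairs_eq r (mx x))"
        using less[OF odx] commutes_gl_step[OF inv less[of m1]] od by auto
    qed
    thus ?thesis by (rule commutes_cong) (simp only: eq)
  qed
qed

lemma gl_invariant_span_perms:
  fixes a :: "(nat \<Rightarrow> 'n::finite) \<Rightarrow> (nat \<Rightarrow> 'n) \<Rightarrow> 'a::field_char_0"
  assumes inv: "gl_invariant r a"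
  shows "\<exists>c. \<forall>i\<in>tuples r. \<forall>j\<in>tuples r. a i j = (\<Sum>\<sigma>\<in>perms r. c \<sigma> * (if j = i \<circ> \<sigma> then 1 else 0))"
proof (rule double_centraliser_tuples)
  fix b :: "(nat \<Rightarrow> 'n) \<Rightarrow> (nat \<Rightarrow> 'n) \<Rightarrow> 'a" and i h :: "nat \<Rightarrow> 'n"
  assume b: "\<And>\<sigma> i j. \<sigma> permutes {..<r} \<Longrightarrow> i \<in> tuples r \<Longrightarrow> j \<in> tuples r \<Longrightarrow> b (i \<circ> \<sigma>) (j \<circ> \<sigma>) = b i j"
    and ih: "i \<in> tuples r" "h \<in> tuples r"
  have dep: "b i j = b i' j'" if "pairs r i j = pairs r i' j'" "i \<in> tuples r" "j \<in> tuples r" "i' \<in> tuples r" "j' \<in> tuples r"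
    for i j i' j'
  proof -
    have eq: "image_mset (\<lambda>p. (i p, j p)) (mset_set {..<r}) = image_mset (\<lambda>p. (i' p, j' p)) (mset_set {..<r})"
      using that(1) by (simp add: pairs_def)
    obtain \<sigma> where s: "\<sigma> permutes {..<r}" "\<And>p. p \<in> {..<r} \<Longrightarrow> (i p, j p) = (i' (\<sigma> p), j' (\<sigma> p))"
      by (rule image_mset_eq_implies_permutes[OF finite_lessThan eq]) blast
    have "i = i' \<circ> \<sigma>" by (rule PiE_ext[OF that(2) PiE_comp_perm[OF that(4) s(1)]]) (use s(2) in auto)
    moreover have "j = j' \<circ> \<sigma>" by (rule PiE_ext[OF that(3) PiE_comp_perm[OF that(5) s(1)]]) (use s(2) in auto)
    ultimately show ?thesis using b[OF s(1) that(4,5)] by simp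
  qed
  \<comment> \<open>By \<open>dep\<close>, b is constant on orbits, so it is the combination of
    orbit indicators with its orbit values as coefficients.\<close>
  define S where "S = (\<lambda>(i, j). pairs r i j) ` (tuples r \<times> tuples r :: ((nat \<Rightarrow> 'n) \<times> (nat \<Rightarrow> 'n)) set)"
  define \<beta> where "\<beta> = (\<lambda>m. let x = SOME x. x \<in> tuples r \<times> tuples r \<and> pairs r (fst x) (snd x) = m in b (fst x) (snd x))"
  have \<beta>: "\<beta> (pairs r i j) = b i j" if "i \<in> tuples r" "j \<in> tuples r" for i j
  proof -
    let ?P = "\<lambda>x. x \<in> tuples r \<times> tuples r \<and> pairs r (fst x) (snd x) = pairs r i j"
    have "?P (i, j)" using that by simp
    hence "?P (Eps ?P)" by (rule someI)
    thus ?thesis unfolding \<beta>_def Let_def using that by (intro dep) (auto simp: mem_Times_iff)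
  qed
  have "commutes r a (\<lambda>i j. \<Sum>m\<in>S. \<beta> m * pairs_eq r m i j)"
    by (intro commutes_sum gl_invariant_commutes_pairs_eq inv)
  hence "commutes r a b"
  proof (rule commutes_cong)
    fix i j :: "nat \<Rightarrow> 'n" assume ij: "i \<in> tuples r" "j \<in> tuples r"
    have "(\<Sum>m\<in>S. \<beta> m * pairs_eq r m i j) = (\<Sum>m\<in>S. if m = pairs r i j then b i j else 0)"
      using \<beta>[OF ij] by (intro sum.cong) auto
    also have "\<dots> = b i j" using ij by (auto simp: S_def)
    finally show "(\<Sum>m\<in>S. \<beta> m * pairs_eq r m i j) = b i j" .
  qed
  thus "(\<Sum>k\<in>tuples r. a i k * b k h) = (\<Sum>k\<in>tuples r. b i k * a k h)" using ih by (simp add: commutes_def)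
qed

section \<open>Polynomials as symmetric tensors\<close>

definition vmono :: "nat \<Rightarrow> (nat \<Rightarrow> 'v) \<Rightarrow> 'v \<Rightarrow>\<^sub>0 nat" where
  "vmono r v = (\<Sum>p<r. Poly_Mapping.single (v p) 1)"

definition mon :: "nat \<Rightarrow> (nat \<Rightarrow> 'v) \<Rightarrow> ('v, 'a::comm_ring_1) mpoly" where
  "mon r v = (\<Prod>p<r. pvar (v p))"

lemma mon_single: "mon r v = Poly_Mapping.single (vmono r v) 1"
  by (induction r) (auto simp: mon_def vmono_def pvar_def mult_single)

lemma pconst_mon: "pconst c * mon r v = Poly_Mapping.single (vmono r v) c"
  by (simp add: mon_single pconst_def mult_single)

lemma lookup_vmono: "Poly_Mapping.lookup (vmono r v) x = count (image_mset v (mset_set {..<r})) x"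
  by (induction r) (auto simp: vmono_def lookup_add lookup_single when_def lessThan_Suc)

lemma mono_eq_iff: "vmono r v = vmono r' v' \<longleftrightarrow> image_mset v (mset_set {..<r}) = image_mset v' (mset_set {..<r'})"
  by (auto simp: poly_mapping_eq_iff fun_eq_iff lookup_vmono multiset_eq_iff)

lemma mono_eq_length: "vmono r v = vmono r' v' \<Longrightarrow> r = r'"
  by (metis mono_eq_iff size_image_mset size_mset_set card_lessThan)

lemma mono_perm: "\<rho> permutes {..<r} \<Longrightarrow> vmono r (v \<circ> \<rho>) = vmono r v"
  using sum.permute[of \<rho> "{..<r}" "\<lambda>p. Poly_Mapping.single (v p) (1::nat)"] by (simp add: vmono_def o_def)

lemma mono_eq_perm:
  assumes "vmono r v = vmono r v'" "v \<in> PiE {..<r} (\<lambda>_. V)" "v' \<in> PiE {..<r} (\<lambda>_. V)"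
  obtains \<rho> where "\<rho> permutes {..<r}" "v = v' \<circ> \<rho>"
proof -
  have eq: "image_mset v (mset_set {..<r}) = image_mset v' (mset_set {..<r})"
    using assms(1) by (simp add: mono_eq_iff)
  obtain \<rho> where \<rho>: "\<rho> permutes {..<r}" "\<forall>p\<in>{..<r}. v p = v' (\<rho> p)"
    by (rule image_mset_eq_implies_permutes[OF finite_lessThan eq]) blast
  have "v = v' \<circ> \<rho>"
    by (rule PiE_ext[OF assms(2) PiE_comp_perm[OF assms(3) \<rho>(1)]]) (use \<rho>(2) in auto)
  thus ?thesis using that \<rho>(1) by blast
qed

lemma ex_mono:
  "Poly_Mapping.keys m \<subseteq> V \<Longrightarrow> \<exists>r. \<exists>v\<in>PiE {..<r} (\<lambda>_. V). vmono r v = m"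
proof (induction "\<Sum>x\<in>Poly_Mapping.keys m. Poly_Mapping.lookup m x" arbitrary: m rule: less_induct)
  case less
  show ?case
  proof (cases "m = 0")
    case True
    thus ?thesis by (intro exI[of _ 0]) (auto simp: vmono_def)
  next
    case False
    then obtain x where x: "x \<in> Poly_Mapping.keys m" by (metis equals0I keys_eq_empty)
    define m' where "m' = m - Poly_Mapping.single x 1"
    have m: "m = m' + Poly_Mapping.single x 1"
      using x by (intro poly_mapping_eqI) (auto simp: m'_def lookup_add lookup_minus lookup_single when_def in_keys_iff)
    have l: "Poly_Mapping.lookup m' y = Poly_Mapping.lookup m y - (if y = x then 1 else 0)" for y
      by (auto simp: m'_def lookup_minus lookup_single when_def)
    have sub: "Poly_Mapping.keys m' \<subseteq> Poly_Mapping.keys m" by (auto simp: in_keys_iff l)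
    have "(\<Sum>y\<in>Poly_Mapping.keys m'. Poly_Mapping.lookup m' y) = (\<Sum>y\<in>Poly_Mapping.keys m. Poly_Mapping.lookup m' y)"
      using sub by (intro sum.mono_neutral_left) (auto simp: in_keys_iff)
    also have "\<dots> < (\<Sum>y\<in>Poly_Mapping.keys m. Poly_Mapping.lookup m y)"
      using x by (intro sum_strict_mono_ex1) (auto simp: l in_keys_iff intro!: bexI[of _ x])
    finally obtain r v where v: "v \<in> PiE {..<r} (\<lambda>_. V)" "vmono r v = m'"
      using less.hyps[of m'] sub less.prems by blast
    have "v(r := x) \<in> PiE {..<Suc r} (\<lambda>_. V)"
      using v(1) x less.prems by (auto simp: PiE_def extensional_def Pi_def less_Suc_eq)
    moreover have "vmono (Suc r) (v(r := x)) = m"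
    proof -
      have "(\<Sum>p<r. Poly_Mapping.single ((v(r := x)) p) (1::nat)) = vmono r v"
        unfolding vmono_def by (intro sum.cong) auto
      thus ?thesis using v(2) by (simp add: vmono_def m)
    qed
    ultimately show ?thesis by blast
  qed
qed

lemma lookup_tensor_sum:
  assumes "r0 \<le> D" "finite V"
  shows "Poly_Mapping.lookup (\<Sum>r\<le>D. \<Sum>v\<in>PiE {..<r} (\<lambda>_. V). pconst (b r v) * mon r v) (vmono r0 v0)
    = (\<Sum>v\<in>{v\<in>PiE {..<r0} (\<lambda>_. V). vmono r0 v = vmono r0 v0}. b r0 v)"
proof -
  let ?P = "\<lambda>r :: nat. PiE {..<r} (\<lambda>_. V)"
  have fin: "finite (?P r)" for r using assms(2) by (intro finite_PiE) auto
  have "Poly_Mapping.lookup (\<Sum>r\<le>D. \<Sum>v\<in>?P r. pconst (b r v) * mon r v) (vmono r0 v0)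
    = (\<Sum>r\<le>D. \<Sum>v\<in>?P r. if vmono r v = vmono r0 v0 then b r v else 0)"
    by (simp add: lookup_sum pconst_mon lookup_single when_def)
  also have "\<dots> = (\<Sum>r\<le>D. if r = r0 then (\<Sum>v\<in>?P r0. if vmono r0 v = vmono r0 v0 then b r0 v else 0) else 0)"
  proof (rule sum.cong[OF refl])
    fix r
    have "(\<Sum>v\<in>?P r. if vmono r v = vmono r0 v0 then b r v else 0) = 0" if "r \<noteq> r0"
      using that mono_eq_length[of r _ r0 v0] by (intro sum.neutral) metis
    thus "(\<Sum>v\<in>?P r. if vmono r v = vmono r0 v0 then b r v else 0)
      = (if r = r0 then \<Sum>v\<in>?P r0. if vmono r0 v = vmono r0 v0 then b r0 v else 0 else 0)"
      by metis
  qed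
  also have "\<dots> = (\<Sum>v\<in>?P r0. if vmono r0 v = vmono r0 v0 then b r0 v else 0)" using assms by simp
  also have "\<dots> = (\<Sum>v\<in>{v\<in>?P r0. vmono r0 v = vmono r0 v0}. b r0 v)"
    using fin by (intro sum.mono_neutral_cong_right) auto
  finally show ?thesis .
qed

text \<open>A monomial does not remember the order of its factors, so a vanishing polynomial forces
  only the symmetrised coefficients to vanish.\<close>

lemma tensor_sum_eq_0:
  fixes b :: "nat \<Rightarrow> (nat \<Rightarrow> 'v) \<Rightarrow> 'a::field_char_0"
  assumes zero: "(\<Sum>r\<le>D. \<Sum>v\<in>PiE {..<r} (\<lambda>_. V). pconst (b r v) * mon r v) = 0"
    and "finite V" "r \<le> D" "v0 \<in> PiE {..<r} (\<lambda>_. V)"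
  shows "(\<Sum>\<rho>\<in>perms r. b r (v0 \<circ> \<rho>)) = 0"
proof -
  let ?C = "{v\<in>PiE {..<r} (\<lambda>_. V). vmono r v = vmono r v0}"
  define Z where "Z = (\<lambda>v. \<Sum>\<rho>\<in>perms r. b r (v \<circ> \<rho>))"
  have C0: "(\<Sum>v\<in>?C. b r v) = 0"
    using lookup_tensor_sum[OF assms(3,2), of b v0] zero by simp
  \<comment> \<open>Z is constant on the arrangements of v0 and its sum over them vanishes, because
    every permutation merely rearranges a sum that is zero. In characteristic 0 the constant is then
    zero.\<close>
  have "Z v = Z v0" if v: "v \<in> ?C" for v
  proof -
    obtain \<tau> where t: "\<tau> permutes {..<r}" "v = v0 \<circ> \<tau>" using mono_eq_perm[of r v v0 V] v assms(4) by auto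
    show ?thesis unfolding Z_def t(2)
      using setum_permutations_compose_left[OF t(1), of "\<lambda>\<rho>. b r (v0 \<circ> \<rho>)"] by (simp add: comp_assoc)
  qed
  hence "(\<Sum>v\<in>?C. Z v) = of_nat (card ?C) * Z v0" by simp
  moreover have "(\<Sum>v\<in>?C. Z v) = 0"
  proof -
    have "(\<Sum>v\<in>?C. Z v) = (\<Sum>\<rho>\<in>perms r. \<Sum>v\<in>?C. b r (v \<circ> \<rho>))" unfolding Z_def by (rule sum.swap)
    also have "\<dots> = (\<Sum>\<rho>\<in>perms r. 0)"
    proof (rule sum.cong[OF refl])
      fix \<rho> assume "\<rho> \<in> perms r"
      hence \<rho>: "\<rho> permutes {..<r}" "inv \<rho> permutes {..<r}" by (auto intro: permutes_inv)
      have c: "\<rho> \<circ> inv \<rho> = id" "inv \<rho> \<circ> \<rho> = id" using permutes_inv_o[OF \<rho>(1)] by auto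
      have "(\<Sum>v\<in>?C. b r (v \<circ> \<rho>)) = (\<Sum>v\<in>?C. b r v)"
        by (rule sum.reindex_bij_witness[of _ "\<lambda>v. v \<circ> inv \<rho>" "\<lambda>v. v \<circ> \<rho>"])
          (use \<rho> in \<open>auto simp: comp_assoc c mono_perm PiE_comp_perm simp del: PiE_iff\<close>)
      thus "(\<Sum>v\<in>?C. b r (v \<circ> \<rho>)) = 0" using C0 by simp
    qed
    finally show ?thesis by simp
  qed
  moreover have "card ?C \<noteq> 0"
  proof -
    have "finite ?C" using assms(2) by (auto intro!: finite_PiE)
    moreover have "v0 \<in> ?C" using assms(4) by simp
    ultimately show ?thesis by (metis card_0_eq empty_iff)
  qed
  ultimately show ?thesis by (simp add: Z_def)
qed

text \<open>Each coefficient is spread evenly over the arrangements of its monomial; dividing by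
  their number requires characteristic 0.\<close>

lemma ex_tensor_expansion:
  fixes f :: "('v, 'a::field_char_0) mpoly"
  assumes "finite V" "\<And>m. m \<in> Poly_Mapping.keys f \<Longrightarrow> Poly_Mapping.keys m \<subseteq> V"
  shows "\<exists>D a. f = (\<Sum>r\<le>D. \<Sum>v\<in>PiE {..<r} (\<lambda>_. V). pconst (a r v) * mon r v)
     \<and> (\<forall>r v \<rho>. \<rho> permutes {..<r} \<longrightarrow> a r (v \<circ> \<rho>) = a r v)"
proof -
  let ?P = "\<lambda>r :: nat. PiE {..<r} (\<lambda>_. V)"
  define N where "N = (\<lambda>r m. card {v\<in>?P r. vmono r v = m})"
  define a where "a = (\<lambda>r v. Poly_Mapping.lookup f (vmono r v) / of_nat (N r (vmono r v)))"
  have "\<forall>m\<in>Poly_Mapping.keys f. \<exists>r. \<exists>v\<in>?P r. vmono r v = m" by (intro ballI ex_mono assms(2))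
  then obtain R where R: "\<And>m. m \<in> Poly_Mapping.keys f \<Longrightarrow> \<exists>v\<in>?P (R m). vmono (R m) v = m" by metis
  define D where "D = Max (insert 0 (R ` Poly_Mapping.keys f))"
  have D: "R m \<le> D" if "m \<in> Poly_Mapping.keys f" for m using that by (auto simp: D_def)
  have "f = (\<Sum>r\<le>D. \<Sum>v\<in>?P r. pconst (a r v) * mon r v)"
  proof (rule poly_mapping_eqI)
    fix m
    show "Poly_Mapping.lookup f m = Poly_Mapping.lookup (\<Sum>r\<le>D. \<Sum>v\<in>?P r. pconst (a r v) * mon r v) m"
    proof (cases "m \<in> Poly_Mapping.keys f")
      case True
      then obtain v0 where v0: "v0 \<in> ?P (R m)" "vmono (R m) v0 = m" using R by blast
      have "Poly_Mapping.lookup (\<Sum>r\<le>D. \<Sum>v\<in>?P r. pconst (a r v) * mon r v) m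
         = (\<Sum>v\<in>{v\<in>?P (R m). vmono (R m) v = m}. a (R m) v)"
        using lookup_tensor_sum[OF D[OF True] assms(1), of a v0] by (simp add: v0)
      also have "\<dots> = (\<Sum>v\<in>{v\<in>?P (R m). vmono (R m) v = m}. Poly_Mapping.lookup f m / of_nat (N (R m) m))"
        by (intro sum.cong) (auto simp: a_def)
      also have "\<dots> = of_nat (N (R m) m) * (Poly_Mapping.lookup f m / of_nat (N (R m) m))"
        by (simp add: N_def)
      also have "\<dots> = Poly_Mapping.lookup f m"
      proof -
        have "finite {v\<in>?P (R m). vmono (R m) v = m}" using assms(1) by (auto intro!: finite_PiE)
        hence "N (R m) m \<noteq> 0" unfolding N_def using v0 by (metis (mono_tags, lifting) card_0_eq empty_iff mem_Collect_eq)
        thus ?thesis by simp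
      qed
      finally show ?thesis by simp
    next
      case False
      hence "a r v = 0" if "vmono r v = m" for r v using that by (simp add: a_def in_keys_iff)
      hence "Poly_Mapping.lookup (pconst (a r v) * mon r v) m = 0" for r v
        by (auto simp: pconst_mon lookup_single when_def)
      thus ?thesis using False by (simp add: lookup_sum in_keys_iff)
    qed
  qed
  moreover have "\<forall>r v \<rho>. \<rho> permutes {..<r} \<longrightarrow> a r (v \<circ> \<rho>) = a r v"
    by (auto simp: a_def mono_perm)
  ultimately show ?thesis by blast
qed

section \<open>The first fundamental theorem for matrices\<close>

definition zip3 :: "nat \<Rightarrow> (nat \<Rightarrow> nat) \<Rightarrow> (nat \<Rightarrow> 'n) \<Rightarrow> (nat \<Rightarrow> 'n) \<Rightarrow> nat \<Rightarrow> nat \<times> 'n \<times> 'n" where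
  "zip3 r k i j = restrict (\<lambda>p. (k p, i p, j p)) {..<r}"

lemma sum_zip3:
  fixes F :: "(nat \<Rightarrow> nat \<times> 'n::finite \<times> 'n) \<Rightarrow> 'b::comm_monoid_add"
  shows "(\<Sum>v\<in>PiE {..<r} (\<lambda>_. K \<times> UNIV). F v) = (\<Sum>k\<in>PiE {..<r} (\<lambda>_. K). \<Sum>i\<in>tuples r. \<Sum>j\<in>tuples r. F (zip3 r k i j))"
proof -
  let ?T = "tuples r :: (nat \<Rightarrow> 'n) set"
  have "(\<Sum>v\<in>PiE {..<r} (\<lambda>_. K \<times> UNIV). F v) = (\<Sum>x\<in>PiE {..<r} (\<lambda>_. K) \<times> ?T \<times> ?T. F (zip3 r (fst x) (fst (snd x)) (snd (snd x))))"
    by (rule sum.reindex_bij_witness[of _ "\<lambda>x. zip3 r (fst x) (fst (snd x)) (snd (snd x))"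
          "\<lambda>v. (restrict (fst \<circ> v) {..<r}, restrict (fst \<circ> snd \<circ> v) {..<r}, restrict (snd \<circ> snd \<circ> v) {..<r})"])
      (auto simp: zip3_def PiE_def extensional_def Pi_def fun_eq_iff restrict_def mem_Times_iff intro!: arg_cong[where f = F])
  also have "\<dots> = (\<Sum>k\<in>PiE {..<r} (\<lambda>_. K). \<Sum>i\<in>?T. \<Sum>j\<in>?T. F (zip3 r k i j))"
    by (simp add: sum.cartesian_product split_def)
  finally show ?thesis .
qed

text \<open>For a permutation \<sigma> of the positions this is the product, over its cycles, of
  traces of generic matrices with the letters k along the cycle. The index sum is the form in which
  it meets the coefficient tensors.\<close>

definition trace_mon :: "nat \<Rightarrow> (nat \<Rightarrow> nat) \<Rightarrow> (nat \<Rightarrow> nat) \<Rightarrow> ('a::comm_ring_1, 'n::finite) cpoly" where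
  "trace_mon r k \<sigma> = (\<Sum>i\<in>tuples r. \<Prod>p<r. pvar (k p, i p, i (\<sigma> p)))"

abbreviation set_row :: "nat \<times> 'n \<times> 'n \<Rightarrow> 'n \<Rightarrow> nat \<times> 'n \<times> 'n" where
  "set_row x i \<equiv> (fst x, i, snd (snd x))"
abbreviation set_col :: "nat \<times> 'n \<times> 'n \<Rightarrow> 'n \<Rightarrow> nat \<times> 'n \<times> 'n" where
  "set_col x j \<equiv> (fst x, fst (snd x), j)"

lemma mon_upd: "p < r \<Longrightarrow> mon r (v(p := x)) = pvar x * (\<Prod>q\<in>{..<r} - {p}. pvar (v q))"
proof -
  assume p: "p < r"
  have "mon r (v(p := x)) = pvar x * (\<Prod>q\<in>{..<r} - {p}. pvar ((v(p := x)) q))"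
    unfolding mon_def using p by (subst prod.remove[of _ p]) auto
  also have "(\<Prod>q\<in>{..<r} - {p}. pvar ((v(p := x)) q)) = (\<Prod>q\<in>{..<r} - {p}. pvar (v q))"
    by (intro prod.cong) auto
  finally show ?thesis .
qed

lemma ad_mon:
  "ad (unit_mat u w) (mon r v) = (\<Sum>p<r. (if fst (snd (v p)) = u then mon r (v(p := set_row (v p) w)) else 0)
      - (if snd (snd (v p)) = w then mon r (v(p := set_col (v p) u)) else 0))"
proof -
  have "ad (unit_mat u w) (mon r v) = (\<Sum>p<r. ad_gen (unit_mat u w) (v p) * (\<Prod>q\<in>{..<r} - {p}. pvar (v q)))"
    unfolding mon_def by (subst deriv_by_prod) auto
  also have "\<dots> = (\<Sum>p<r. (if fst (snd (v p)) = u then mon r (v(p := set_row (v p) w)) else 0)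
      - (if snd (snd (v p)) = w then mon r (v(p := set_col (v p) u)) else 0))"
  proof (rule sum.cong[OF refl])
    fix p assume "p \<in> {..<r}"
    hence p: "p < r" by simp
    obtain k i j where v: "v p = (k, i, j)" by (metis prod.exhaust)
    show "ad_gen (unit_mat u w) (v p) * (\<Prod>q\<in>{..<r} - {p}. pvar (v q)) = (if fst (snd (v p)) = u then mon r (v(p := set_row (v p) w)) else 0)
      - (if snd (snd (v p)) = w then mon r (v(p := set_col (v p) u)) else 0)"
      unfolding v ad_gen_unit_mat by (simp add: mon_upd[OF p] left_diff_distrib)
  qed
  finally show ?thesis .
qed

text \<open>Summation by parts: it moves the substitution at position p from the monomials to the
  coefficients, so that a derivation can be read as an operation on tensors.\<close>

lemma sum_PiE_upd:
  fixes p r :: nat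
  assumes "p < r" "\<And>x. x \<in> V \<Longrightarrow> P x \<Longrightarrow> g x \<in> V \<and> Q (g x) \<and> h (g x) = x"
    "\<And>x. x \<in> V \<Longrightarrow> Q x \<Longrightarrow> h x \<in> V \<and> P (h x) \<and> g (h x) = x" "finite V"
  shows "(\<Sum>v\<in>PiE {..<r} (\<lambda>_. V). if P (v p) then F v (v(p := g (v p))) else 0)
    = (\<Sum>v\<in>PiE {..<r} (\<lambda>_. V). if Q (v p) then F (v(p := h (v p))) v else 0)"
proof -
  let ?P = "PiE {..<r} (\<lambda>_. V)"
  have fin: "finite ?P" using assms(4) by (intro finite_PiE) auto
  have upd: "v(p := x) \<in> ?P" if "v \<in> ?P" "x \<in> V" for v x
    using that assms(1) by (auto simp: PiE_def extensional_def)
  have inV: "v p \<in> V" if "v \<in> ?P" for v using that assms(1) by auto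
  have "(\<Sum>v\<in>?P. if P (v p) then F v (v(p := g (v p))) else 0) = (\<Sum>v\<in>{v\<in>?P. P (v p)}. F v (v(p := g (v p))))"
    using fin by (intro sum.mono_neutral_cong_right) auto
  also have "\<dots> = (\<Sum>v\<in>{v\<in>?P. Q (v p)}. F (v(p := h (v p))) v)"
    by (rule sum.reindex_bij_witness[of _ "\<lambda>v. v(p := h (v p))" "\<lambda>v. v(p := g (v p))"])
      (use assms(2,3) upd inV in \<open>simp_all add: fun_upd_idem\<close>)
  also have "\<dots> = (\<Sum>v\<in>?P. if Q (v p) then F (v(p := h (v p))) v else 0)"
    using fin by (intro sum.mono_neutral_cong_left) auto
  finally show ?thesis .
qed

text \<open>For fixed letters k, the symmetric coefficient tensor of f is a matrix indexed by row
  tuples and column tuples. Annihilation by all matrix units says that this matrix is invariant, so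
  it is a combination of place permutations, and these are the coefficient tensors of trace
  monomials.\<close>

theorem invariants_are_trace_polynomials:
  fixes f :: "('a::field_char_0, 'n::finite) cpoly"
  assumes inv: "\<And>u w. ad (unit_mat u w) f = 0"
  shows "\<exists>D K c. finite K \<and> f = (\<Sum>r\<le>D. \<Sum>k\<in>PiE {..<r} (\<lambda>_. K). \<Sum>\<sigma>\<in>perms r. pconst (c r k \<sigma>) * trace_mon r k \<sigma>)"
proof -
  define K where "K = fst ` (\<Union>m\<in>Poly_Mapping.keys f. Poly_Mapping.keys m)"
  define V :: "(nat \<times> 'n \<times> 'n) set" where "V = K \<times> UNIV"
  have finK: "finite K" by (auto simp: K_def)
  hence finV: "finite V" by (simp add: V_def)
  have "Poly_Mapping.keys m \<subseteq> V" if "m \<in> Poly_Mapping.keys f" for m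
    using that by (force simp: V_def K_def)
  from ex_tensor_expansion[OF finV, of f, OF this] obtain D a where f: "f = (\<Sum>r\<le>D. \<Sum>v\<in>PiE {..<r} (\<lambda>_. V). pconst (a r v) * mon r v)"
    and sym: "\<And>r v \<rho>. \<rho> permutes {..<r} \<Longrightarrow> a r (v \<circ> \<rho>) = a r v"
    by blast
  let ?P = "\<lambda>r :: nat. PiE {..<r} (\<lambda>_. V)"
  \<comment> \<open>The coefficient tensor of \<open>ad (unit_mat u w) f\<close>.\<close>
  define b where "b = (\<lambda>u w r v. (\<Sum>p<r. if fst (snd (v p)) = w then a r (v(p := set_row (v p) u)) else 0)
      - (\<Sum>p<r. if snd (snd (v p)) = u then a r (v(p := set_col (v p) w)) else 0))"
  have b0: "b u w r v = 0" if r: "r \<le> D" and v: "v \<in> ?P r" for u w r v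
  proof -
    have "(\<Sum>r\<le>D. \<Sum>v\<in>?P r. pconst (b u w r v) * mon r v) = ad (unit_mat u w) f"
      unfolding f deriv_by_sum
    proof (rule sum.cong[OF refl])
      fix r
      have 1: "(\<Sum>v\<in>?P r. if fst (snd (v p)) = u then pconst (a r v) * mon r (v(p := set_row (v p) w)) else 0)
         = (\<Sum>v\<in>?P r. if fst (snd (v p)) = w then pconst (a r (v(p := set_row (v p) u))) * mon r v else 0)" if "p < r" for p
        by (rule sum_PiE_upd[OF that, where F = "\<lambda>v v'. pconst (a r v) * mon r v'" and V = V and P = "\<lambda>x. fst (snd x) = u" and Q = "\<lambda>x. fst (snd x) = w"
             and g = "\<lambda>x. set_row x w" and h = "\<lambda>x. set_row x u"]) (use finV in \<open>auto simp: V_def\<close>)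
      have 2: "(\<Sum>v\<in>?P r. if snd (snd (v p)) = w then pconst (a r v) * mon r (v(p := set_col (v p) u)) else 0)
         = (\<Sum>v\<in>?P r. if snd (snd (v p)) = u then pconst (a r (v(p := set_col (v p) w))) * mon r v else 0)" if "p < r" for p
        by (rule sum_PiE_upd[OF that, where F = "\<lambda>v v'. pconst (a r v) * mon r v'" and V = V and P = "\<lambda>x. snd (snd x) = w" and Q = "\<lambda>x. snd (snd x) = u"
             and g = "\<lambda>x. set_col x u" and h = "\<lambda>x. set_col x w"]) (use finV in \<open>auto simp: V_def\<close>)
      have "(\<Sum>v\<in>?P r. ad (unit_mat u w) (pconst (a r v) * mon r v))
        = (\<Sum>v\<in>?P r. \<Sum>p<r. (if fst (snd (v p)) = u then pconst (a r v) * mon r (v(p := set_row (v p) w)) else 0)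
           - (if snd (snd (v p)) = w then pconst (a r v) * mon r (v(p := set_col (v p) u)) else 0))"
        by (rule sum.cong[OF refl], simp only: deriv_by_mult deriv_by_pconst mult_zero_left add_0 ad_mon sum_distrib_left,
            rule sum.cong[OF refl], simp add: right_diff_distrib)
      also have "\<dots> = (\<Sum>p<r. (\<Sum>v\<in>?P r. if fst (snd (v p)) = u then pconst (a r v) * mon r (v(p := set_row (v p) w)) else 0)
           - (\<Sum>v\<in>?P r. if snd (snd (v p)) = w then pconst (a r v) * mon r (v(p := set_col (v p) u)) else 0))"
        by (subst sum.swap) (simp add: sum_subtractf)
      also have "\<dots> = (\<Sum>p<r. (\<Sum>v\<in>?P r. if fst (snd (v p)) = w then pconst (a r (v(p := set_row (v p) u))) * mon r v else 0)
           - (\<Sum>v\<in>?P r. if snd (snd (v p)) = u then pconst (a r (v(p := set_col (v p) w))) * mon r v else 0))"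
        by (rule sum.cong[OF refl]) (simp only: 1 2 lessThan_iff)
      also have "\<dots> = (\<Sum>v\<in>?P r. \<Sum>p<r. (if fst (snd (v p)) = w then pconst (a r (v(p := set_row (v p) u))) * mon r v else 0)
           - (if snd (snd (v p)) = u then pconst (a r (v(p := set_col (v p) w))) * mon r v else 0))"
        unfolding sum_subtractf[symmetric] by (rule sum.swap)
      also have "\<dots> = (\<Sum>v\<in>?P r. pconst (b u w r v) * mon r v)"
      proof (rule sum.cong[OF refl])
        fix v :: "nat \<Rightarrow> nat \<times> 'n \<times> 'n"
        have if1: "(if Q then pconst x * y else 0) = pconst (if Q then x else 0) * y" for Q x and y :: "('a, 'n) cpoly" by simp
        show "(\<Sum>p<r. (if fst (snd (v p)) = w then pconst (a r (v(p := set_row (v p) u))) * mon r v else 0)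
           - (if snd (snd (v p)) = u then pconst (a r (v(p := set_col (v p) w))) * mon r v else 0)) = pconst (b u w r v) * mon r v"
          unfolding if1 b_def is_hom_diff[OF is_hom_pconst] is_hom_sum[OF is_hom_pconst] left_diff_distrib
            sum_distrib_right sum_subtractf ..
      qed
      finally show "(\<Sum>v\<in>?P r. pconst (b u w r v) * mon r v) = (\<Sum>v\<in>?P r. ad (unit_mat u w) (pconst (a r v) * mon r v))" by simp
    qed
    hence "(\<Sum>r\<le>D. \<Sum>v\<in>?P r. pconst (b u w r v) * mon r v) = 0" using inv by simp
    from tensor_sum_eq_0[OF this finV r v] have "(\<Sum>\<rho>\<in>perms r. b u w r (v \<circ> \<rho>)) = 0" .
    \<comment> \<open>b inherits the symmetry of a, so its symmetrisation is a nonzero multiple of b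
      itself.\<close>
    moreover have "b u w r (v \<circ> \<rho>) = b u w r v" if \<rho>: "\<rho> permutes {..<r}" for \<rho>
    proof -
      have upd: "(v \<circ> \<rho>)(p := x) = v(\<rho> p := x) \<circ> \<rho>" for p x
        using permutes_inj[OF \<rho>] by (auto simp: fun_eq_iff inj_eq)
      have s: "a r ((v \<circ> \<rho>)(p := x)) = a r (v(\<rho> p := x))" for p x unfolding upd by (rule sym[OF \<rho>])
      show ?thesis unfolding b_def s comp_apply
        using sum.permute[OF \<rho>, of "\<lambda>p. if fst (snd (v p)) = w then a r (v(p := set_row (v p) u)) else 0"]
          sum.permute[OF \<rho>, of "\<lambda>p. if snd (snd (v p)) = u then a r (v(p := set_col (v p) w)) else 0"]
        by (simp add: o_def)
    qed
    ultimately have "of_nat (card (perms r)) * b u w r v = 0" by simp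
    moreover have "card (perms r) \<noteq> 0" by (simp add: card_permutations)
    ultimately show ?thesis by simp
  qed
  have ex: "\<exists>c. \<forall>i\<in>tuples r. \<forall>j\<in>tuples r. a r (zip3 r k i j) = (\<Sum>\<sigma>\<in>perms r. c \<sigma> * (if j = i \<circ> \<sigma> then 1 else 0))"
    if r: "r \<le> D" and k: "k \<in> PiE {..<r} (\<lambda>_. K)" for r k
  proof (rule gl_invariant_span_perms, unfold gl_invariant_def, intro allI ballI)
    fix u w and i j :: "nat \<Rightarrow> 'n" assume ij: "i \<in> tuples r" "j \<in> tuples r"
    have "zip3 r k i j \<in> ?P r" using k by (auto simp: zip3_def V_def)
    from b0[OF r this, of u w] have lie: "(\<Sum>p<r. if fst (snd (zip3 r k i j p)) = w then a r ((zip3 r k i j)(p := set_row (zip3 r k i j p) u)) else 0)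
      = (\<Sum>p<r. if snd (snd (zip3 r k i j p)) = u then a r ((zip3 r k i j)(p := set_col (zip3 r k i j p) w)) else 0)"
      by (simp add: b_def)
    have z: "(zip3 r k i j)(p := (k p, u, j p)) = zip3 r k (i(p := u)) j"
      "(zip3 r k i j)(p := (k p, i p, w)) = zip3 r k i (j(p := w))"
      "zip3 r k i j p = (k p, i p, j p)" if "p < r" for p
      using that by (auto simp: zip3_def)
    have "(\<Sum>p<r. if fst (snd (zip3 r k i j p)) = w then a r ((zip3 r k i j)(p := set_row (zip3 r k i j p) u)) else 0)
      = (\<Sum>p<r. if i p = w then a r (zip3 r k (i(p := u)) j) else 0)"
      by (rule sum.cong[OF refl]) (simp only: lessThan_iff z fst_conv snd_conv)
    moreover have "(\<Sum>p<r. if snd (snd (zip3 r k i j p)) = u then a r ((zip3 r k i j)(p := set_col (zip3 r k i j p) w)) else 0)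
      = (\<Sum>p<r. if j p = u then a r (zip3 r k i (j(p := w))) else 0)"
      by (rule sum.cong[OF refl]) (simp only: lessThan_iff z fst_conv snd_conv)
    ultimately show "(\<Sum>p<r. if i p = w then a r (zip3 r k (i(p := u)) j) else 0) = (\<Sum>p<r. if j p = u then a r (zip3 r k i (j(p := w))) else 0)"
      using lie by simp
  qed
  define c where "c = (\<lambda>r k. SOME c. \<forall>i\<in>tuples r. \<forall>j\<in>tuples r.
     a r (zip3 r k i j) = (\<Sum>\<sigma>\<in>perms r. c \<sigma> * (if j = i \<circ> \<sigma> then 1 else 0)))"
  have c: "a r (zip3 r k i j) = (\<Sum>\<sigma>\<in>perms r. c r k \<sigma> * (if j = i \<circ> \<sigma> then 1 else 0))"
    if "r \<le> D" "k \<in> PiE {..<r} (\<lambda>_. K)" "i \<in> tuples r" "j \<in> tuples r" for r k i j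
    using someI_ex[OF ex[OF that(1,2)], folded c_def, THEN bspec, OF that(3), THEN bspec, OF that(4)]
    unfolding c_def .
  have "f = (\<Sum>r\<le>D. \<Sum>k\<in>PiE {..<r} (\<lambda>_. K). \<Sum>\<sigma>\<in>perms r. pconst (c r k \<sigma>) * trace_mon r k \<sigma>)"
    unfolding f
  proof (rule sum.cong[OF refl])
    fix r assume "r \<in> {..D}"
    hence r: "r \<le> D" by simp
    have "(\<Sum>v\<in>?P r. pconst (a r v) * mon r v)
      = (\<Sum>k\<in>PiE {..<r} (\<lambda>_. K). \<Sum>i\<in>tuples r. \<Sum>j\<in>tuples r. pconst (a r (zip3 r k i j)) * mon r (zip3 r k i j))"
      unfolding V_def by (rule sum_zip3)
    also have "\<dots> = (\<Sum>k\<in>PiE {..<r} (\<lambda>_. K). \<Sum>\<sigma>\<in>perms r. pconst (c r k \<sigma>) * trace_mon r k \<sigma>)"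
    proof (rule sum.cong[OF refl])
      fix k assume k: "k \<in> PiE {..<r} (\<lambda>_. K)"
      let ?T = "tuples r :: (nat \<Rightarrow> 'n) set"
      have "(\<Sum>i\<in>?T. \<Sum>j\<in>?T. pconst (a r (zip3 r k i j)) * mon r (zip3 r k i j))
        = (\<Sum>i\<in>?T. \<Sum>j\<in>?T. \<Sum>\<sigma>\<in>perms r. pconst (c r k \<sigma>) * (if j = i \<circ> \<sigma> then mon r (zip3 r k i j) else 0))"
        by (rule sum.cong[OF refl], rule sum.cong[OF refl],
            simp only: c[OF r k] is_hom_sum[OF is_hom_pconst] sum_distrib_right, rule sum.cong[OF refl], simp)
      also have "\<dots> = (\<Sum>\<sigma>\<in>perms r. \<Sum>i\<in>?T. \<Sum>j\<in>?T. pconst (c r k \<sigma>) * (if j = i \<circ> \<sigma> then mon r (zip3 r k i j) else 0))"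
        by (rule sum_swap3)
      also have "\<dots> = (\<Sum>\<sigma>\<in>perms r. pconst (c r k \<sigma>) * trace_mon r k \<sigma>)"
      proof (rule sum.cong[OF refl])
        fix \<sigma> assume "\<sigma> \<in> perms r"
        hence s: "\<sigma> permutes {..<r}" by simp
        have "(\<Sum>i\<in>?T. \<Sum>j\<in>?T. pconst (c r k \<sigma>) * (if j = i \<circ> \<sigma> then mon r (zip3 r k i j) else 0))
          = pconst (c r k \<sigma>) * (\<Sum>i\<in>?T. \<Sum>j\<in>?T. (if j = i \<circ> \<sigma> then mon r (zip3 r k i j) else 0))"
          by (simp only: sum_distrib_left)
        also have "(\<Sum>i\<in>?T. \<Sum>j\<in>?T. (if j = i \<circ> \<sigma> then mon r (zip3 r k i j) else 0)) = (\<Sum>i\<in>?T. mon r (zip3 r k i (i \<circ> \<sigma>)))"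
          by (rule sum.cong[OF refl]) (simp add: PiE_comp_perm[OF _ s])
        also have "\<dots> = (trace_mon r k \<sigma> :: ('a, 'n) cpoly)"
          unfolding trace_mon_def mon_def by (intro sum.cong prod.cong refl) (auto simp: zip3_def)
        finally show "(\<Sum>i\<in>?T. \<Sum>j\<in>?T. pconst (c r k \<sigma>) * (if j = i \<circ> \<sigma> then mon r (zip3 r k i j) else 0))
          = pconst (c r k \<sigma>) * trace_mon r k \<sigma>" .
      qed
      finally show "(\<Sum>i\<in>?T. \<Sum>j\<in>?T. pconst (a r (zip3 r k i j)) * mon r (zip3 r k i j))
         = (\<Sum>\<sigma>\<in>perms r. pconst (c r k \<sigma>) * trace_mon r k \<sigma>)" .
    qed
    finally show "(\<Sum>v\<in>?P r. pconst (a r v) * mon r v) = (\<Sum>k\<in>PiE {..<r} (\<lambda>_. K). \<Sum>\<sigma>\<in>perms r. pconst (c r k \<sigma>) * trace_mon r k \<sigma>)" .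
  qed
  thus ?thesis using finK by blast
qed

section \<open>Linear relations between place permutations\<close>

text \<open>The rearrangement inequality inside the classes of f, on each of which g increases. It
  serves with opposite signs: once for values that increase on colour classes, once for the negated
  values on a decreasing set.\<close>

lemma rearrangement_strict:
  fixes g :: "nat \<Rightarrow> int" and f :: "nat \<Rightarrow> 'c"
  assumes "finite Q"
  shows "\<rho> permutes Q \<Longrightarrow> (\<And>p. p \<in> Q \<Longrightarrow> f (\<rho> p) = f p) \<Longrightarrow>
    (\<And>p q. p \<in> Q \<Longrightarrow> q \<in> Q \<Longrightarrow> p < q \<Longrightarrow> f p = f q \<Longrightarrow> g p < g q) \<Longrightarrow> \<rho> \<noteq> id \<Longrightarrow>
    (\<Sum>p\<in>Q. int p * g (\<rho> p)) < (\<Sum>p\<in>Q. int p * g p)"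
  using assms
proof (induction Q arbitrary: \<rho> rule: finite_linorder_max_induct)
  case empty
  thus ?case by simp
next
  case (insert M Q)
  note \<rho> = insert.prems(1) and f = insert.prems(2) and g = insert.prems(3)
  have MQ: "M \<notin> Q" using insert.hyps by auto
  show ?case
  proof (cases "\<rho> M = M")
    case True
    have "\<rho> permutes Q" using permutes_superset[OF \<rho>, of Q] True by auto
    hence "(\<Sum>p\<in>Q. int p * g (\<rho> p)) < (\<Sum>p\<in>Q. int p * g p)"
      using insert.IH[of \<rho>] f g insert.prems(4) by blast
    thus ?thesis using True MQ insert.hyps by simp
  next
    case False
    define a where "a = inv \<rho> M"
    define b where "b = \<rho> M"
    have ra: "\<rho> a = M" using permutes_inverses(1)[OF \<rho>] by (simp add: a_def)
    have aM: "a \<noteq> M" using ra False by auto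
    have aQ: "a \<in> Q" using aM ra \<rho> by (metis insertCI insertE permutes_not_in)
    have bQ: "b \<in> Q" using False permutes_in_image[OF \<rho>, of M] by (auto simp: b_def)
    \<comment> \<open>Composing with a transposition makes the largest position M fixed. The
      exchange strictly increases the sum, because a lies below M and g increases from b to M within
      one class; the rest is the induction hypothesis.\<close>
    define \<rho>' where "\<rho>' = Transposition.transpose M b \<circ> \<rho>"
    have "\<rho>' permutes insert M Q"
      unfolding \<rho>'_def using bQ by (intro permutes_compose[OF \<rho>] permutes_swap_id) auto
    moreover have r'M: "\<rho>' M = M" by (simp add: \<rho>'_def b_def)
    ultimately have r'Q: "\<rho>' permutes Q" using permutes_superset[of \<rho>' "insert M Q" Q] by auto
    have r'a: "\<rho>' a = b" by (simp add: \<rho>'_def ra)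
    have r'o: "\<rho>' p = \<rho> p" if "p \<noteq> M" "p \<noteq> a" for p
      using that ra permutes_inj[OF \<rho>] by (simp add: \<rho>'_def b_def Transposition.transpose_def inj_eq) (metis injD)
    have fb: "f b = f M" using f[of M] by (simp add: b_def)
    have fa: "f a = f M" using f[of a] aQ by (simp add: ra)
    have f': "f (\<rho>' p) = f p" if "p \<in> Q" for p
    proof (cases "p = a")
      case False
      moreover have "p \<noteq> M" using that MQ by auto
      ultimately show ?thesis using f[of p] that r'o[of p] by simp
    qed (use r'a fa fb in simp)
    have le: "(\<Sum>p\<in>Q. int p * g (\<rho>' p)) \<le> (\<Sum>p\<in>Q. int p * g p)"
    proof (cases "\<rho>' = id")
      case False
      thus ?thesis using insert.IH[OF r'Q] f' g by fastforce
    qed auto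
    have "(int M - int a) * (g M - g b) > 0"
      using insert.hyps(2) aQ bQ g[of b M] fb by (intro mult_pos_pos) auto
    hence lt: "int M * g b + int a * g M < int M * g M + int a * g b" by (simp add: algebra_simps)
    have fin: "finite Q" using insert.hyps by simp
    have "(\<Sum>p\<in>insert M Q. int p * g (\<rho> p)) = int M * g b + int a * g M + (\<Sum>p\<in>Q - {a}. int p * g (\<rho> p))"
      using MQ fin aQ by (simp add: sum.remove[of Q a] b_def ra)
    also have "\<dots> = int M * g b + int a * g M + (\<Sum>p\<in>Q - {a}. int p * g (\<rho>' p))"
    proof -
      have "\<rho> p = \<rho>' p" if "p \<in> Q - {a}" for p using r'o[of p] that MQ by fastforce
      thus ?thesis by simp
    qed
    also have "\<dots> < int M * g M + int a * g b + (\<Sum>p\<in>Q - {a}. int p * g (\<rho>' p))" using lt by simp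
    also have "\<dots> = int M * g M + (\<Sum>p\<in>Q. int p * g (\<rho>' p))"
      using fin aQ by (simp add: sum.remove[of Q a] r'a)
    also have "\<dots> \<le> int M * g M + (\<Sum>p\<in>Q. int p * g p)" using le by simp
    also have "\<dots> = (\<Sum>p\<in>insert M Q. int p * g p)" using MQ fin by simp
    finally show ?thesis .
  qed
qed

definition decreasing_on :: "nat set \<Rightarrow> (nat \<Rightarrow> nat) \<Rightarrow> bool" where
  "decreasing_on D \<sigma> \<longleftrightarrow> (\<forall>x\<in>D. \<forall>y\<in>D. x < y \<longrightarrow> \<sigma> y < \<sigma> x)"

text \<open>Colour a position by the length of the longest decreasing subsequence ending there.\<close>
lemma decreasing_or_colouring:
  assumes inj: "inj \<sigma>"
  shows "(\<exists>Q\<subseteq>{..<N}. card Q = Suc n \<and> decreasing_on Q \<sigma>) \<or>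
    (\<exists>f :: nat \<Rightarrow> nat. (\<forall>p<N. f p < n) \<and> (\<forall>p q. p < q \<longrightarrow> q < N \<longrightarrow> f p = f q \<longrightarrow> \<sigma> p < \<sigma> q))"
proof (cases "\<exists>D\<subseteq>{..<N}. Suc n \<le> card D \<and> decreasing_on D \<sigma>")
  case True
  then obtain D where D: "D \<subseteq> {..<N}" "Suc n \<le> card D" "decreasing_on D \<sigma>" by blast
  obtain Q where "Q \<subseteq> D" "card Q = Suc n" using obtain_subset_with_card_n[OF D(2)] by blast
  moreover from this have "decreasing_on Q \<sigma>" using D(3) by (auto simp: decreasing_on_def)
  ultimately show ?thesis using D(1) by (intro disjI1 exI[of _ Q]) auto
next
  case False
  define \<D> where "\<D> = (\<lambda>p. {D. D \<subseteq> {..p} \<and> p \<in> D \<and> decreasing_on D \<sigma>})"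
  define h where "h = (\<lambda>p. Max (card ` \<D> p))"
  have fin: "finite (\<D> p)" for p
    by (rule finite_subset[of _ "Pow {..p}"]) (auto simp: \<D>_def)
  have ne: "{p} \<in> \<D> p" for p by (auto simp: \<D>_def decreasing_on_def)
  have le: "card D \<le> h p" if "D \<in> \<D> p" for D p using that fin by (auto simp: h_def)
  have ex: "\<exists>D\<in>\<D> p. card D = h p" for p
  proof -
    have "h p \<in> card ` \<D> p" unfolding h_def using fin ne[of p] by (intro Max_in) auto
    thus ?thesis by auto
  qed
  have pos: "h p \<ge> 1" for p using le[OF ne[of p]] by simp
  have bound: "h p \<le> n" if "p < N" for p
  proof -
    obtain D where D: "D \<in> \<D> p" "card D = h p" using ex by blast
    hence "D \<subseteq> {..<N}" "decreasing_on D \<sigma>" using that by (auto simp: \<D>_def)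
    thus ?thesis using False D(2) by (metis not_less_eq_eq)
  qed
  have inc: "\<sigma> p < \<sigma> q" if "p < q" "h p = h q" for p q
  proof (rule ccontr)
    assume "\<not> \<sigma> p < \<sigma> q"
    moreover have "\<sigma> p \<noteq> \<sigma> q" using inj that(1) by (auto simp: inj_eq)
    ultimately have lt: "\<sigma> q < \<sigma> p" by simp
    obtain D where D: "D \<in> \<D> p" "card D = h p" using ex by blast
    have sub: "D \<subseteq> {..p}" "p \<in> D" "decreasing_on D \<sigma>" using D by (auto simp: \<D>_def)
    have q: "q \<notin> D" using sub that(1) by auto
    have "\<sigma> q < \<sigma> x" if "x \<in> D" for x
    proof (cases "x = p")
      case False
      hence "x < p" using that sub(1) by fastforce
      thus ?thesis using sub that lt unfolding decreasing_on_def by (meson less_trans)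
    qed (use lt in auto)
    hence "insert q D \<in> \<D> q" using sub that(1) unfolding \<D>_def decreasing_on_def by fastforce
    hence "Suc (card D) \<le> h q" using le[of "insert q D" q] q finite_subset[OF sub(1)] by simp
    thus False using D(2) that(2) by simp
  qed
  have "h p - 1 < n" if "p < N" for p using bound[OF that] pos[of p] by simp
  moreover have "h p = h q" if "h p - 1 = h q - 1" for p q using that pos[of p] pos[of q] by simp
  ultimately show ?thesis using inc by (intro disjI2 exI[of _ "\<lambda>p. h p - 1"]) auto
qed

section \<open>Alternating sums and the kernel of the group algebra on tensors\<close>

lemma alternating_sum_antisym:
  fixes F :: "(nat \<Rightarrow> 'x) \<Rightarrow> 'b::comm_ring_1"
  assumes "s \<in> S" "t \<in> S" "s \<noteq> t" "i s = i t" "finite S"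
  shows "(\<Sum>\<pi> | \<pi> permutes S. of_int (sign \<pi>) * F (i \<circ> \<pi>)) = - (\<Sum>\<pi> | \<pi> permutes S. of_int (sign \<pi>) * F (i \<circ> \<pi>))"
proof -
  let ?t = "Transposition.transpose s t"
  have t: "?t permutes S" using assms by (intro permutes_swap_id) auto
  have it: "i \<circ> ?t = i" using assms(4) by (auto simp: fun_eq_iff Transposition.transpose_def)
  have "(\<Sum>\<pi> | \<pi> permutes S. of_int (sign \<pi>) * F (i \<circ> \<pi>))
    = (\<Sum>\<pi> | \<pi> permutes S. of_int (sign (?t \<circ> \<pi>)) * F (i \<circ> (?t \<circ> \<pi>)))"
    by (rule setum_permutations_compose_left[OF t])
  also have "\<dots> = (\<Sum>\<pi> | \<pi> permutes S. - (of_int (sign \<pi>) * F (i \<circ> \<pi>)))"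
  proof (rule sum.cong[OF refl])
    fix \<pi> assume "\<pi> \<in> {\<pi>. \<pi> permutes S}"
    hence "permutation \<pi>" using assms(5) by (auto simp: permutation_permutes)
    moreover have "permutation ?t" by (rule permutation_swap_id)
    ultimately have "sign (?t \<circ> \<pi>) = - sign \<pi>" using assms(3) by (simp add: sign_compose sign_swap_id)
    moreover have "i \<circ> (?t \<circ> \<pi>) = i \<circ> \<pi>" using it by (simp flip: comp_assoc)
    ultimately show "of_int (sign (?t \<circ> \<pi>)) * F (i \<circ> (?t \<circ> \<pi>)) = - (of_int (sign \<pi>) * F (i \<circ> \<pi>))" by simp
  qed
  finally show ?thesis by (simp add: sum_negf)
qed

lemma pigeonhole_tuple:
  fixes i :: "nat \<Rightarrow> 'n::finite"
  assumes "card S = Suc CARD('n)"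
  obtains s t where "s \<in> S" "t \<in> S" "s \<noteq> t" "i s = i t"
proof -
  have "card (i ` S) \<le> CARD('n)" by (intro card_mono) auto
  hence "\<not> inj_on i S" using assms by (auto dest: card_image)
  thus ?thesis using that by (auto simp: inj_on_def)
qed

definition alt_coeff :: "nat set \<Rightarrow> (nat \<Rightarrow> nat) \<Rightarrow> (nat \<Rightarrow> nat) \<Rightarrow> 'a::comm_ring_1" where
  "alt_coeff S \<tau> \<sigma> = (\<Sum>\<pi> | \<pi> permutes S. of_int (sign \<pi>) * (if \<sigma> = \<pi> \<circ> \<tau> then 1 else 0))"

lemma sum_alt_coeff:
  fixes \<psi> :: "(nat \<Rightarrow> nat) \<Rightarrow> 'b::comm_ring_1"
  assumes "S \<subseteq> {..<N}" "\<tau> permutes {..<N}"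
  shows "(\<Sum>\<sigma>\<in>perms N. alt_coeff S \<tau> \<sigma> * \<psi> \<sigma>) = (\<Sum>\<pi> | \<pi> permutes S. of_int (sign \<pi>) * \<psi> (\<pi> \<circ> \<tau>))"
proof -
  have "(\<Sum>\<sigma>\<in>perms N. alt_coeff S \<tau> \<sigma> * \<psi> \<sigma>)
    = (\<Sum>\<pi> | \<pi> permutes S. \<Sum>\<sigma>\<in>perms N. if \<sigma> = \<pi> \<circ> \<tau> then of_int (sign \<pi>) * \<psi> (\<pi> \<circ> \<tau>) else 0)"
    unfolding alt_coeff_def sum_distrib_right by (subst sum.swap) (intro sum.cong refl, simp)
  also have "\<dots> = (\<Sum>\<pi> | \<pi> permutes S. of_int (sign \<pi>) * \<psi> (\<pi> \<circ> \<tau>))"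
  proof (rule sum.cong[OF refl])
    fix \<pi> assume "\<pi> \<in> {\<pi>. \<pi> permutes S}"
    hence "\<pi> permutes {..<N}" using permutes_subset[OF _ assms(1)] by auto
    hence "\<pi> \<circ> \<tau> permutes {..<N}" by (intro permutes_compose assms(2))
    thus "(\<Sum>\<sigma>\<in>perms N. if \<sigma> = \<pi> \<circ> \<tau> then of_int (sign \<pi>) * \<psi> (\<pi> \<circ> \<tau>) else 0) = of_int (sign \<pi>) * \<psi> (\<pi> \<circ> \<tau>)"
      by simp
  qed
  finally show ?thesis .
qed

text \<open>The combinations of permutations of N places that act as zero on the N-th tensor power
  of the n-dimensional space, written in matrix entries.\<close>

definition in_perm_kernel :: "'n::finite itself \<Rightarrow> nat \<Rightarrow> ((nat \<Rightarrow> nat) \<Rightarrow> 'a::field_char_0) \<Rightarrow> bool" where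
  "in_perm_kernel _ N c \<longleftrightarrow> (\<forall>i\<in>tuples N. \<forall>j\<in>tuples N :: (nat \<Rightarrow> 'n) set.
     (\<Sum>\<sigma>\<in>perms N. c \<sigma> * (if j = i \<circ> \<sigma> then 1 else 0)) = 0)"

text \<open>Among n + 1 positions two carry the same of n indices; exchanging them reverses the sign
  and leaves everything else unchanged.\<close>

lemma alt_coeff_in_kernel:
  assumes "S \<subseteq> {..<N}" "card S = Suc CARD('n::finite)" "\<tau> permutes {..<N}"
  shows "in_perm_kernel TYPE('n) N (alt_coeff S \<tau> :: _ \<Rightarrow> 'a::field_char_0)"
  unfolding in_perm_kernel_def
proof (intro ballI)
  fix i j :: "nat \<Rightarrow> 'n"
  obtain s t where st: "s \<in> S" "t \<in> S" "s \<noteq> t" "i s = i t" using pigeonhole_tuple[OF assms(2)] by blast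
  have fin: "finite S" using finite_subset[OF assms(1)] by simp
  define F where "F = (\<lambda>g. if j = g \<circ> \<tau> then 1 else (0::'a))"
  have "(\<Sum>\<sigma>\<in>perms N. alt_coeff S \<tau> \<sigma> * (if j = i \<circ> \<sigma> then 1 else (0::'a))) = (\<Sum>\<pi> | \<pi> permutes S. of_int (sign \<pi>) * F (i \<circ> \<pi>))"
    unfolding sum_alt_coeff[OF assms(1,3)] F_def by (simp add: comp_assoc)
  moreover have "\<dots> = - \<dots>" by (rule alternating_sum_antisym[OF st fin])
  ultimately show "(\<Sum>\<sigma>\<in>perms N. alt_coeff S \<tau> \<sigma> * (if j = i \<circ> \<sigma> then 1 else (0::'a))) = 0" by simp
qed

text \<open>The measure that makes both parts of the straightening triangular. A permutation is the
  strict minimum of its alternating sum over a decreasing set (\<open>perm_stat_alt\<close>), and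
  the strict maximum among the permutations that respect a colouring with increasing classes
  (\<open>kernel_coeff_zero\<close>).\<close>

definition perm_stat :: "nat \<Rightarrow> (nat \<Rightarrow> nat) \<Rightarrow> int" where
  "perm_stat N \<sigma> = (\<Sum>p<N. int p * int (\<sigma> p))"

lemma perm_stat_alt:
  assumes \<sigma>: "\<sigma> permutes {..<N}" and Q: "Q \<subseteq> {..<N}" "decreasing_on Q \<sigma>"
    and \<pi>: "\<pi> permutes \<sigma> ` Q" "\<pi> \<noteq> id"
  shows "perm_stat N \<sigma> < perm_stat N (\<pi> \<circ> \<sigma>)"
proof -
  define \<rho> where "\<rho> = inv \<sigma> \<circ> \<pi> \<circ> \<sigma>"
  \<comment> \<open>Q becomes a single class and every other position a class of its own;
    \<open>Suc\<close> keeps position 0 apart from the class of Q.\<close>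
  define f where "f = (\<lambda>p. if p \<in> Q then 0 else Suc p)"
  have s: "\<sigma> (\<rho> p) = \<pi> (\<sigma> p)" for p using permutes_inverses[OF \<sigma>] by (simp add: \<rho>_def)
  have "\<sigma> ` Q \<subseteq> {..<N}" using Q(1) permutes_image[OF \<sigma>] by blast
  hence "\<pi> permutes {..<N}" using \<pi>(1) permutes_subset by blast
  hence r: "\<rho> permutes {..<N}" unfolding \<rho>_def
    by (intro permutes_compose \<sigma> permutes_inv)
  have ne: "\<rho> \<noteq> id"
  proof
    assume "\<rho> = id"
    hence "\<pi> \<circ> \<sigma> = id \<circ> \<sigma>" using s by (auto simp: fun_eq_iff)
    thus False using comp_perm_cancel[OF \<sigma>] \<pi>(2) by blast
  qed
  have ff: "f (\<rho> p) = f p" for p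
  proof (cases "p \<in> Q")
    case True
    hence "\<pi> (\<sigma> p) \<in> \<sigma> ` Q" using permutes_in_image[OF \<pi>(1)] by auto
    hence "\<rho> p \<in> Q" using s permutes_inj[OF \<sigma>] by (metis imageE injD)
    thus ?thesis using True by (simp add: f_def)
  next
    case False
    hence "\<sigma> p \<notin> \<sigma> ` Q" using permutes_inj[OF \<sigma>] by (auto simp: inj_eq)
    hence "\<pi> (\<sigma> p) = \<sigma> p" using \<pi>(1) by (auto simp: permutes_def)
    hence "\<rho> p = p" using s permutes_inj[OF \<sigma>] by (metis injD)
    thus ?thesis by simp
  qed
  have "(\<Sum>p<N. int p * - int (\<sigma> (\<rho> p))) < (\<Sum>p<N. int p * - int (\<sigma> p))"
  proof (rule rearrangement_strict[OF _ r, where f = f and g = "\<lambda>p. - int (\<sigma> p)"])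
    fix p q assume "p < q" "f p = f q"
    hence "p \<in> Q" "q \<in> Q" by (auto simp: f_def split: if_splits)
    thus "- int (\<sigma> p) < - int (\<sigma> q)" using Q(2) \<open>p < q\<close> by (auto simp: decreasing_on_def)
  qed (use ff ne in auto)
  thus ?thesis by (simp add: perm_stat_def s sum_negf)
qed

text \<open>Colours read as indices give tuples with \<open>j = i \<circ> \<sigma>\<close>. Any
  other \<tau> with \<open>j = i \<circ> \<tau>\<close> differs from \<sigma> by moving positions
  inside colour classes, on which \<sigma> increases. It thus has a smaller statistic and
  contributes nothing, so this one entry isolates \<open>c \<sigma>\<close>.\<close>

lemma kernel_coeff_zero:
  fixes c :: "(nat \<Rightarrow> nat) \<Rightarrow> 'a::field_char_0"
  assumes ker: "in_perm_kernel TYPE('n::finite) N c" and \<sigma>: "\<sigma> permutes {..<N}"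
    and low: "\<And>\<tau>. \<tau> permutes {..<N} \<Longrightarrow> perm_stat N \<tau> < perm_stat N \<sigma> \<Longrightarrow> c \<tau> = 0"
    and f: "\<And>p. p < N \<Longrightarrow> f p < CARD('n)" "\<And>p q. p < q \<Longrightarrow> q < N \<Longrightarrow> f p = f q \<Longrightarrow> \<sigma> p < \<sigma> q"
  shows "c \<sigma> = 0"
proof -
  obtain e :: "nat \<Rightarrow> 'n" where e: "bij_betw e {..<CARD('n)} UNIV"
    using ex_bij_betw_nat_finite[of "UNIV :: 'n set"] by (auto simp: atLeast0LessThan)
  define F where "F = (\<lambda>p. e (f p))"
  have Fi: "f p = f q" if "F p = F q" "p < N" "q < N" for p q
    using that e f(1) unfolding F_def by (meson bij_betw_imp_inj_on inj_onD lessThan_iff)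
  define i where "i = restrict (F \<circ> inv \<sigma>) {..<N}"
  define j where "j = restrict F {..<N}"
  have "(\<Sum>\<tau>\<in>perms N. c \<tau> * (if j = i \<circ> \<tau> then 1 else 0)) = 0"
    using ker unfolding in_perm_kernel_def i_def j_def by auto
  moreover have "c \<tau> * (if j = i \<circ> \<tau> then 1 else 0) = (if \<tau> = \<sigma> then c \<sigma> else 0)" if "\<tau> \<in> perms N" for \<tau>
  proof (cases "\<tau> = \<sigma>")
    case True
    have "j = i \<circ> \<sigma>"
    proof
      fix p show "j p = (i \<circ> \<sigma>) p"
        using permutes_in_image[OF \<sigma>, of p] permutes_inverses[OF \<sigma>] by (auto simp: i_def j_def)
    qed
    thus ?thesis using True by simp
  next
    case False
    have t: "\<tau> permutes {..<N}" using that by simp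
    define \<rho> where "\<rho> = inv \<sigma> \<circ> \<tau>"
    have r: "\<rho> permutes {..<N}" unfolding \<rho>_def by (intro permutes_compose t permutes_inv \<sigma>)
    have sr: "\<sigma> (\<rho> p) = \<tau> p" for p using permutes_inverses[OF \<sigma>] by (simp add: \<rho>_def)
    have "\<rho> \<noteq> id" using sr False by (metis eq_id_iff ext)
    have "c \<tau> = 0" if ji: "j = i \<circ> \<tau>"
    proof (rule low[OF t])
      have "F (\<rho> p) = F p" if "p \<in> {..<N}" for p
        using fun_cong[OF ji, of p] that permutes_in_image[OF t, of p] by (simp add: i_def j_def \<rho>_def)
      hence fr: "f (\<rho> p) = f p" if "p \<in> {..<N}" for p
        using that permutes_in_image[OF r, of p] by (intro Fi) auto
      have "(\<Sum>p<N. int p * int (\<sigma> (\<rho> p))) < (\<Sum>p<N. int p * int (\<sigma> p))"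
        by (rule rearrangement_strict[OF _ r, where f = f and g = "\<lambda>p. int (\<sigma> p)"])
          (use fr f(2) \<open>\<rho> \<noteq> id\<close> in auto)
      thus "perm_stat N \<tau> < perm_stat N \<sigma>" by (simp add: perm_stat_def sr)
    qed
    thus ?thesis using False by auto
  qed
  ultimately have "(\<Sum>\<tau>\<in>perms N. if \<tau> = \<sigma> then c \<sigma> else 0) = 0" by simp
  thus ?thesis using \<sigma> by simp
qed

definition alt_sets :: "nat \<Rightarrow> nat \<Rightarrow> nat set set" where
  "alt_sets n N = {S. S \<subseteq> {..<N} \<and> card S = Suc n}"

lemma finite_alt_sets [simp]: "finite (alt_sets n N)"
  by (rule finite_subset[of _ "Pow {..<N}"]) (auto simp: alt_sets_def)

definition alt_combination :: "nat \<Rightarrow> nat \<Rightarrow> (nat set \<Rightarrow> (nat \<Rightarrow> nat) \<Rightarrow> 'a) \<Rightarrow> (nat \<Rightarrow> nat) \<Rightarrow> 'a::comm_ring_1" where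
  "alt_combination n N e \<sigma> = (\<Sum>S\<in>alt_sets n N. \<Sum>\<tau>\<in>perms N. e S \<tau> * alt_coeff S \<tau> \<sigma>)"

lemma alt_combination_in_kernel:
  "in_perm_kernel TYPE('n::finite) N (alt_combination CARD('n) N e :: _ \<Rightarrow> 'a::field_char_0)"
  unfolding in_perm_kernel_def
proof (intro ballI)
  fix i j :: "nat \<Rightarrow> 'n" assume ij: "i \<in> tuples N" "j \<in> tuples N"
  have "(\<Sum>\<sigma>\<in>perms N. alt_combination CARD('n) N e \<sigma> * (if j = i \<circ> \<sigma> then 1 else 0))
    = (\<Sum>S\<in>alt_sets CARD('n) N. \<Sum>\<tau>\<in>perms N. e S \<tau> * (\<Sum>\<sigma>\<in>perms N. alt_coeff S \<tau> \<sigma> * (if j = i \<circ> \<sigma> then 1 else 0)))"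
    unfolding alt_combination_def sum_distrib_right sum_distrib_left mult.assoc by (subst sum_swap3[symmetric]) simp
  also have "\<dots> = 0"
  proof (intro sum.neutral ballI)
    fix S \<tau> assume "S \<in> alt_sets CARD('n) N" "\<tau> \<in> perms N"
    hence "in_perm_kernel TYPE('n) N (alt_coeff S \<tau> :: _ \<Rightarrow> 'a)"
      by (intro alt_coeff_in_kernel) (auto simp: alt_sets_def)
    thus "e S \<tau> * (\<Sum>\<sigma>\<in>perms N. alt_coeff S \<tau> \<sigma> * (if j = i \<circ> \<sigma> then 1 else 0)) = 0"
      using ij by (simp add: in_perm_kernel_def)
  qed
  finally show "(\<Sum>\<sigma>\<in>perms N. alt_combination CARD('n) N e \<sigma> * (if j = i \<circ> \<sigma> then 1 else 0)) = 0" .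
qed

text \<open>The coefficients are cleared from the lowest statistic upwards. At the lowest level m a
  permutation with nonzero coefficient admits no colouring, so it has n + 1 decreasing positions;
  subtracting its alternating sum removes it and otherwise touches only higher levels.\<close>

theorem perm_kernel:
  fixes c :: "(nat \<Rightarrow> nat) \<Rightarrow> 'a::field_char_0"
  assumes "in_perm_kernel TYPE('n::finite) N c"
  shows "\<exists>e. \<forall>\<sigma>\<in>perms N. c \<sigma> = alt_combination CARD('n) N e \<sigma>"
proof -
  define B where "B = Max (insert 0 (perm_stat N ` perms N))"
  have B: "perm_stat N \<sigma> \<le> B" if "\<sigma> permutes {..<N}" for \<sigma>
    using that unfolding B_def by (intro Max_ge) auto
  have main: "\<exists>e. \<forall>\<sigma>\<in>perms N. c \<sigma> = alt_combination CARD('n) N e \<sigma>"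
    if "in_perm_kernel TYPE('n) N c" "\<And>\<sigma>. \<sigma> permutes {..<N} \<Longrightarrow> perm_stat N \<sigma> < m \<Longrightarrow> c \<sigma> = 0" for m and c :: "(nat \<Rightarrow> nat) \<Rightarrow> 'a"
    using that
  proof (induction "nat (B + 1 - m)" arbitrary: m c rule: less_induct)
    case less
    note ker = less.prems(1) and low = less.prems(2)
    show ?case
    proof (cases "m > B")
      case True
      hence "c \<sigma> = 0" if "\<sigma> \<in> perms N" for \<sigma> using low[of \<sigma>] B[of \<sigma>] that by auto
      thus ?thesis by (intro exI[of _ "\<lambda>_ _. 0"]) (auto simp: alt_combination_def)
    next
      case False
      have bad: "\<exists>Q\<subseteq>{..<N}. card Q = Suc CARD('n) \<and> decreasing_on Q \<sigma>"
        if sig: "\<sigma> permutes {..<N}" "perm_stat N \<sigma> = m" "c \<sigma> \<noteq> 0" for \<sigma>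
      proof (rule ccontr)
        assume "\<not> ?thesis"
        then obtain f :: "nat \<Rightarrow> nat" where f: "\<And>p. p < N \<Longrightarrow> f p < CARD('n)"
          "\<And>p q. p < q \<Longrightarrow> q < N \<Longrightarrow> f p = f q \<Longrightarrow> \<sigma> p < \<sigma> q"
          using decreasing_or_colouring[OF permutes_inj[OF sig(1)], of N "CARD('n)"] by blast
        have "c \<sigma> = 0"
          by (rule kernel_coeff_zero[OF ker sig(1) _ f]) (use low sig(2) in auto)
        thus False using sig(3) by simp
      qed
      define Qs where "Qs = (\<lambda>\<sigma>. SOME Q. Q \<subseteq> {..<N} \<and> card Q = Suc CARD('n) \<and> decreasing_on Q \<sigma>)"
      define T where "T = {\<sigma>. \<sigma> permutes {..<N} \<and> perm_stat N \<sigma> = m \<and> c \<sigma> \<noteq> 0}"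
      have Qs: "Qs \<sigma> \<subseteq> {..<N}" "card (Qs \<sigma>) = Suc CARD('n)" "decreasing_on (Qs \<sigma>) \<sigma>" if "\<sigma> \<in> T" for \<sigma>
      proof -
        have "\<exists>Q. Q \<subseteq> {..<N} \<and> card Q = Suc CARD('n) \<and> decreasing_on Q \<sigma>" using bad[of \<sigma>] that unfolding T_def by blast
        from someI_ex[OF this] show "Qs \<sigma> \<subseteq> {..<N}" "card (Qs \<sigma>) = Suc CARD('n)" "decreasing_on (Qs \<sigma>) \<sigma>"
          unfolding Qs_def by blast+
      qed
      \<comment> \<open>The alternating set consists of values, not of positions, since
        \<open>alt_coeff\<close> composes on the left; hence the image of the decreasing
        positions.\<close>
      define e0 where "e0 = (\<lambda>S \<tau>. if \<tau> \<in> T \<and> S = \<tau> ` Qs \<tau> then c \<tau> else 0)"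
      have SA: "\<tau> ` Qs \<tau> \<in> alt_sets CARD('n) N" if "\<tau> \<in> T" for \<tau>
      proof -
        have t: "\<tau> permutes {..<N}" using that by (simp add: T_def)
        have "\<tau> ` Qs \<tau> \<subseteq> {..<N}" using Qs(1)[OF that] permutes_image[OF t] by blast
        moreover have "card (\<tau> ` Qs \<tau>) = Suc CARD('n)"
          using Qs(2)[OF that] card_image[OF inj_on_subset[OF permutes_inj[OF t]], of "Qs \<tau>"] by simp
        ultimately show ?thesis by (simp add: alt_sets_def)
      qed
      have finT: "finite T" by (rule finite_subset[OF _ finite_perms[of N]]) (auto simp: T_def)
      have comb: "alt_combination CARD('n) N e0 \<sigma> = (\<Sum>\<tau>\<in>T. c \<tau> * alt_coeff (\<tau> ` Qs \<tau>) \<tau> \<sigma>)" for \<sigma>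
      proof -
        have "alt_combination CARD('n) N e0 \<sigma> = (\<Sum>\<tau>\<in>perms N. \<Sum>S\<in>alt_sets CARD('n) N. e0 S \<tau> * alt_coeff S \<tau> \<sigma>)"
          unfolding alt_combination_def by (rule sum.swap)
        also have "\<dots> = (\<Sum>\<tau>\<in>T. \<Sum>S\<in>alt_sets CARD('n) N. e0 S \<tau> * alt_coeff S \<tau> \<sigma>)"
        proof (rule sum.mono_neutral_right)
          show "T \<subseteq> perms N" by (auto simp: T_def)
        qed (simp_all add: e0_def)
        also have "\<dots> = (\<Sum>\<tau>\<in>T. \<Sum>S\<in>alt_sets CARD('n) N. if S = \<tau> ` Qs \<tau> then c \<tau> * alt_coeff (\<tau> ` Qs \<tau>) \<tau> \<sigma> else 0)"
          by (intro sum.cong refl) (auto simp: e0_def)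
        also have "\<dots> = (\<Sum>\<tau>\<in>T. c \<tau> * alt_coeff (\<tau> ` Qs \<tau>) \<tau> \<sigma>)"
          by (rule sum.cong[OF refl]) (simp add: SA)
        finally show ?thesis .
      qed
      have ac: "alt_coeff (\<tau> ` Qs \<tau>) \<tau> \<sigma> = (if \<sigma> = \<tau> then 1 else (0::'a))"
        if "\<tau> \<in> T" "perm_stat N \<sigma> \<le> m" for \<tau> \<sigma>
      proof -
        have t: "\<tau> permutes {..<N}" "perm_stat N \<tau> = m" using that(1) by (auto simp: T_def)
        have fin: "finite (\<tau> ` Qs \<tau>)" using Qs(1)[OF that(1)] finite_subset by blast
        have "alt_coeff (\<tau> ` Qs \<tau>) \<tau> \<sigma> = (\<Sum>\<pi> | \<pi> permutes \<tau> ` Qs \<tau>. if \<pi> = id then (if \<sigma> = \<tau> then 1 else (0::'a)) else 0)"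
          unfolding alt_coeff_def
        proof (rule sum.cong[OF refl])
          fix \<pi> assume "\<pi> \<in> {\<pi>. \<pi> permutes \<tau> ` Qs \<tau>}"
          hence "\<sigma> \<noteq> \<pi> \<circ> \<tau>" if "\<pi> \<noteq> id"
            using perm_stat_alt[OF t(1) Qs(1,3)[OF \<open>\<tau> \<in> T\<close>], of \<pi>] that \<open>perm_stat N \<sigma> \<le> m\<close> t(2) by auto
          thus "of_int (sign \<pi>) * (if \<sigma> = \<pi> \<circ> \<tau> then 1 else 0) = (if \<pi> = id then (if \<sigma> = \<tau> then 1 else (0::'a)) else 0)"
            by (auto simp: sign_id)
        qed
        also have "\<dots> = (if \<sigma> = \<tau> then 1 else 0)"
          using finite_permutations[OF fin] by (simp add: permutes_id)
        finally show ?thesis .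
      qed
      define c' where "c' = (\<lambda>\<sigma>. c \<sigma> - alt_combination CARD('n) N e0 \<sigma>)"
      have "in_perm_kernel TYPE('n) N c'"
        using ker alt_combination_in_kernel[where 'n = 'n, of N e0]
        unfolding in_perm_kernel_def c'_def by (simp add: left_diff_distrib sum_subtractf)
      moreover have "c' \<sigma> = 0" if "\<sigma> permutes {..<N}" "perm_stat N \<sigma> < m + 1" for \<sigma>
      proof -
        have "alt_combination CARD('n) N e0 \<sigma> = (\<Sum>\<tau>\<in>T. if \<tau> = \<sigma> then c \<sigma> else 0)"
          unfolding comb
        proof (rule sum.cong[OF refl])
          fix \<tau> assume "\<tau> \<in> T"
          thus "c \<tau> * alt_coeff (\<tau> ` Qs \<tau>) \<tau> \<sigma> = (if \<tau> = \<sigma> then c \<sigma> else 0)"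
            using ac[of \<tau> \<sigma>] that(2) by auto
        qed
        also have "\<dots> = c \<sigma>" using finT low[of \<sigma>] that by (auto simp: T_def)
        finally show ?thesis by (simp add: c'_def)
      qed
      ultimately obtain e1 where e1: "\<And>\<sigma>. \<sigma> \<in> perms N \<Longrightarrow> c' \<sigma> = alt_combination CARD('n) N e1 \<sigma>"
        using less.hyps[of "m + 1" c'] False by auto
      have "c \<sigma> = alt_combination CARD('n) N (\<lambda>S \<tau>. e0 S \<tau> + e1 S \<tau>) \<sigma>" if "\<sigma> \<in> perms N" for \<sigma>
        using e1[OF that] by (simp add: c'_def alt_combination_def distrib_right sum.distrib diff_eq_eq add.commute)
      thus ?thesis by blast
    qed
  qed
  have "perm_stat N \<sigma> \<ge> 0" for \<sigma> by (simp add: perm_stat_def sum_nonneg)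
  hence "\<not> perm_stat N \<sigma> < 0" for \<sigma> by (simp add: not_less)
  thus ?thesis by (intro main[of c 0] assms) blast
qed

section \<open>Traces along the cycles of a permutation\<close>

text \<open>Cycles are lists because words are read along them. Appending the head closes the cycle,
  so a one-element list is a cycle exactly when its point is fixed.\<close>

definition is_cyc :: "(nat \<Rightarrow> nat) \<Rightarrow> nat list \<Rightarrow> bool" where
  "is_cyc \<sigma> l \<longleftrightarrow> l \<noteq> [] \<and> distinct l \<and> successively (\<lambda>a b. \<sigma> a = b) (l @ [hd l])"

lemma is_cyc_funpow:
  assumes "is_cyc \<sigma> l"
  shows "(\<sigma> ^^ j) (hd l) = l ! (j mod length l)"
proof (induction j)
  case 0
  show ?case using assms by (simp add: is_cyc_def hd_conv_nth)
next
  case (Suc j)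
  have l: "0 < length l" using assms by (simp add: is_cyc_def)
  define m where "m = j mod length l"
  have m: "m < length l" using l by (simp add: m_def)
  have "\<sigma> ((l @ [hd l]) ! m) = (l @ [hd l]) ! Suc m"
    using successively_nth[of "\<lambda>a b. \<sigma> a = b" "l @ [hd l]" m] assms m by (simp add: is_cyc_def)
  hence s: "\<sigma> (l ! m) = (l @ [hd l]) ! Suc m" using m by (simp add: nth_append)
  have "(l @ [hd l]) ! Suc m = l ! (Suc j mod length l)"
  proof (cases "Suc m = length l")
    case True
    hence "Suc j mod length l = 0" by (simp add: m_def mod_Suc)
    thus ?thesis using True l by (simp add: nth_append hd_conv_nth)
  next
    case False
    hence "Suc j mod length l = Suc m" by (simp add: m_def mod_Suc)
    thus ?thesis using False m by (simp add: nth_append)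
  qed
  thus ?case using Suc.IH s by (simp add: m_def)
qed

lemma is_cyc_orb:
  assumes "is_cyc \<sigma> l"
  shows "orb \<sigma> (hd l) = set l"
proof -
  have l: "0 < length l" using assms by (simp add: is_cyc_def)
  have "l ! j \<in> range (\<lambda>j. l ! (j mod length l))" if "j < length l" for j
    using that by (intro image_eqI[of _ _ j]) auto
  thus ?thesis using l unfolding orb_def is_cyc_funpow[OF assms] set_conv_nth by auto
qed

lemma is_cyc_cycword:
  assumes "is_cyc \<sigma> l"
  shows "cycword \<sigma> (hd l) = l"
proof -
  have "card (set l) = length l" using assms by (simp add: is_cyc_def distinct_card)
  thus ?thesis
    unfolding cycword_def is_cyc_orb[OF assms] is_cyc_funpow[OF assms]
    by (intro nth_equalityI) auto
qed

lemma is_cyc_closed: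
  assumes "is_cyc \<sigma> l" "x \<in> set l"
  shows "\<sigma> x \<in> set l"
proof -
  obtain j where "x = (\<sigma> ^^ j) (hd l)" using assms(2) is_cyc_orb[OF assms(1)] by (auto simp: orb_def)
  hence "\<sigma> x = (\<sigma> ^^ Suc j) (hd l)" by simp
  thus ?thesis using is_cyc_orb[OF assms(1)] unfolding orb_def by blast
qed

text \<open>The orbit of d stays in a finite set, so two iterates agree, and injectivity shifts the
  repetition back to d. The cycle lists the iterates before the first return.\<close>

lemma ex_is_cyc:
  assumes "permutation \<sigma>"
  shows "\<exists>l. is_cyc \<sigma> l \<and> hd l = d"
proof -
  have inj: "inj (\<sigma> ^^ i)" for i
    using permutation_bijective[OF assms] by (intro inj_fn bij_is_inj)
  obtain A where A: "\<sigma> permutes A" "finite A" using assms by (auto simp: permutation_permutes)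
  have "(\<sigma> ^^ j) d \<in> insert d A" for j
    by (induction j) (use permutes_in_image[OF A(1)] A(1) in \<open>auto simp: permutes_def\<close>)
  hence "\<not> inj (\<lambda>j. (\<sigma> ^^ j) d)"
    using A(2) finite_imageD[of "\<lambda>j. (\<sigma> ^^ j) d" UNIV] by (metis finite_insert finite_subset image_subsetI infinite_UNIV_nat)
  then obtain i j where ij: "i < j" "(\<sigma> ^^ i) d = (\<sigma> ^^ j) d"
    unfolding inj_def by (metis linorder_neqE_nat)
  have "(\<sigma> ^^ i) d = (\<sigma> ^^ i) ((\<sigma> ^^ (j - i)) d)"
    using ij funpow_add[of i "j - i" \<sigma>] by simp
  hence N: "(\<sigma> ^^ (j - i)) d = d" "j - i > 0" using inj ij(1) by (metis injD, simp)
  define n where "n = (LEAST n. n > 0 \<and> (\<sigma> ^^ n) d = d)"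
  have n: "n > 0" "(\<sigma> ^^ n) d = d"
    using LeastI[of "\<lambda>n. n > 0 \<and> (\<sigma> ^^ n) d = d" "j - i"] N unfolding n_def by auto
  have least: "(\<sigma> ^^ m) d \<noteq> d" if "0 < m" "m < n" for m
    using that not_less_Least[of m "\<lambda>n. n > 0 \<and> (\<sigma> ^^ n) d = d"] unfolding n_def by auto
  have aux: "\<not> (\<sigma> ^^ i) d = (\<sigma> ^^ j) d" if "i < j" "j < n" for i j
  proof
    assume "(\<sigma> ^^ i) d = (\<sigma> ^^ j) d"
    also have "\<dots> = (\<sigma> ^^ i) ((\<sigma> ^^ (j - i)) d)" using that funpow_add[of i "j - i" \<sigma>] by simp
    finally have "(\<sigma> ^^ (j - i)) d = d" using inj by (metis injD)
    thus False using least[of "j - i"] that by simp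
  qed
  define l where "l = map (\<lambda>j. (\<sigma> ^^ j) d) [0..<n]"
  have len: "length l = n" by (simp add: l_def)
  have hd: "hd l = d" using n by (simp add: l_def hd_map)
  have "distinct l"
    unfolding l_def distinct_map
  proof (intro conjI distinct_upt inj_onI)
    fix i j assume "i \<in> set [0..<n]" "j \<in> set [0..<n]" "(\<sigma> ^^ i) d = (\<sigma> ^^ j) d"
    thus "i = j" using aux[of i j] aux[of j i] by (cases i j rule: linorder_cases) auto
  qed
  moreover have "successively (\<lambda>a b. \<sigma> a = b) (l @ [d])"
    unfolding successively_conv_nth
  proof (intro allI impI)
    fix i assume i: "Suc i < length (l @ [d])"
    hence "(l @ [d]) ! Suc i = (\<sigma> ^^ Suc i) d"
    proof (cases "Suc i = n")
      case True
      thus ?thesis using n len by (simp add: nth_append del: funpow.simps)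
    next
      case False
      thus ?thesis using i len by (simp add: nth_append l_def del: funpow.simps)
    qed
    moreover have "(l @ [d]) ! i = (\<sigma> ^^ i) d" using i by (simp add: nth_append l_def)
    ultimately show "\<sigma> ((l @ [d]) ! i) = (l @ [d]) ! Suc i" by simp
  qed
  ultimately have "is_cyc \<sigma> l" using n len by (auto simp: is_cyc_def hd)
  thus ?thesis using hd by blast
qed

lemma permutes_imp_permutation: "finite A \<Longrightarrow> \<sigma> permutes A \<Longrightarrow> permutation \<sigma>"
  by (auto simp: permutation_permutes)

lemma is_cyc_cycword':
  assumes "permutation \<sigma>"
  shows "is_cyc \<sigma> (cycword \<sigma> d)" "hd (cycword \<sigma> d) = d" "set (cycword \<sigma> d) = orb \<sigma> d"
proof -
  obtain l where l: "is_cyc \<sigma> l" "hd l = d" using ex_is_cyc[OF assms] by blast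
  have "cycword \<sigma> d = l" "orb \<sigma> d = set l" using is_cyc_cycword[OF l(1)] is_cyc_orb[OF l(1)] l(2) by auto
  thus "is_cyc \<sigma> (cycword \<sigma> d)" "hd (cycword \<sigma> d) = d" "set (cycword \<sigma> d) = orb \<sigma> d" using l by auto
qed

lemma is_cyc_conj:
  assumes "is_cyc \<sigma> l" "bij E"
  shows "is_cyc (E \<circ> \<sigma> \<circ> inv E) (map E l)"
proof -
  have l: "l \<noteq> []" "distinct l" "successively (\<lambda>a b. \<sigma> a = b) (l @ [hd l])" using assms by (auto simp: is_cyc_def)
  have E: "inv E (E x) = x" for x using assms(2) by (simp add: bij_is_inj)
  have m: "map E l @ [hd (map E l)] = map E (l @ [hd l])" using l(1) by (simp add: hd_map)
  have "successively (\<lambda>a b. (E \<circ> \<sigma> \<circ> inv E) a = b) (map E (l @ [hd l]))"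
    unfolding successively_map using successively_mono[OF l(3)] E by fastforce
  moreover have "inj_on E (set l)" using assms(2) by (meson bij_is_inj inj_on_subset subset_UNIV)
  ultimately show ?thesis using l unfolding is_cyc_def m by (simp add: distinct_map)
qed

text \<open>Remove the point \<open>p\<close> from its cycle.\<close>
definition bypass :: "nat \<Rightarrow> (nat \<Rightarrow> nat) \<Rightarrow> nat \<Rightarrow> nat" where
  "bypass p \<sigma> = Transposition.transpose p (\<sigma> p) \<circ> \<sigma>"

lemma bypass_self [simp]: "bypass p \<sigma> p = p"
  by (simp add: bypass_def)

lemma bypass_pred: "\<sigma> q = p \<Longrightarrow> bypass p \<sigma> q = \<sigma> p"
  by (simp add: bypass_def)

lemma bypass_other: "inj \<sigma> \<Longrightarrow> x \<noteq> p \<Longrightarrow> \<sigma> x \<noteq> p \<Longrightarrow> bypass p \<sigma> x = \<sigma> x"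
  by (auto simp: bypass_def Transposition.transpose_def dest: injD)

lemma bypass_permutes:
  assumes "\<sigma> permutes A" "p \<in> A"
  shows "bypass p \<sigma> permutes (A - {p})"
proof -
  have "bypass p \<sigma> permutes A"
    unfolding bypass_def using permutes_in_image[OF assms(1)] assms(2)
    by (intro permutes_compose[OF assms(1)] permutes_swap_id) auto
  thus ?thesis by (rule permutes_superset) auto
qed

text \<open>Removing p commutes with a left factor that fixes p. This permits an alternating sum to
  be reduced in all its terms at once.\<close>

lemma bypass_comp:
  assumes "inj \<pi>" "\<pi> p = p"
  shows "bypass p (\<pi> \<circ> \<tau>) = \<pi> \<circ> bypass p \<tau>"
proof
  fix x
  have "\<pi> y = p \<longleftrightarrow> y = p" for y using assms by (metis injD)
  thus "bypass p (\<pi> \<circ> \<tau>) x = (\<pi> \<circ> bypass p \<tau>) x"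
    by (auto simp: bypass_def Transposition.transpose_def inj_eq[OF assms(1)] assms(2))
qed

lemma is_cyc_pred:
  assumes "is_cyc \<sigma> l" "inj \<sigma>" "\<sigma> q = p" "p \<in> set l"
  shows "q \<in> set l"
proof -
  have "p \<in> \<sigma> ` set l"
  proof -
    have "\<sigma> ` set l \<subseteq> set l" using is_cyc_closed[OF assms(1)] by blast
    moreover have "card (\<sigma> ` set l) = card (set l)" using assms(2) by (metis card_image inj_on_subset subset_UNIV)
    ultimately have "\<sigma> ` set l = set l" by (intro card_subset_eq) auto
    thus ?thesis using assms(4) by simp
  qed
  thus ?thesis using assms(2,3) by (auto dest: injD)
qed

text \<open>Apart from p, only the predecessor q of p gets a new image. A cycle list therefore loses
  the entry p after q or stays as it is; p differs from the head, so the list keeps its starting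
  point.\<close>

lemma is_cyc_bypass:
  assumes cyc: "is_cyc \<sigma> l" and "inj \<sigma>" "\<sigma> q = p" "p \<noteq> hd l" "\<sigma> p \<noteq> p"
  obtains l' where "is_cyc (bypass p \<sigma>) l'" "hd l' = hd l" "set l' = set l - {p}"
    "p \<notin> set l \<Longrightarrow> l' = l"
    "p \<in> set l \<Longrightarrow> \<exists>xs ys. l = xs @ q # p # ys \<and> l' = xs @ q # ys"
proof (cases "p \<in> set l")
  case False
  have "q \<notin> set l" using is_cyc_closed[OF cyc, of q] assms(3) False by auto
  have sl: "set (l @ [hd l]) = set l" using cyc by (auto simp: is_cyc_def)
  have "bypass p \<sigma> x = \<sigma> x" if "x \<in> set l" for x
    using that False is_cyc_closed[OF cyc that] by (intro bypass_other assms(2)) auto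
  hence "successively (\<lambda>a b. bypass p \<sigma> a = b) (l @ [hd l])"
    using successively_mono[of "\<lambda>a b. \<sigma> a = b" "l @ [hd l]" "\<lambda>a b. bypass p \<sigma> a = b"] cyc sl
    unfolding is_cyc_def by fastforce
  hence "is_cyc (bypass p \<sigma>) l" using cyc by (auto simp: is_cyc_def)
  thus ?thesis using that[of l] False by auto
next
  case True
  then obtain zs ys where l: "l = zs @ p # ys" by (metis split_list)
  have "zs \<noteq> []" using l assms(4) by auto
  then obtain xs q' where zs: "zs = xs @ [q']" by (metis rev_exhaust)
  have d: "distinct l" and s: "successively (\<lambda>a b. \<sigma> a = b) (l @ [hd l])" using cyc by (auto simp: is_cyc_def)
  have s': "successively (\<lambda>a b. \<sigma> a = b) (xs @ q' # p # ys @ [hd l])" using s by (simp add: l zs)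
  hence sp: "successively (\<lambda>a b. \<sigma> a = b) xs" "xs = [] \<or> \<sigma> (last xs) = q'" "\<sigma> q' = p" "\<sigma> p = hd (ys @ [hd l])"
    "successively (\<lambda>a b. \<sigma> a = b) (ys @ [hd l])"
    by (auto simp: successively_append_iff successively_Cons)
  have q': "q' = q" using sp(3) assms(2,3) by (auto dest: injD)
  have hd': "hd (xs @ q # ys) = hd l" by (cases xs) (auto simp: l zs q')
  have np: "p \<notin> set xs" "p \<notin> set ys" "q \<notin> set xs" "q \<notin> set ys" "p \<noteq> q" "p \<noteq> hd l"
    using d assms(4) by (auto simp: l zs q')
  have oth: "bypass p \<sigma> x = \<sigma> x" if "x \<noteq> p" "x \<noteq> q" for x
    using that assms(2,3) by (intro bypass_other) (auto dest: injD)
  have mono: "successively (\<lambda>a b. bypass p \<sigma> a = b) zs" if "successively (\<lambda>a b. \<sigma> a = b) zs" "p \<notin> set (butlast zs)" "q \<notin> set (butlast zs)" for zs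
    unfolding successively_conv_nth
  proof (intro allI impI)
    fix i assume i: "Suc i < length zs"
    have "zs ! i \<in> set (butlast zs)" using i by (auto simp: nth_butlast[symmetric] intro!: nth_mem)
    hence "bypass p \<sigma> (zs ! i) = \<sigma> (zs ! i)" using that by (intro oth) auto
    thus "bypass p \<sigma> (zs ! i) = zs ! Suc i" using successively_nth[OF that(1) i] by simp
  qed
  define ws where "ws = ys @ [hd l]"
  have "successively (\<lambda>a b. bypass p \<sigma> a = b) xs"
    using np by (intro mono sp(1)) (auto dest: in_set_butlastD)
  moreover have "successively (\<lambda>a b. bypass p \<sigma> a = b) ws"
    unfolding ws_def using np by (intro mono sp(5)) auto
  moreover have "bypass p \<sigma> q = hd ws" using bypass_pred[of \<sigma> q p, OF assms(3)] sp(4) by (simp add: ws_def)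
  moreover have "bypass p \<sigma> (last xs) = q" if "xs \<noteq> []"
  proof -
    have "last xs \<in> set xs" using that by simp
    hence "bypass p \<sigma> (last xs) = \<sigma> (last xs)" using np by (intro oth) auto
    thus ?thesis using sp(2) that q' by simp
  qed
  ultimately have "successively (\<lambda>a b. bypass p \<sigma> a = b) (xs @ q # ws)"
    by (auto simp: successively_append_iff successively_Cons)
  hence "successively (\<lambda>a b. bypass p \<sigma> a = b) (xs @ q # ys @ [hd l])" by (simp add: ws_def)
  hence "is_cyc (bypass p \<sigma>) (xs @ q # ys)" using d hd' by (auto simp: is_cyc_def l zs q')
  thus ?thesis using that[of "xs @ q # ys"] hd' np l zs q' True by auto
qed

text \<open>For a permutation \<open>\<sigma>\<close> of \<open>B\<close> this is the product over the cycles of \<open>\<sigma>\<close> of the traces of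
  the products of the matrices along the cycles.\<close>
definition index_trace :: "(nat \<Rightarrow> 'b::comm_ring_1^'n::finite^'n) \<Rightarrow> (nat \<Rightarrow> nat) \<Rightarrow> nat set \<Rightarrow> 'b" where
  "index_trace Y \<sigma> B = (\<Sum>i\<in>PiE B (\<lambda>_. UNIV). \<Prod>p\<in>B. Y p $ i p $ i (\<sigma> p))"

lemma sum_PiE_insert:
  assumes "p \<notin> B"
  shows "(\<Sum>i\<in>PiE (insert p B) (\<lambda>_. X). F i) = (\<Sum>i\<in>PiE B (\<lambda>_. X). \<Sum>x\<in>X. F (i(p := x)))"
proof -
  have "(\<Sum>i\<in>PiE (insert p B) (\<lambda>_. X). F i) = (\<Sum>y\<in>X \<times> PiE B (\<lambda>_. X). F ((snd y)(p := fst y)))"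
    unfolding PiE_insert_eq
    by (subst sum.reindex[OF inj_combinator[OF assms]]) (simp add: split_def)
  also have "\<dots> = (\<Sum>x\<in>X. \<Sum>i\<in>PiE B (\<lambda>_. X). F (i(p := x)))" by (simp add: sum.cartesian_product split_def)
  also have "\<dots> = (\<Sum>i\<in>PiE B (\<lambda>_. X). \<Sum>x\<in>X. F (i(p := x)))" by (rule sum.swap)
  finally show ?thesis .
qed

lemma index_trace_cong:
  assumes "\<And>p. p \<in> B \<Longrightarrow> Y p = Y' p" "\<And>p. p \<in> B \<Longrightarrow> \<sigma> p = \<sigma>' p"
  shows "index_trace Y \<sigma> B = index_trace Y' \<sigma>' B"
  unfolding index_trace_def using assms by simp

text \<open>The index at p occurs only in the factors of q and of p; summing over it multiplies the
  two matrices.\<close>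

lemma index_trace_bypass:
  assumes fin: "finite B" and pq: "p \<in> B" "q \<in> B" "\<sigma> q = p" "\<sigma> p \<noteq> p" and inj: "inj \<sigma>"
    and stable: "\<sigma> p \<in> B"
  shows "index_trace Y \<sigma> B = index_trace (Y(q := Y q ** Y p)) (bypass p \<sigma>) (B - {p})"
proof -
  define C where "C = B - {p, q}"
  have qp: "q \<noteq> p" using pq by auto
  have B: "B = insert p (insert q C)" "B - {p} = insert q C" "p \<notin> insert q C" "q \<notin> C" "finite C"
    using pq qp fin by (auto simp: C_def)
  have "index_trace Y \<sigma> B = (\<Sum>i\<in>PiE (insert q C) (\<lambda>_. UNIV). \<Sum>x\<in>UNIV.
      \<Prod>y\<in>insert p (insert q C). Y y $ (i(p := x)) y $ (i(p := x)) (\<sigma> y))"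
    unfolding index_trace_def B(1) by (rule sum_PiE_insert[OF B(3)])
  also have "\<dots> = (\<Sum>i\<in>PiE (insert q C) (\<lambda>_. UNIV). (Y q ** Y p) $ i q $ i (\<sigma> p) * (\<Prod>y\<in>C. Y y $ i y $ i (\<sigma> y)))"
  proof (rule sum.cong[OF refl])
    fix i
    have "(\<Prod>y\<in>insert p (insert q C). Y y $ (i(p := x)) y $ (i(p := x)) (\<sigma> y))
       = Y q $ i q $ x * Y p $ x $ i (\<sigma> p) * (\<Prod>y\<in>C. Y y $ i y $ i (\<sigma> y))" for x
    proof -
      have "(\<Prod>y\<in>C. Y y $ (i(p := x)) y $ (i(p := x)) (\<sigma> y)) = (\<Prod>y\<in>C. Y y $ i y $ i (\<sigma> y))"
      proof (rule prod.cong[OF refl])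
        fix y assume "y \<in> C"
        hence "y \<noteq> p" "y \<noteq> q" by (auto simp: C_def)
        moreover from this have "\<sigma> y \<noteq> p" using pq(3) inj by (metis injD)
        ultimately show "Y y $ (i(p := x)) y $ (i(p := x)) (\<sigma> y) = Y y $ i y $ i (\<sigma> y)" by simp
      qed
      thus ?thesis using B(3-5) pq(3,4) qp by (simp add: mult_ac)
    qed
    thus "(\<Sum>x\<in>UNIV. \<Prod>y\<in>insert p (insert q C). Y y $ (i(p := x)) y $ (i(p := x)) (\<sigma> y))
      = (Y q ** Y p) $ i q $ i (\<sigma> p) * (\<Prod>y\<in>C. Y y $ i y $ i (\<sigma> y))"
      by (simp add: matrix_matrix_mult_def sum_distrib_right)
  qed
  also have "\<dots> = index_trace (Y(q := Y q ** Y p)) (bypass p \<sigma>) (B - {p})"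
    unfolding index_trace_def B(2)
  proof (rule sum.cong[OF refl])
    fix i
    have "(\<Prod>y\<in>C. (Y(q := Y q ** Y p)) y $ i y $ i (bypass p \<sigma> y)) = (\<Prod>y\<in>C. Y y $ i y $ i (\<sigma> y))"
    proof (rule prod.cong[OF refl])
      fix y assume "y \<in> C"
      hence y: "y \<noteq> p" "y \<noteq> q" by (auto simp: C_def)
      moreover from this have "\<sigma> y \<noteq> p" using pq(3) inj by (metis injD)
      ultimately show "(Y(q := Y q ** Y p)) y $ i y $ i (bypass p \<sigma> y) = Y y $ i y $ i (\<sigma> y)"
        using inj by (simp add: bypass_other)
    qed
    thus "(Y q ** Y p) $ i q $ i (\<sigma> p) * (\<Prod>y\<in>C. Y y $ i y $ i (\<sigma> y))
      = (\<Prod>y\<in>insert q C. (Y(q := Y q ** Y p)) y $ i y $ i (bypass p \<sigma> y))"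
      using B(4,5) by (simp add: bypass_pred[of \<sigma>] pq(3))
  qed
  finally show ?thesis .
qed

lemma index_trace_fixed:
  assumes "finite B" "p \<in> B" "\<sigma> p = p" "inj \<sigma>"
  shows "index_trace Y \<sigma> B = trace (Y p) * index_trace Y \<sigma> (B - {p})"
proof -
  define C where "C = B - {p}"
  have B: "B = insert p C" "p \<notin> C" "finite C" using assms by (auto simp: C_def)
  have "(\<Prod>y\<in>C. Y y $ (i(p := x)) y $ (i(p := x)) (\<sigma> y)) = (\<Prod>y\<in>C. Y y $ i y $ i (\<sigma> y))" for i x
  proof (rule prod.cong[OF refl])
    fix y assume "y \<in> C"
    hence "y \<noteq> p" by (auto simp: C_def)
    moreover from this have "\<sigma> y \<noteq> p" using assms(3,4) by (metis injD)
    ultimately show "Y y $ (i(p := x)) y $ (i(p := x)) (\<sigma> y) = Y y $ i y $ i (\<sigma> y)" by simp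
  qed
  hence "index_trace Y \<sigma> B = (\<Sum>i\<in>PiE C (\<lambda>_. UNIV). \<Sum>x\<in>UNIV. Y p $ x $ x * (\<Prod>y\<in>C. Y y $ i y $ i (\<sigma> y)))"
    unfolding index_trace_def B(1) sum_PiE_insert[OF B(2)] using B(2,3) assms(3) by simp
  also have "\<dots> = trace (Y p) * index_trace Y \<sigma> C"
    unfolding index_trace_def trace_def sum_product by (rule sum.swap)
  finally show ?thesis by (simp add: C_def)
qed

lemma wordmat_append: "wordmat Y (u @ v) = wordmat Y u ** wordmat Y v"
  by (induction u) (auto simp: matrix_mul_assoc)

lemma wordmat_cong: "(\<And>p. p \<in> set l \<Longrightarrow> Y p = Y' p) \<Longrightarrow> wordmat Y l = wordmat Y' l"
  by (induction l) auto

text \<open>Splitting off a cycle: shorten it with \<open>bypass\<close> until it becomes a fixed point.\<close>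
lemma index_trace_cycle:
  assumes "is_cyc \<sigma> l" "finite B" "set l \<subseteq> B" "inj \<sigma>"
  shows "index_trace Y \<sigma> B = trace (wordmat Y l) * index_trace Y \<sigma> (B - set l)"
  using assms
proof (induction "length l" arbitrary: l B \<sigma> Y rule: less_induct)
  case less
  obtain x zs where l: "l = x # zs" using less.prems(1) by (cases l) (auto simp: is_cyc_def)
  show ?case
  proof (cases zs)
    case Nil
    hence "\<sigma> x = x" using less.prems(1) by (simp add: l is_cyc_def)
    thus ?thesis using index_trace_fixed[OF less.prems(2), of x \<sigma> Y] less.prems Nil by (simp add: l)
  next
    case (Cons p ys)
    have sp: "\<sigma> x = p" "\<sigma> p = hd (ys @ [x])" and d: "distinct l"
      using less.prems(1) by (auto simp: l Cons is_cyc_def successively_Cons)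
    have px: "p \<noteq> x" using d by (auto simp: l Cons)
    have npp: "\<sigma> p \<noteq> p" using sp(2) d px by (cases ys) (auto simp: l Cons)
    have phd: "p \<noteq> hd l" and pl: "p \<in> set l" using px by (auto simp: l Cons)
    obtain l' where l': "is_cyc (bypass p \<sigma>) l'" "p \<in> set l \<Longrightarrow> \<exists>us vs. l = us @ x # p # vs \<and> l' = us @ x # vs"
      by (rule is_cyc_bypass[OF less.prems(1,4) sp(1) phd npp]) blast
    from l'(2)[OF pl] obtain us vs where uv: "l = us @ x # p # vs" "l' = us @ x # vs" by blast
    have "us = []" using uv(1) d by (cases us) (auto simp: l)
    hence l'eq: "l' = x # ys" using uv by (simp add: l Cons)
    define Y' where "Y' = Y(x := Y x ** Y p)"
    have pB: "p \<in> B" "x \<in> B" using less.prems(3) by (auto simp: l Cons)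
    have "index_trace Y \<sigma> B = index_trace Y' (bypass p \<sigma>) (B - {p})"
      unfolding Y'_def using pB sp npp less.prems is_cyc_closed[OF less.prems(1), of p]
      by (intro index_trace_bypass) (auto simp: l Cons)
    also have "\<dots> = trace (wordmat Y' l') * index_trace Y' (bypass p \<sigma>) (B - {p} - set l')"
    proof (rule less.hyps)
      show "length l' < length l" by (simp add: l'eq l Cons)
      show "is_cyc (bypass p \<sigma>) l'" by fact
      show "finite (B - {p})" using less.prems by simp
      show "set l' \<subseteq> B - {p}" using less.prems(3) d by (auto simp: l'eq l Cons)
      show "inj (bypass p \<sigma>)" unfolding bypass_def by (intro inj_compose less.prems(4)) simp
    qed
    also have "wordmat Y' l' = wordmat Y l"
    proof -
      have "wordmat Y' ys = wordmat Y ys" using d by (intro wordmat_cong) (auto simp: Y'_def l Cons)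
      thus ?thesis by (simp add: l'eq l Cons Y'_def matrix_mul_assoc)
    qed
    also have "B - {p} - set l' = B - set l" by (auto simp: l'eq l Cons)
    also have "index_trace Y' (bypass p \<sigma>) (B - set l) = index_trace Y \<sigma> (B - set l)"
    proof (rule index_trace_cong)
      fix y assume y: "y \<in> B - set l"
      thus "Y' y = Y y" by (auto simp: Y'_def l)
      have "\<sigma> y \<noteq> p"
      proof
        assume "\<sigma> y = p"
        hence "y = x" using sp(1) less.prems(4) by (metis injD)
        thus False using y by (simp add: l)
      qed
      thus "bypass p \<sigma> y = \<sigma> y" using y less.prems(4) by (intro bypass_other) (auto simp: l Cons)
    qed
    finally show ?thesis .
  qed
qed

lemma index_trace_conj:
  assumes "bij E"
  shows "index_trace Y (E \<circ> \<sigma> \<circ> inv E) (E ` B) = index_trace (Y \<circ> E) \<sigma> B"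
proof -
  have E: "inv E (E x) = x" "E (inv E x) = x" for x using assms by (simp_all add: bij_is_inj bij_is_surj surj_f_inv_f)
  have inj: "inj_on E B" using assms by (meson bij_is_inj inj_on_subset subset_UNIV)
  show ?thesis unfolding index_trace_def
  proof (rule sum.reindex_bij_witness[of _ "\<lambda>i. restrict (i \<circ> inv E) (E ` B)" "\<lambda>i. restrict (i \<circ> E) B"])
    fix i assume i: "i \<in> PiE (E ` B) (\<lambda>_. UNIV :: 'b set)"
    show "restrict (restrict (i \<circ> E) B \<circ> inv E) (E ` B) = i"
    proof
      fix x show "restrict (restrict (i \<circ> E) B \<circ> inv E) (E ` B) x = i x"
        using i E by (cases "x \<in> E ` B") (auto simp: PiE_def extensional_def)
    qed
    show "restrict (i \<circ> E) B \<in> PiE B (\<lambda>_. UNIV)" by auto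
    show "(\<Prod>p\<in>B. (Y \<circ> E) p $ restrict (i \<circ> E) B p $ restrict (i \<circ> E) B (\<sigma> p))
      = (\<Prod>p\<in>E ` B. Y p $ i p $ i ((E \<circ> \<sigma> \<circ> inv E) p))"
      unfolding prod.reindex[OF inj] comp_def
    proof (rule prod.cong[OF refl])
      fix p assume p: "p \<in> B"
      have "restrict (\<lambda>x. i (E x)) B (\<sigma> p) = i (E (\<sigma> p))"
      proof (cases "\<sigma> p \<in> B")
        case False
        hence "E (\<sigma> p) \<notin> E ` B" using assms by (metis bij_is_inj image_iff injD)
        thus ?thesis using False i by (auto simp: PiE_def extensional_def)
      qed auto
      thus "Y (E p) $ restrict (\<lambda>x. i (E x)) B p $ restrict (\<lambda>x. i (E x)) B (\<sigma> p) = Y (E p) $ i (E p) $ i (E (\<sigma> (inv E (E p))))"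
        using p E by simp
    qed
  next
    fix i assume i: "i \<in> PiE B (\<lambda>_. UNIV :: 'b set)"
    show "restrict (restrict (i \<circ> inv E) (E ` B) \<circ> E) B = i"
    proof
      fix x show "restrict (restrict (i \<circ> inv E) (E ` B) \<circ> E) B x = i x"
        using i E by (cases "x \<in> B") (auto simp: PiE_def extensional_def)
    qed
    show "restrict (i \<circ> inv E) (E ` B) \<in> PiE (E ` B) (\<lambda>_. UNIV)" by auto
  qed
qed

section \<open>Alternating sums and the Cayley--Hamilton quasi-polynomial\<close>

lemma qmul_eq:
  assumes "finite K" "finite L" "Poly_Mapping.keys p \<subseteq> K" "Poly_Mapping.keys q \<subseteq> L"
  shows "qmul p q = (\<Sum>u\<in>K. \<Sum>v\<in>L. Poly_Mapping.single (u @ v) (Poly_Mapping.lookup p u * Poly_Mapping.lookup q v))"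
proof -
  have "qmul p q = (\<Sum>u\<in>Poly_Mapping.keys p. \<Sum>v\<in>L. Poly_Mapping.single (u @ v) (Poly_Mapping.lookup p u * Poly_Mapping.lookup q v))"
    unfolding qmul_def using assms by (intro sum.cong refl sum.mono_neutral_left) (auto simp: in_keys_iff)
  also have "\<dots> = (\<Sum>u\<in>K. \<Sum>v\<in>L. Poly_Mapping.single (u @ v) (Poly_Mapping.lookup p u * Poly_Mapping.lookup q v))"
    using assms by (intro sum.mono_neutral_left) (auto simp: in_keys_iff intro!: sum.neutral)
  finally show ?thesis .
qed

lemma qmul_single: "qmul (Poly_Mapping.single u a) (Poly_Mapping.single v b) = Poly_Mapping.single (u @ v) (a * b)"
  by (subst qmul_eq[of "{u}" "{v}"]) auto

lemma qmul_add_left: "qmul (p + p') q = qmul p q + qmul p' q"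
proof -
  let ?K = "Poly_Mapping.keys p \<union> Poly_Mapping.keys p'"
  have "Poly_Mapping.keys (p + p') \<subseteq> ?K" by (rule keys_add)
  thus ?thesis
    by (subst (1 2 3) qmul_eq[of ?K "Poly_Mapping.keys q"]) (auto simp: lookup_add distrib_right single_add sum.distrib)
qed

lemma qmul_add_right: "qmul p (q + q') = qmul p q + qmul p q'"
proof -
  let ?K = "Poly_Mapping.keys q \<union> Poly_Mapping.keys q'"
  have "Poly_Mapping.keys (q + q') \<subseteq> ?K" by (rule keys_add)
  thus ?thesis
    by (subst (1 2 3) qmul_eq[of "Poly_Mapping.keys p" ?K]) (auto simp: lookup_add distrib_left single_add sum.distrib)
qed

lemma qmul_0 [simp]: "qmul 0 q = 0" "qmul p 0 = 0"
  by (auto simp: qmul_def)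

lemma qmul_sum_left: "qmul (\<Sum>x\<in>X. f x) q = (\<Sum>x\<in>X. qmul (f x) q)"
  by (induction X rule: infinite_finite_induct) (auto simp: qmul_add_left)

lemma qmul_sum_right: "qmul p (\<Sum>x\<in>X. f x) = (\<Sum>x\<in>X. qmul p (f x))"
  by (induction X rule: infinite_finite_induct) (auto simp: qmul_add_right)

lemma qmul_one_right: "qmul p (Poly_Mapping.single [] 1) = p"
proof -
  have "qmul p (Poly_Mapping.single [] 1) = (\<Sum>u\<in>Poly_Mapping.keys p. Poly_Mapping.single u (Poly_Mapping.lookup p u))"
    by (subst qmul_eq[of "Poly_Mapping.keys p" "{[]}"]) auto
  thus ?thesis by (simp flip: poly_mapping_sum_singles)
qed

abbreviation qscale :: "('a::comm_ring_1, 'n) cpoly \<Rightarrow> ('a, 'n) qpoly \<Rightarrow> ('a, 'n) qpoly" where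
  "qscale c p \<equiv> qmul (Poly_Mapping.single [] c) p"

lemma single_sum: "Poly_Mapping.single k (\<Sum>x\<in>X. f x) = (\<Sum>x\<in>X. Poly_Mapping.single k (f x))"
  by (induction X rule: infinite_finite_induct) (auto simp: single_add)

lemma qscale_sum: "qscale (\<Sum>x\<in>X. c x) p = (\<Sum>x\<in>X. qscale (c x) p)"
  by (simp add: single_sum qmul_sum_left)

lemma T_ideal_sum: "T_ideal I \<Longrightarrow> (\<And>x. x \<in> X \<Longrightarrow> f x \<in> I) \<Longrightarrow> (\<Sum>x\<in>X. f x) \<in> I"
  by (induction X rule: infinite_finite_induct) (auto simp: T_ideal_def)

lemma T_ideal_scale: "T_ideal I \<Longrightarrow> p \<in> I \<Longrightarrow> qscale c p \<in> I"
  unfolding T_ideal_def by (metis qmul_one_right)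

text \<open>Extends \<open>phi_sigma\<close> to any finite set A of points, any root d and words
  \<open>H p\<close> in place of letters, with the root's own word read first. The induction that
  deletes points of A runs inside this larger family.\<close>

definition phi :: "nat set \<Rightarrow> nat \<Rightarrow> (nat \<Rightarrow> nat) \<Rightarrow> (nat \<Rightarrow> nat list) \<Rightarrow> ('a::comm_ring_1, 'n::finite) qpoly" where
  "phi A d \<sigma> H = Poly_Mapping.single (concat (map H (cycword \<sigma> d)))
     (index_trace (\<lambda>p. wordmat generic (H p)) \<sigma> (A - orb \<sigma> d))"

text \<open>p and its predecessor q lie in the same cycle and are read one after the other, so p can
  be absorbed by appending its word to that of q. This applies to the open word and to the traces
  alike.\<close>

lemma phi_bypass:
  assumes "finite A" "\<sigma> permutes A" "p \<in> A" "p \<noteq> d" "\<sigma> q = p" "\<sigma> p \<noteq> p"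
  shows "(phi A d \<sigma> H :: ('a::comm_ring_1, 'n::finite) qpoly) = phi (A - {p}) d (bypass p \<sigma>) (H(q := H q @ H p))"
proof -
  have inj: "inj \<sigma>" using assms(2) by (rule permutes_inj)
  have perm: "permutation \<sigma>" using assms(1,2) by (rule permutes_imp_permutation)
  define l where "l = cycword \<sigma> d"
  have l: "is_cyc \<sigma> l" "hd l = d" "set l = orb \<sigma> d" using is_cyc_cycword'[OF perm] by (auto simp: l_def)
  have d: "distinct l" using l(1) by (simp add: is_cyc_def)
  have qA: "q \<in> A" using assms(2,3,5) by (metis permutes_not_in)
  have phd: "p \<noteq> hd l" using l(2) assms(4) by simp
  obtain l' where l': "is_cyc (bypass p \<sigma>) l'" "hd l' = hd l" "set l' = set l - {p}"
    "p \<notin> set l \<Longrightarrow> l' = l" "p \<in> set l \<Longrightarrow> \<exists>xs ys. l = xs @ q # p # ys \<and> l' = xs @ q # ys"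
    by (rule is_cyc_bypass[OF l(1) inj assms(5) phd assms(6)]) blast
  have c': "cycword (bypass p \<sigma>) d = l'" "orb (bypass p \<sigma>) d = set l - {p}"
    using is_cyc_cycword[OF l'(1)] is_cyc_orb[OF l'(1)] l'(2,3) l(2) by auto
  let ?H = "H(q := H q @ H p)"
  let ?W = "\<lambda>H p. wordmat generic (H p) :: ('a, 'n) cpoly^'n^'n"
  have oth: "bypass p \<sigma> x = \<sigma> x" if "x \<noteq> p" "x \<noteq> q" for x
    using that inj assms(5) by (intro bypass_other) (auto dest: injD)
  show ?thesis
  proof (cases "p \<in> set l")
    case True
    then obtain xs ys where xy: "l = xs @ q # p # ys" "l' = xs @ q # ys" using l'(5) by blast
    have n: "q \<notin> set xs" "q \<notin> set ys" using d by (auto simp: xy(1))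
    have "concat (map ?H l') = concat (map H l)" using n by (simp add: xy)
    moreover have "A - {p} - (set l - {p}) = A - set l" using True by auto
    moreover have "index_trace (?W ?H) (bypass p \<sigma>) (A - set l) = index_trace (?W H) \<sigma> (A - set l)"
    proof (rule index_trace_cong)
      fix x assume "x \<in> A - set l"
      hence x: "x \<noteq> q" "x \<noteq> p" by (auto simp: xy(1))
      show "wordmat generic (?H x) = wordmat generic (H x)" using x by simp
      show "bypass p \<sigma> x = \<sigma> x" using oth x by simp
    qed
    ultimately show ?thesis unfolding phi_def c' l_def[symmetric] l(3)[symmetric] by simp
  next
    case False
    have ql: "q \<notin> set l" using is_cyc_closed[OF l(1), of q] False assms(5) by auto
    have spl: "\<sigma> p \<notin> set l" using is_cyc_pred[OF l(1) inj, of p "\<sigma> p"] False by auto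
    have spA: "\<sigma> p \<in> A" using permutes_in_image[OF assms(2)] assms(3) by auto
    have "concat (map ?H l) = concat (map H l)"
      using ql by (intro arg_cong[where f = concat] map_cong) auto
    moreover have "A - {p} - (set l - {p}) = A - set l - {p}" by auto
    moreover have "index_trace (?W H) \<sigma> (A - set l) = index_trace ((?W H)(q := ?W H q ** ?W H p)) (bypass p \<sigma>) (A - set l - {p})"
      using assms qA ql False spl spA inj by (intro index_trace_bypass) auto
    moreover have "(?W H)(q := ?W H q ** ?W H p) = ?W ?H" by (auto simp: wordmat_append)
    ultimately show ?thesis unfolding phi_def c' l_def[symmetric] l(3)[symmetric] l'(4)[OF False] by (simp only:)
  qed
qed

lemma phi_fixed:
  assumes "finite A" "\<sigma> permutes A" "p \<in> A" "p \<noteq> d" "\<sigma> p = p"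
  shows "(phi A d \<sigma> H :: ('a::comm_ring_1, 'n::finite) qpoly) = qscale (trace (wordmat generic (H p))) (phi (A - {p}) d \<sigma> H)"
proof -
  have inj: "inj \<sigma>" using assms(2) by (rule permutes_inj)
  have "p \<notin> orb \<sigma> d"
  proof
    assume "p \<in> orb \<sigma> d"
    then obtain j where "p = (\<sigma> ^^ j) d" by (auto simp: orb_def)
    moreover have "(\<sigma> ^^ j) p = p" using assms(5) by (induction j) auto
    ultimately have "(\<sigma> ^^ j) p = (\<sigma> ^^ j) d" by simp
    hence "p = d" using inj_fn[OF inj, of j] by (metis injD)
    thus False using assms(4) by simp
  qed
  hence "index_trace (\<lambda>p. wordmat generic (H p) :: ('a, 'n) cpoly^'n^'n) \<sigma> (A - orb \<sigma> d)
     = trace (wordmat generic (H p)) * index_trace (\<lambda>p. wordmat generic (H p)) \<sigma> (A - orb \<sigma> d - {p})"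
    using assms inj by (intro index_trace_fixed) auto
  moreover have "A - orb \<sigma> d - {p} = A - {p} - orb \<sigma> d" by auto
  ultimately show ?thesis by (simp add: phi_def qmul_single)
qed

text \<open>If the root itself is deleted, its predecessor q becomes the root. But q is read last in
  the old cycle and first in the new one, so its word is taken out as a right factor and replaced by
  the empty word, while \<open>H d\<close> remains in front.\<close>

lemma phi_reroot:
  assumes "finite A" "\<sigma> permutes A" "d \<in> A" "\<sigma> q = d" "\<sigma> d \<noteq> d"
  shows "(phi A d \<sigma> H :: ('a::comm_ring_1, 'n::finite) qpoly) = qmul (qmul (Poly_Mapping.single (H d) 1) (phi (A - {d}) q (bypass d \<sigma>) (H(q := []))))
    (Poly_Mapping.single (H q) 1)"
proof -
  have inj: "inj \<sigma>" using assms(2) by (rule permutes_inj)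
  have perm: "permutation \<sigma>" using assms(1,2) by (rule permutes_imp_permutation)
  define l where "l = cycword \<sigma> d"
  have l: "is_cyc \<sigma> l" "hd l = d" "set l = orb \<sigma> d" using is_cyc_cycword'[OF perm] by (auto simp: l_def)
  obtain zs where zs: "l = d # zs" using l by (cases l) (auto simp: is_cyc_def)
  have "zs \<noteq> []" using l(1) assms(5) by (auto simp: zs is_cyc_def)
  then obtain ys q' where ys: "zs = ys @ [q']" by (metis rev_exhaust)
  have s: "successively (\<lambda>a b. \<sigma> a = b) ((d # ys) @ [q', d])" and dist: "distinct (d # ys @ [q'])"
    using l(1) by (auto simp: zs ys is_cyc_def)
  have "\<sigma> q' = d" using s unfolding successively_append_iff by simp
  hence q': "q' = q" using inj assms(4) by (auto dest: injD)
  have s2: "successively (\<lambda>a b. \<sigma> a = b) ((d # ys) @ [q])"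
    using s unfolding successively_append_iff q' by simp
  have "is_cyc \<sigma> (q # d # ys)"
    unfolding is_cyc_def using dist s2 assms(4) by (auto simp: q' successively_Cons)
  moreover have "d \<noteq> hd (q # d # ys)" using dist q' by auto
  ultimately obtain l' where l': "is_cyc (bypass d \<sigma>) l'"
    "d \<in> set (q # d # ys) \<Longrightarrow> \<exists>us vs. q # d # ys = us @ q # d # vs \<and> l' = us @ q # vs"
    by (rule is_cyc_bypass[OF _ inj assms(4) _ assms(5)]) blast
  then obtain us vs where uv: "q # d # ys = us @ q # d # vs" "l' = us @ q # vs" by auto
  have "us = []" using uv(1) dist q' by (cases us; cases "tl us") auto
  hence l'q: "l' = q # ys" using uv by simp
  have c': "cycword (bypass d \<sigma>) q = q # ys" "orb (bypass d \<sigma>) q = set (q # ys)"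
    using is_cyc_cycword[OF l'(1)] is_cyc_orb[OF l'(1)] unfolding l'q list.sel by auto
  let ?H = "H(q := [])"
  have "concat (map H l) = H d @ concat (map ?H (q # ys)) @ H q"
  proof -
    have "concat (map ?H ys) = concat (map H ys)"
      using dist q' by (intro arg_cong[where f = concat] map_cong) auto
    thus ?thesis by (simp add: zs ys q')
  qed
  moreover have "A - {d} - set (q # ys) = A - set l" by (auto simp: zs ys q')
  moreover have "index_trace (\<lambda>p. wordmat generic (?H p)) (bypass d \<sigma>) (A - set l)
     = (index_trace (\<lambda>p. wordmat generic (H p)) \<sigma> (A - set l) :: ('a, 'n) cpoly)"
  proof (rule index_trace_cong)
    fix x assume "x \<in> A - set l"
    hence x: "x \<noteq> q" "x \<noteq> d" by (auto simp: zs ys q')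
    show "wordmat generic (?H x) = wordmat generic (H x)" using x by simp
    show "bypass d \<sigma> x = \<sigma> x" using x inj assms(4) by (intro bypass_other) (auto dest: injD)
  qed
  ultimately show ?thesis unfolding phi_def c' l_def[symmetric] l(3)[symmetric] by (simp add: qmul_single)
qed

lemma phi_conj:
  assumes "permutation E" "permutation \<sigma>"
  shows "(phi (E ` A) (E d) (E \<circ> \<sigma> \<circ> inv E) H :: ('a::comm_ring_1, 'n::finite) qpoly) = phi A d \<sigma> (H \<circ> E)"
proof -
  have bij: "bij E" using assms(1) by (rule permutation_bijective)
  define l where "l = cycword \<sigma> d"
  have l: "is_cyc \<sigma> l" "hd l = d" "set l = orb \<sigma> d" using is_cyc_cycword'[OF assms(2)] by (auto simp: l_def)
  have cyc: "is_cyc (E \<circ> \<sigma> \<circ> inv E) (map E l)" by (rule is_cyc_conj[OF l(1) bij])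
  have hd: "hd (map E l) = E d" using l by (simp add: hd_map is_cyc_def)
  have c': "cycword (E \<circ> \<sigma> \<circ> inv E) (E d) = map E l" "orb (E \<circ> \<sigma> \<circ> inv E) (E d) = E ` set l"
    using is_cyc_cycword[OF cyc] is_cyc_orb[OF cyc] unfolding hd by auto
  have diff: "E ` A - E ` set l = E ` (A - set l)" using bij by (simp add: image_set_diff bij_is_inj)
  have eq: "index_trace (\<lambda>p. wordmat generic (H p) :: ('a, 'n) cpoly^'n^'n) (E \<circ> \<sigma> \<circ> inv E) (E ` (A - set l))
     = index_trace (\<lambda>p. wordmat generic ((H \<circ> E) p)) \<sigma> (A - set l)"
    unfolding index_trace_conj[OF bij] by (simp only: comp_def)
  show ?thesis unfolding phi_def c' l_def[symmetric] l(3)[symmetric] diff eq by simp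
qed

section \<open>Comparison with the cycle products in \<open>Qn\<close>\<close>

lemma orb_eq:
  assumes "permutation \<sigma>" "y \<in> orb \<sigma> x"
  shows "orb \<sigma> y = orb \<sigma> x"
proof -
  have inj: "inj \<sigma>" using permutation_bijective[OF assms(1)] by (rule bij_is_inj)
  obtain j where j: "y = (\<sigma> ^^ j) x" using assms(2) by (auto simp: orb_def)
  have "(\<sigma> ^^ i) y = (\<sigma> ^^ (i + j)) x" for i by (simp add: j funpow_add)
  hence "orb \<sigma> y \<subseteq> orb \<sigma> x" unfolding orb_def by auto
  moreover have "x \<in> orb \<sigma> y"
  proof -
    note c = is_cyc_cycword'[OF assms(1), of y]
    have "(\<sigma> ^^ j) x \<in> orb \<sigma> y \<Longrightarrow> x \<in> orb \<sigma> y"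
    proof (induction j)
      case (Suc j)
      thus ?case using is_cyc_pred[OF c(1) inj, of "(\<sigma> ^^ j) x" "(\<sigma> ^^ Suc j) x"] c(3) by simp
    qed auto
    moreover have "y \<in> orb \<sigma> y" unfolding orb_def by (metis funpow_0 rangeI)
    ultimately show ?thesis using j by simp
  qed
  then obtain k where k: "x = (\<sigma> ^^ k) y" by (auto simp: orb_def)
  have "(\<sigma> ^^ i) x = (\<sigma> ^^ (i + k)) y" for i by (simp add: k funpow_add)
  hence "orb \<sigma> x \<subseteq> orb \<sigma> y" unfolding orb_def by auto
  ultimately show ?thesis by blast
qed

lemma self_in_orb [simp]: "x \<in> orb \<sigma> x"
  unfolding orb_def by (metis funpow_0 rangeI)

text \<open>Splitting off one orbit after the other. The least element as starting point of each
  cycle matches the convention of \<open>phi_sigma\<close>.\<close>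

lemma index_trace_orbits:
  assumes "permutation \<sigma>"
  shows "finite B \<Longrightarrow> (\<And>x. x \<in> B \<Longrightarrow> orb \<sigma> x \<subseteq> B) \<Longrightarrow>
    index_trace Y \<sigma> B = (\<Prod>Cy\<in>orb \<sigma> ` B. trace (wordmat Y (cycword \<sigma> (Min Cy))))"
proof (induction "card B" arbitrary: B rule: less_induct)
  case less
  show ?case
  proof (cases "B = {}")
    case True
    thus ?thesis by (simp add: index_trace_def)
  next
    case False
    then obtain x where x: "x \<in> B" by blast
    define C where "C = orb \<sigma> x"
    have CB: "C \<subseteq> B" using less.prems(2)[OF x] by (simp add: C_def)
    have finC: "finite C" using CB less.prems(1) finite_subset by blast
    have "C \<noteq> {}" using self_in_orb[of x \<sigma>] unfolding C_def by blast
    hence "Min C \<in> C" using finC by (intro Min_in)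
    hence oC: "orb \<sigma> (Min C) = C" using orb_eq[OF assms] by (simp add: C_def)
    note c = is_cyc_cycword'[OF assms, of "Min C"]
    have inj: "inj \<sigma>" using permutation_bijective[OF assms] by (rule bij_is_inj)
    have "index_trace Y \<sigma> B = trace (wordmat Y (cycword \<sigma> (Min C))) * index_trace Y \<sigma> (B - C)"
      using index_trace_cycle[OF c(1) less.prems(1) _ inj, of Y] CB unfolding c(3) oC by simp
    also have "index_trace Y \<sigma> (B - C) = (\<Prod>Cy\<in>orb \<sigma> ` (B - C). trace (wordmat Y (cycword \<sigma> (Min Cy))))"
    proof (rule less.hyps)
      have "x \<in> C" using self_in_orb[of x \<sigma>] by (simp add: C_def)
      thus "card (B - C) < card B" using x less.prems(1) by (intro psubset_card_mono) auto
      show "finite (B - C)" using less.prems(1) by simp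
      fix y assume y: "y \<in> B - C"
      show "orb \<sigma> y \<subseteq> B - C"
      proof
        fix z assume z: "z \<in> orb \<sigma> y"
        hence "z \<in> B" using less.prems(2) y by blast
        moreover have "z \<notin> C"
        proof
          assume "z \<in> C"
          hence "orb \<sigma> y = C" using orb_eq[OF assms z] orb_eq[OF assms, of z x] by (simp add: C_def)
          thus False using y self_in_orb[of y \<sigma>] by auto
        qed
        ultimately show "z \<in> B - C" by simp
      qed
    qed
    also have "trace (wordmat Y (cycword \<sigma> (Min C))) * (\<Prod>Cy\<in>orb \<sigma> ` (B - C). trace (wordmat Y (cycword \<sigma> (Min Cy))))
       = (\<Prod>Cy\<in>insert C (orb \<sigma> ` (B - C)). trace (wordmat Y (cycword \<sigma> (Min Cy))))"
    proof -
      have "C \<notin> orb \<sigma> ` (B - C)" using self_in_orb[of _ \<sigma>] by blast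
      thus ?thesis using less.prems(1) by simp
    qed
    also have "insert C (orb \<sigma> ` (B - C)) = orb \<sigma> ` B"
    proof -
      have "orb \<sigma> z = C" if "z \<in> C" for z using orb_eq[OF assms, of z x] that by (simp add: C_def)
      hence "orb \<sigma> ` C = {C}" using \<open>C \<noteq> {}\<close> by auto
      moreover have "orb \<sigma> ` B = orb \<sigma> ` C \<union> orb \<sigma> ` (B - C)" using CB by blast
      ultimately show ?thesis by simp
    qed
    finally show ?thesis .
  qed
qed

lemma orb_subset: "\<sigma> permutes A \<Longrightarrow> x \<in> A \<Longrightarrow> orb \<sigma> x \<subseteq> A"
proof -
  assume s: "\<sigma> permutes A" "x \<in> A"
  have "(\<sigma> ^^ j) x \<in> A" for j by (induction j) (use s permutes_in_image[OF s(1)] in auto)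
  thus ?thesis by (auto simp: orb_def)
qed

lemma index_trace_cycles:
  assumes "\<sigma> permutes {0..n}"
  shows "index_trace Y \<sigma> ({0..n} - orb \<sigma> n)
    = (\<Prod>Cy\<in>{orb \<sigma> i | i. i < n \<and> n \<notin> orb \<sigma> i}. trace (wordmat Y (cycword \<sigma> (Min Cy))))"
proof -
  have perm: "permutation \<sigma>" using permutes_imp_permutation[OF _ assms] by simp
  have sub: "orb \<sigma> x \<subseteq> {0..n}" if "x \<in> {0..n}" for x using orb_subset[OF assms that] .
  have sym: "y \<in> orb \<sigma> x \<longleftrightarrow> x \<in> orb \<sigma> y" for x y
    using orb_eq[OF perm] self_in_orb by metis
  have "orb \<sigma> x \<subseteq> {0..n} - orb \<sigma> n" if x: "x \<in> {0..n} - orb \<sigma> n" for x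
  proof
    fix z assume z: "z \<in> orb \<sigma> x"
    have "z \<notin> orb \<sigma> n"
    proof
      assume "z \<in> orb \<sigma> n"
      hence "orb \<sigma> x = orb \<sigma> n" using orb_eq[OF perm z] orb_eq[OF perm] by metis
      thus False using x self_in_orb[of x \<sigma>] by simp
    qed
    thus "z \<in> {0..n} - orb \<sigma> n" using sub x z by blast
  qed
  hence "index_trace Y \<sigma> ({0..n} - orb \<sigma> n) = (\<Prod>Cy\<in>orb \<sigma> ` ({0..n} - orb \<sigma> n). trace (wordmat Y (cycword \<sigma> (Min Cy))))"
    by (intro index_trace_orbits[OF perm]) auto
  also have "orb \<sigma> ` ({0..n} - orb \<sigma> n) = {orb \<sigma> i | i. i < n \<and> n \<notin> orb \<sigma> i}"
  proof -
    have "x \<in> {0..n} - orb \<sigma> n \<longleftrightarrow> x < n \<and> n \<notin> orb \<sigma> x" for x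
      using sym[of x n] self_in_orb[of n \<sigma>] by (cases "x = n") auto
    hence "{0..n} - orb \<sigma> n = {x. x < n \<and> n \<notin> orb \<sigma> x}" by blast
    thus ?thesis by (simp only: setcompr_eq_image)
  qed
  finally show ?thesis .
qed

lemma Phi_single: "Phi (Poly_Mapping.single u 1) = wordmat generic u"
  by (simp add: Phi_def msmult_def vec_eq_iff)

lemma wordmat_concat: "wordmat Y (concat (map u w)) = wordmat (\<lambda>k. wordmat Y (u k)) w"
  by (induction w) (auto simp: wordmat_append)

lemma is_hom_of_nat: "is_hom h \<Longrightarrow> h (of_nat k) = of_nat k"
  by (induction k) (auto simp: is_hom_def)

lemma is_hom_of_int: "is_hom h \<Longrightarrow> h (of_int k) = of_int k"
  by (cases k) (auto simp: is_hom_of_nat is_hom_uminus is_homD is_hom_diff)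

lemma qword_single: "qword (\<lambda>k. Poly_Mapping.single (u k) 1) w = Poly_Mapping.single (concat (map u w)) 1"
  by (induction w) (auto simp: qword_def qone_def qmul_single)

lemma qsubst_eq:
  assumes "finite K" "Poly_Mapping.keys P \<subseteq> K"
  shows "qsubst H P = (\<Sum>w\<in>K. qscale (cpeval (\<lambda>(k, i, j). Phi (H k) $ i $ j) (Poly_Mapping.lookup P w) cconst) (qword H w))"
  unfolding qsubst_def using assms by (intro sum.mono_neutral_left) (auto simp: in_keys_iff)

lemma qsubst_single: "qsubst H (Poly_Mapping.single w a) = qscale (cpeval (\<lambda>(k, i, j). Phi (H k) $ i $ j) a cconst) (qword H w)"
  by (subst qsubst_eq[of "{w}"]) auto

lemma is_hom_cconst [simp]: "is_hom cconst"
  by (simp add: cconst_pconst)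

lemma qsubst_add: "qsubst H (P + Q) = qsubst H P + qsubst H Q"
proof -
  let ?K = "Poly_Mapping.keys P \<union> Poly_Mapping.keys Q"
  have "Poly_Mapping.keys (P + Q) \<subseteq> ?K" by (rule keys_add)
  thus ?thesis
    by (subst (1 2 3) qsubst_eq[of ?K]) (auto simp: lookup_add cpeval_add single_add qmul_add_left sum.distrib)
qed

lemma qsubst_sum: "qsubst H (\<Sum>x\<in>X. f x) = (\<Sum>x\<in>X. qsubst H (f x))"
proof -
  have "qsubst H 0 = 0" by (simp add: qsubst_def)
  thus ?thesis by (induction X rule: infinite_finite_induct) (auto simp: qsubst_add)
qed

lemma cpeval_qtr_words:
  "cpeval (\<lambda>(k, i, j). Phi (Poly_Mapping.single (u k) 1) $ i $ j) (qtr w) cconst = trace (wordmat generic (concat (map u w)))"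
proof -
  let ?h = "\<lambda>p. cpeval (\<lambda>(k, i, j). Phi (Poly_Mapping.single (u k) 1) $ i $ j) p cconst"
  have h: "is_hom ?h" by simp
  have "?h (qtr w) = (\<Sum>i\<in>UNIV. ?h (wordmat generic w $ i $ i))"
    by (simp add: qtr_def trace_def is_hom_sum[OF h])
  also have "\<dots> = (\<Sum>i\<in>UNIV. wordmat (\<lambda>k. wordmat generic (u k)) w $ i $ i)"
    by (intro sum.cong refl is_hom_wordmat[OF h]) (auto simp: generic_def cvar_pvar Phi_single)
  finally show ?thesis by (simp add: trace_def wordmat_concat)
qed

lemma cycword_tailword: "finite (orb \<sigma> n) \<Longrightarrow> cycword \<sigma> n = n # tailword n \<sigma>"
proof -
  assume "finite (orb \<sigma> n)"
  hence "card (orb \<sigma> n) > 0" using self_in_orb[of n \<sigma>] card_gt_0_iff by blast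
  hence "[0..<card (orb \<sigma> n)] = 0 # [1..<card (orb \<sigma> n)]" by (simp add: upt_conv_Cons)
  thus ?thesis by (simp add: cycword_def tailword_def)
qed

text \<open>Substituting words for the letters of \<open>Qn\<close> gives every term except for the
  word of the distinguished point, which \<open>tailword\<close> omits and \<open>phi\<close> puts
  first. It is common to all terms and becomes a left factor.\<close>

lemma alternating_phi_Qn:
  "(\<Sum>\<sigma> | \<sigma> permutes {0..CARD('n)}. qscale (of_int (sign \<sigma>)) (phi {0..CARD('n)} CARD('n) \<sigma> u :: ('a::comm_ring_1, 'n::finite) qpoly))
    = qmul (Poly_Mapping.single (u CARD('n)) 1) (qsubst (\<lambda>k. Poly_Mapping.single (u k) 1) Qn)"
proof -
  let ?n = "CARD('n)"
  let ?h = "\<lambda>p. cpeval (\<lambda>(k, i, j). Phi (Poly_Mapping.single (u k) 1) $ i $ j) p cconst :: ('a, 'n) cpoly"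
  have h: "is_hom ?h" by simp
  have "qmul (Poly_Mapping.single (u ?n) 1) (qsubst (\<lambda>k. Poly_Mapping.single (u k) 1) (Qn :: ('a, 'n) qpoly))
     = (\<Sum>\<sigma> | \<sigma> permutes {0..?n}. qmul (Poly_Mapping.single (u ?n) 1) (qsubst (\<lambda>k. Poly_Mapping.single (u k) 1) (qscale (of_int (sign \<sigma>)) (phi_sigma ?n \<sigma>))))"
    unfolding Qn_def qsubst_sum qmul_sum_right ..
  also have "\<dots> = (\<Sum>\<sigma> | \<sigma> permutes {0..?n}. qscale (of_int (sign \<sigma>)) (phi {0..?n} ?n \<sigma> u))"
  proof (rule sum.cong[OF refl])
    fix \<sigma> assume "\<sigma> \<in> {\<sigma>. \<sigma> permutes {0..?n}}"
    hence s: "\<sigma> permutes {0..?n}" by simp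
    have "orb \<sigma> ?n \<subseteq> {0..?n}" using orb_subset[OF s] by simp
    hence fin: "finite (orb \<sigma> ?n)" using finite_subset by blast
    have "?h (of_int (sign \<sigma>) * (\<Prod>Cy\<in>{orb \<sigma> i | i. i < ?n \<and> ?n \<notin> orb \<sigma> i}. qtr (cycword \<sigma> (Min Cy))))
      = of_int (sign \<sigma>) * index_trace (\<lambda>p. wordmat generic (u p)) \<sigma> ({0..?n} - orb \<sigma> ?n)"
      unfolding is_homD(4)[OF h] is_hom_prod[OF h] cpeval_qtr_words is_hom_of_int[OF h] index_trace_cycles[OF s] wordmat_concat ..
    thus "qmul (Poly_Mapping.single (u ?n) 1) (qsubst (\<lambda>k. Poly_Mapping.single (u k) 1) (qscale (of_int (sign \<sigma>)) (phi_sigma ?n \<sigma>)))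
       = (qscale (of_int (sign \<sigma>)) (phi {0..?n} ?n \<sigma> u) :: ('a, 'n) qpoly)"
      unfolding phi_sigma_def phi_def qmul_single qsubst_single qword_single cycword_tailword[OF fin] by simp
  qed
  finally show ?thesis by simp
qed

section \<open>Alternating sums lie in the T-ideal of \<open>Qn\<close>\<close>

lemma permutes_conj:
  assumes "\<sigma> permutes A" "bij E"
  shows "E \<circ> \<sigma> \<circ> inv E permutes E ` A"
proof -
  have "bij (E \<circ> \<sigma> \<circ> inv E)" using assms permutes_bij[OF assms(1)] by (intro bij_comp bij_imp_bij_inv)
  moreover have "(E \<circ> \<sigma> \<circ> inv E) x = x" if "x \<notin> E ` A" for x
  proof -
    have Ex: "E (inv E x) = x" using assms(2) by (simp add: bij_is_surj surj_f_inv_f)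
    hence "inv E x \<notin> A" using that by (metis imageI)
    thus ?thesis using Ex permutes_not_in[OF assms(1)] by simp
  qed
  ultimately show ?thesis unfolding permutes_def bij_iff by blast
qed

text \<open>A permutation of all natural numbers with finite support, not merely a bijection onto S,
  so that conjugation by it makes sense and preserves signs.\<close>

lemma ex_relabelling:
  assumes "finite S" "card S = Suc n" "d \<in> S"
  shows "\<exists>E. permutation E \<and> E ` {0..n} = S \<and> E n = d"
proof -
  obtain e0 where e0: "bij_betw e0 {0..n} S"
    using assms(1,2) by (metis card_atLeastAtMost diff_zero finite_atLeastAtMost finite_same_card_bij)
  define e where "e = Transposition.transpose (e0 n) d \<circ> e0"
  have "e0 n \<in> S" using e0 by (auto simp: bij_betw_def)
  hence "Transposition.transpose (e0 n) d permutes S" using assms(3) by (intro permutes_swap_id)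
  hence e: "bij_betw e {0..n} S" unfolding e_def using e0 permutes_imp_bij by (metis bij_betw_trans)
  have en: "e n = d" by (simp add: e_def)
  define U where "U = {0..n} \<union> S"
  have finU: "finite U" using assms(1) by (simp add: U_def)
  have "card (U - {0..n}) = card (U - S)"
    using assms(1,2) finU by (simp add: card_Diff_subset U_def)
  then obtain g where g: "bij_betw g (U - {0..n}) (U - S)"
    using finU by (metis finite_Diff finite_same_card_bij)
  define E where "E = (\<lambda>x. if x \<in> {0..n} then e x else if x \<in> U then g x else x)"
  have "bij_betw E {0..n} S" using e by (rule bij_betw_cong[THEN iffD1, rotated]) (simp add: E_def)
  moreover have "bij_betw E (U - {0..n}) (U - S)" using g by (rule bij_betw_cong[THEN iffD1, rotated]) (simp add: E_def)
  ultimately have "bij_betw E ({0..n} \<union> (U - {0..n})) (S \<union> (U - S))" by (rule bij_betw_combine) auto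
  moreover have "{0..n} \<union> (U - {0..n}) = U" "S \<union> (U - S) = U" by (auto simp: U_def)
  ultimately have "E permutes U" by (intro bij_imp_permutes) (auto simp: E_def U_def)
  hence "permutation E" using finU permutes_imp_permutation by blast
  moreover have "E ` {0..n} = S" using \<open>bij_betw E {0..n} S\<close> by (simp add: bij_betw_def)
  ultimately show ?thesis using en by (intro exI[of _ E]) (auto simp: E_def)
qed

lemma alternating_phi_base:
  fixes I :: "('a::comm_ring_1, 'n::finite) qpoly set"
  assumes "T_ideal I" "Qn \<in> I" "finite S" "card S = Suc CARD('n)" "d \<in> S"
  shows "(\<Sum>\<sigma> | \<sigma> permutes S. qscale (of_int (sign \<sigma>)) (phi S d \<sigma> H)) \<in> I"
proof -
  let ?n = "CARD('n)"
  obtain E where E: "permutation E" "E ` {0..?n} = S" "E ?n = d"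
    using ex_relabelling[OF assms(3,4,5)] by blast
  have bij: "bij E" using permutation_bijective[OF E(1)] .
  have inv: "E \<circ> inv E = id" "inv E \<circ> E = id" using bij bij_is_surj surj_iff bij_is_inj inj_iff by metis+
  have pinv: "permutation (inv E)" using permutation_inverse[OF E(1)] .
  have inv': "inv E \<circ> (E \<circ> f) = f" "E \<circ> (inv E \<circ> f) = f" for f :: "nat \<Rightarrow> nat"
    using inv by (simp_all flip: comp_assoc)
  have "(\<Sum>\<sigma> | \<sigma> permutes S. qscale (of_int (sign \<sigma>)) (phi S d \<sigma> H) :: ('a, 'n) qpoly)
     = (\<Sum>\<sigma> | \<sigma> permutes {0..?n}. qscale (of_int (sign \<sigma>)) (phi {0..?n} ?n \<sigma> (H \<circ> E)))"
  proof (rule sum.reindex_bij_witness[of _ "\<lambda>\<sigma>. E \<circ> \<sigma> \<circ> inv E" "\<lambda>\<sigma>. inv E \<circ> \<sigma> \<circ> E"])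
    fix \<sigma> assume "\<sigma> \<in> {\<sigma>. \<sigma> permutes S}"
    hence s: "\<sigma> permutes S" by simp
    have perm: "permutation \<sigma>" using permutes_imp_permutation[OF assms(3) s] .
    show bk: "E \<circ> (inv E \<circ> \<sigma> \<circ> E) \<circ> inv E = \<sigma>" using inv by (simp add: comp_assoc inv')
    have "inv E ` S = {0..?n}" using E(2) bij by (metis bij_is_inj image_inv_f_f)
    thus "inv E \<circ> \<sigma> \<circ> E \<in> {\<sigma>. \<sigma> permutes {0..?n}}"
      using permutes_conj[OF s bij_imp_bij_inv[OF bij]] bij by (simp add: inv_inv_eq)
    have p2: "permutation (inv E \<circ> \<sigma> \<circ> E)" using perm E(1) pinv by (intro permutation_compose)
    have "sign (inv E \<circ> \<sigma> \<circ> E) = sign \<sigma>"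
      using perm E(1) pinv by (simp add: sign_compose permutation_compose sign_inverse mult.commute)
    moreover have "phi S d \<sigma> H = (phi {0..?n} ?n (inv E \<circ> \<sigma> \<circ> E) (H \<circ> E) :: ('a, 'n) qpoly)"
      using phi_conj[OF E(1) p2, of "{0..?n}" ?n H] unfolding bk E(2,3) .
    ultimately show "qscale (of_int (sign (inv E \<circ> \<sigma> \<circ> E))) (phi {0..?n} ?n (inv E \<circ> \<sigma> \<circ> E) (H \<circ> E))
       = (qscale (of_int (sign \<sigma>)) (phi S d \<sigma> H) :: ('a, 'n) qpoly)" by simp
  next
    fix \<sigma> assume "\<sigma> \<in> {\<sigma>. \<sigma> permutes {0..?n}}"
    hence s: "\<sigma> permutes {0..?n}" by simp
    show "inv E \<circ> (E \<circ> \<sigma> \<circ> inv E) \<circ> E = \<sigma>" using inv by (simp add: comp_assoc inv')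
    show "E \<circ> \<sigma> \<circ> inv E \<in> {\<sigma>. \<sigma> permutes S}" using permutes_conj[OF s bij] E(2) by simp
  qed
  also have "\<dots> = qmul (qmul (Poly_Mapping.single ((H \<circ> E) ?n) 1) (qsubst (\<lambda>k. Poly_Mapping.single ((H \<circ> E) k) 1) Qn)) (Poly_Mapping.single [] 1)"
    unfolding alternating_phi_Qn qmul_one_right ..
  also have "\<dots> \<in> I" using assms(1,2) unfolding T_ideal_def by blast
  finally show ?thesis .
qed

text \<open>The scalar trace identity in n + 1 matrices, by the pigeonhole argument. It is an
  equation in the coefficient ring, so such sums vanish already in the free algebra.\<close>

lemma index_trace_alternating:
  fixes Y :: "nat \<Rightarrow> ('a::field_char_0, 'n::finite) cpoly^'n^'n"
  assumes "finite S" "card S = Suc CARD('n)"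
  shows "(\<Sum>\<pi> | \<pi> permutes S. of_int (sign \<pi>) * index_trace Y (\<pi> \<circ> \<tau>) S) = 0"
proof -
  have "(\<Sum>\<pi> | \<pi> permutes S. of_int (sign \<pi>) * index_trace Y (\<pi> \<circ> \<tau>) S)
    = (\<Sum>i\<in>PiE S (\<lambda>_. UNIV). \<Sum>\<pi> | \<pi> permutes S. of_int (sign \<pi>) * (\<Prod>p\<in>S. Y p $ i p $ (i \<circ> \<pi>) (\<tau> p)))"
    unfolding index_trace_def sum_distrib_left by (subst sum.swap) simp
  also have "\<dots> = 0"
  proof (rule sum.neutral, rule ballI)
    fix i :: "nat \<Rightarrow> 'n"
    let ?F = "\<lambda>g. \<Prod>p\<in>S. Y p $ i p $ g (\<tau> p)"
    define X where "X = (\<Sum>\<pi> | \<pi> permutes S. of_int (sign \<pi>) * ?F (i \<circ> \<pi>))"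
    obtain s t where st: "s \<in> S" "t \<in> S" "s \<noteq> t" "i s = i t" using pigeonhole_tuple[OF assms(2)] by blast
    have "X = - X" unfolding X_def using alternating_sum_antisym[OF st assms(1), of ?F] .
    hence "2 * X = 0" unfolding mult_2 by (rule eq_neg_iff_add_eq_0[THEN iffD1])
    moreover have "(2 :: ('a, 'n) cpoly) \<noteq> 0" by simp
    ultimately have "X = 0" using mpoly_no_zero_divisors by blast
    thus "(\<Sum>\<pi> | \<pi> permutes S. of_int (sign \<pi>) * ?F (i \<circ> \<pi>)) = 0" by (simp only: X_def)
  qed
  finally show ?thesis .
qed

text \<open>Points outside S are fixed by every \<pi>. Hence the predecessor of such a point under
  \<open>\<pi> \<circ> \<tau>\<close> is its preimage under \<tau>, whatever \<pi> is, and deleting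
  the point changes the words in all terms in the same way. Once A shrinks to S, the sum is a
  substituted \<open>Qn\<close>.\<close>

lemma alternating_phi_in_ideal:
  fixes I :: "('a::field_char_0, 'n::finite) qpoly set"
  assumes I: "T_ideal I" "Qn \<in> I" and S: "card S = Suc CARD('n)"
  shows "finite A \<Longrightarrow> S \<subseteq> A \<Longrightarrow> \<tau> permutes A \<Longrightarrow> d \<in> A \<Longrightarrow>
    (\<Sum>\<pi> | \<pi> permutes S. qscale (of_int (sign \<pi>)) (phi A d (\<pi> \<circ> \<tau>) H)) \<in> I"
proof (induction "card (A - S)" arbitrary: A \<tau> d H rule: less_induct)
  case less
  note A = less.prems
  have finS: "finite S" using A(1,2) finite_subset by blast
  have perms: "\<pi> permutes A" "inj \<pi>" "\<pi> \<circ> \<tau> permutes A" if "\<pi> \<in> {\<pi>. \<pi> permutes S}" for \<pi>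
    using that permutes_subset[of \<pi> S A] A(2) permutes_inj permutes_compose[OF A(3)] by auto
  have fixS: "\<pi> p = p" if "\<pi> \<in> {\<pi>. \<pi> permutes S}" "p \<notin> S" for \<pi> p using that by (auto simp: permutes_def)
  have smaller: "card (A - {p} - S) < card (A - S)" if "p \<in> A" "p \<notin> S" for p
    using that A(1) by (intro psubset_card_mono) auto
  consider "A = S" | p where "p \<in> A" "p \<notin> S" "p \<noteq> d" | "A - S = {d}" using A(2,4) by blast
  thus ?case
  proof cases
    case 1
    have t: "\<tau> permutes S" using A(3) 1 by simp
    have pt: "permutation \<tau>" using permutes_imp_permutation[OF finS t] .
    \<comment> \<open>Summing over \<open>\<pi> \<circ> \<tau>\<close> instead of \<pi> gives the
      full alternating sum up to the sign of \<tau>.\<close>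
    let ?g = "\<lambda>\<sigma>. qscale (of_int (sign (\<sigma> \<circ> inv \<tau>))) (phi S d \<sigma> H) :: ('a, 'n) qpoly"
    have "(\<Sum>\<pi> | \<pi> permutes S. qscale (of_int (sign \<pi>)) (phi A d (\<pi> \<circ> \<tau>) H)) = (\<Sum>\<pi> | \<pi> permutes S. ?g (\<pi> \<circ> \<tau>))"
      using permutes_inv_o(1)[OF t] by (simp add: 1 comp_assoc)
    also have "\<dots> = (\<Sum>\<sigma> | \<sigma> permutes S. ?g \<sigma>)"
      by (rule sum_permutations_compose_right[OF t, of ?g, symmetric])
    also have "\<dots> = (\<Sum>\<sigma> | \<sigma> permutes S. qscale (of_int (sign \<tau>)) (qscale (of_int (sign \<sigma>)) (phi S d \<sigma> H)))"
    proof (rule sum.cong[OF refl])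
      fix \<sigma> assume "\<sigma> \<in> {\<sigma>. \<sigma> permutes S}"
      hence "permutation \<sigma>" using permutes_imp_permutation[OF finS] by auto
      hence "sign (\<sigma> \<circ> inv \<tau>) = sign \<tau> * sign \<sigma>"
        using pt by (simp add: sign_compose permutation_inverse sign_inverse)
      thus "?g \<sigma> = qscale (of_int (sign \<tau>)) (qscale (of_int (sign \<sigma>)) (phi S d \<sigma> H))"
        by (simp add: phi_def qmul_single mult.assoc)
    qed
    also have "\<dots> = qscale (of_int (sign \<tau>)) (\<Sum>\<sigma> | \<sigma> permutes S. qscale (of_int (sign \<sigma>)) (phi S d \<sigma> H))"
      by (simp only: qmul_sum_right)
    also have "\<dots> \<in> I"
      using A(4) 1 S finS by (intro T_ideal_scale alternating_phi_base I) auto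
    finally show ?thesis .
  next
    case 2
    show ?thesis
    proof (cases "\<tau> p = p")
      case True
      let ?t = "trace (wordmat generic (H p)) :: ('a, 'n) cpoly"
      have "(\<Sum>\<pi> | \<pi> permutes S. qscale (of_int (sign \<pi>)) (phi A d (\<pi> \<circ> \<tau>) H))
         = (\<Sum>\<pi> | \<pi> permutes S. qscale ?t (qscale (of_int (sign \<pi>)) (phi (A - {p}) d (\<pi> \<circ> \<tau>) H)))"
      proof (rule sum.cong[OF refl])
        fix \<pi> assume "\<pi> \<in> {\<pi>. \<pi> permutes S}"
        note p = perms[OF this] fixS[OF this 2(2)]
        show "qscale (of_int (sign \<pi>)) (phi A d (\<pi> \<circ> \<tau>) H) = qscale ?t (qscale (of_int (sign \<pi>)) (phi (A - {p}) d (\<pi> \<circ> \<tau>) H))"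
          using p True by (subst phi_fixed[OF A(1) p(3) 2(1,3)]) (simp_all add: phi_def qmul_single mult.left_commute)
      qed
      also have "\<dots> = qscale ?t (\<Sum>\<pi> | \<pi> permutes S. qscale (of_int (sign \<pi>)) (phi (A - {p}) d (\<pi> \<circ> \<tau>) H))"
        by (simp only: qmul_sum_right)
      also have "\<dots> \<in> I"
      proof (rule T_ideal_scale[OF I(1)], rule less.hyps[OF smaller[OF 2(1,2)]])
        show "\<tau> permutes A - {p}" using permutes_superset[OF A(3), of "A - {p}"] True by auto
      qed (use A 2 in auto)
      finally show ?thesis .
    next
      case False
      define q where "q = inv \<tau> p"
      have tq: "\<tau> q = p" using permutes_inverses(1)[OF A(3)] by (simp add: q_def)
      have "(\<Sum>\<pi> | \<pi> permutes S. qscale (of_int (sign \<pi>)) (phi A d (\<pi> \<circ> \<tau>) H) :: ('a, 'n) qpoly)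
         = (\<Sum>\<pi> | \<pi> permutes S. qscale (of_int (sign \<pi>)) (phi (A - {p}) d (\<pi> \<circ> bypass p \<tau>) (H(q := H q @ H p))))"
      proof (rule sum.cong[OF refl])
        fix \<pi> assume "\<pi> \<in> {\<pi>. \<pi> permutes S}"
        note p = perms[OF this] fixS[OF this 2(2)]
        have "(\<pi> \<circ> \<tau>) q = p" using tq p(4) by simp
        moreover have "(\<pi> \<circ> \<tau>) p \<noteq> p" using False p(2,4) by (metis comp_apply injD)
        ultimately have "phi A d (\<pi> \<circ> \<tau>) H = (phi (A - {p}) d (bypass p (\<pi> \<circ> \<tau>)) (H(q := H q @ H p)) :: ('a, 'n) qpoly)"
          by (rule phi_bypass[OF A(1) p(3) 2(1,3)])
        thus "qscale (of_int (sign \<pi>)) (phi A d (\<pi> \<circ> \<tau>) H)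
           = (qscale (of_int (sign \<pi>)) (phi (A - {p}) d (\<pi> \<circ> bypass p \<tau>) (H(q := H q @ H p))) :: ('a, 'n) qpoly)"
          using bypass_comp[OF p(2,4)] by simp
      qed
      also have "\<dots> \<in> I"
        using A 2 bypass_permutes[OF A(3) 2(1)] by (intro less.hyps[OF smaller[OF 2(1,2)]]) auto
      finally show ?thesis .
    qed
  next
    case 3
    hence dS: "d \<notin> S" "A - {d} = S" using A(2) by auto
    \<comment> \<open>If the root is a fixed point, all terms carry the same word and their scalar
      factors add up to zero. Otherwise the root moves to its predecessor, which lies in S.\<close>
    show ?thesis
    proof (cases "\<tau> d = d")
      case True
      have "(\<Sum>\<pi> | \<pi> permutes S. qscale (of_int (sign \<pi>)) (phi A d (\<pi> \<circ> \<tau>) H) :: ('a, 'n) qpoly)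
        = (\<Sum>\<pi> | \<pi> permutes S. Poly_Mapping.single (H d) (of_int (sign \<pi>) * index_trace (\<lambda>p. wordmat generic (H p)) (\<pi> \<circ> \<tau>) S))"
      proof (rule sum.cong[OF refl])
        fix \<pi> assume "\<pi> \<in> {\<pi>. \<pi> permutes S}"
        note p = perms[OF this] fixS[OF this dS(1)]
        have cyc: "is_cyc (\<pi> \<circ> \<tau>) [d]" using True p(4) by (simp add: is_cyc_def)
        show "(qscale (of_int (sign \<pi>)) (phi A d (\<pi> \<circ> \<tau>) H) :: ('a, 'n) qpoly)
          = Poly_Mapping.single (H d) (of_int (sign \<pi>) * index_trace (\<lambda>p. wordmat generic (H p)) (\<pi> \<circ> \<tau>) S)"
          using is_cyc_cycword[OF cyc] is_cyc_orb[OF cyc] dS(2) by (simp add: phi_def qmul_single)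
      qed
      also have "\<dots> = 0"
        unfolding single_sum[symmetric] index_trace_alternating[OF finS S] by simp
      finally show ?thesis using I(1) by (simp add: T_ideal_def)
    next
      case False
      define q where "q = inv \<tau> d"
      have tq: "\<tau> q = d" using permutes_inverses(1)[OF A(3)] by (simp add: q_def)
      have qd: "q \<noteq> d" using tq False by auto
      have qA: "q \<in> A" using tq A(3,4) by (metis permutes_not_in)
      let ?L = "Poly_Mapping.single (H d) 1 :: ('a, 'n) qpoly" and ?R = "Poly_Mapping.single (H q) 1 :: ('a, 'n) qpoly"
      have "(\<Sum>\<pi> | \<pi> permutes S. qscale (of_int (sign \<pi>)) (phi A d (\<pi> \<circ> \<tau>) H))
         = (\<Sum>\<pi> | \<pi> permutes S. qmul (qmul ?L (qscale (of_int (sign \<pi>)) (phi (A - {d}) q (\<pi> \<circ> bypass d \<tau>) (H(q := []))))) ?R)"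
      proof (rule sum.cong[OF refl])
        fix \<pi> assume "\<pi> \<in> {\<pi>. \<pi> permutes S}"
        note p = perms[OF this] fixS[OF this dS(1)]
        have "(\<pi> \<circ> \<tau>) q = d" using tq p(4) by simp
        moreover have "(\<pi> \<circ> \<tau>) d \<noteq> d" using False p(2,4) by (metis comp_apply injD)
        ultimately have "phi A d (\<pi> \<circ> \<tau>) H = qmul (qmul ?L (phi (A - {d}) q (bypass d (\<pi> \<circ> \<tau>)) (H(q := [])))) ?R"
          by (rule phi_reroot[OF A(1) p(3) A(4)])
        thus "qscale (of_int (sign \<pi>)) (phi A d (\<pi> \<circ> \<tau>) H)
          = qmul (qmul ?L (qscale (of_int (sign \<pi>)) (phi (A - {d}) q (\<pi> \<circ> bypass d \<tau>) (H(q := []))))) ?R"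
          using bypass_comp[OF p(2,4)] by (simp add: phi_def qmul_single)
      qed
      also have "\<dots> = qmul (qmul ?L (\<Sum>\<pi> | \<pi> permutes S. qscale (of_int (sign \<pi>)) (phi (A - {d}) q (\<pi> \<circ> bypass d \<tau>) (H(q := []))))) ?R"
        by (simp only: qmul_sum_right qmul_sum_left)
      also have "\<dots> \<in> I"
      proof -
        have "(\<Sum>\<pi> | \<pi> permutes S. qscale (of_int (sign \<pi>)) (phi (A - {d}) q (\<pi> \<circ> bypass d \<tau>) (H(q := [])))) \<in> I"
          using A qd qA dS bypass_permutes[OF A(3,4)] by (intro less.hyps[OF smaller[OF A(4) dS(1)]]) auto
        thus ?thesis using I(1) unfolding T_ideal_def by blast
      qed
      finally show ?thesis .
    qed
  qed
qed

section \<open>Trace identities\<close>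

lemma Phi_eq:
  assumes "finite K" "Poly_Mapping.keys P \<subseteq> K"
  shows "Phi P $ u $ v = (\<Sum>w\<in>K. Poly_Mapping.lookup P w * qentry w u v)"
proof -
  have "Phi P $ u $ v = (\<Sum>w\<in>Poly_Mapping.keys P. Poly_Mapping.lookup P w * qentry w u v)"
    by (simp add: Phi_def msmult_def)
  also have "\<dots> = (\<Sum>w\<in>K. Poly_Mapping.lookup P w * qentry w u v)"
    using assms by (intro sum.mono_neutral_left) (auto simp: in_keys_iff)
  finally show ?thesis .
qed

lemma Phi_single_entry: "Phi (Poly_Mapping.single w a) $ u $ v = a * qentry w u v"
  by (subst Phi_eq[of "{w}"]) auto

lemma Phi_add: "Phi (P + Q) $ u $ v = Phi P $ u $ v + Phi Q $ u $ v"
proof -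
  let ?K = "Poly_Mapping.keys P \<union> Poly_Mapping.keys Q"
  have "Poly_Mapping.keys (P + Q) \<subseteq> ?K" by (rule keys_add)
  thus ?thesis by (subst (1 2 3) Phi_eq[of ?K]) (auto simp: lookup_add distrib_right sum.distrib)
qed

lemma Phi_sum: "Phi (\<Sum>x\<in>X. f x) $ u $ v = (\<Sum>x\<in>X. Phi (f x) $ u $ v)"
proof -
  have "Phi 0 $ u $ v = 0" by (simp add: Phi_def)
  thus ?thesis by (induction X rule: infinite_finite_induct) (auto simp: Phi_add)
qed

text \<open>Position d carries the empty word: it only marks where the open word begins and ends,
  and the d letters occupy the positions below it.\<close>

definition letter :: "nat \<Rightarrow> (nat \<Rightarrow> nat) \<Rightarrow> nat \<Rightarrow> nat list" where
  "letter d k p = (if p < d then [k p] else [])"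

abbreviation lphi :: "nat \<Rightarrow> (nat \<Rightarrow> nat) \<Rightarrow> (nat \<Rightarrow> nat) \<Rightarrow> ('a::comm_ring_1, 'n::finite) qpoly" where
  "lphi d k \<sigma> \<equiv> phi {..<Suc d} d \<sigma> (letter d k)"

lemma Phi_qscale_phi: "Phi (qscale c (phi A d \<sigma> H)) $ u $ v = c * Phi (phi A d \<sigma> H) $ u $ v"
  by (simp add: phi_def qmul_single Phi_single_entry mult.assoc)

text \<open>Close the open path at \<open>d\<close> with the matrix unit \<open>E\<^sub>v\<^sub>u\<close>.\<close>
lemma Phi_lphi_index_trace:
  assumes "\<sigma> permutes {..<Suc d}"
  shows "(Phi (lphi d k \<sigma>) $ u $ v :: ('a::comm_ring_1, 'n::finite) cpoly)
    = index_trace (\<lambda>p. if p < d then generic (k p) else (\<chi> a b. if a = v \<and> b = u then 1 else 0)) \<sigma> {..<Suc d}"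
proof -
  let ?Y = "\<lambda>p. if p < d then generic (k p) else (\<chi> a b. if a = v \<and> b = u then 1 else 0) :: ('a, 'n) cpoly^'n^'n"
  let ?W = "\<lambda>p. wordmat generic (letter d k p) :: ('a, 'n) cpoly^'n^'n"
  have perm: "permutation \<sigma>" using permutes_imp_permutation[OF _ assms] by simp
  define l where "l = cycword \<sigma> d"
  have l: "is_cyc \<sigma> l" "hd l = d" "set l = orb \<sigma> d" using is_cyc_cycword'[OF perm] by (auto simp: l_def)
  obtain zs where zs: "l = d # zs" using l by (cases l) (auto simp: is_cyc_def)
  have sub: "set l \<subseteq> {..<Suc d}" using orb_subset[OF assms, of d] l(3) by simp
  have dzs: "p < d" if "p \<in> set zs" for p
  proof -
    have "p \<noteq> d" using that l(1) by (auto simp: zs is_cyc_def)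
    moreover have "p < Suc d" using that sub by (auto simp: zs)
    ultimately show ?thesis by simp
  qed
  have "wordmat ?Y zs = wordmat ?W zs"
    using dzs by (intro wordmat_cong) (simp add: letter_def)
  hence "trace (wordmat ?Y l) = (\<Sum>a\<in>UNIV. \<Sum>b\<in>UNIV. (if a = v \<and> b = u then 1 else 0) * wordmat ?W zs $ b $ a)"
    by (simp add: zs trace_def matrix_matrix_mult_def)
  also have "\<dots> = (\<Sum>a\<in>UNIV. \<Sum>b\<in>UNIV. if b = u then (if a = v then wordmat ?W zs $ b $ a else 0) else 0)"
    by (rule sum.cong[OF refl], rule sum.cong[OF refl]) auto
  also have "\<dots> = wordmat ?W zs $ u $ v" by simp
  also have "\<dots> = qentry (concat (map (letter d k) l)) u v"
    by (simp add: zs wordmat_concat letter_def[of d k d])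
  finally have tr: "trace (wordmat ?Y l) = qentry (concat (map (letter d k) l)) u v" .
  have "index_trace ?Y \<sigma> {..<Suc d} = trace (wordmat ?Y l) * index_trace ?Y \<sigma> ({..<Suc d} - set l)"
    using index_trace_cycle[OF l(1) _ sub] permutes_inj[OF assms] by simp
  also have "index_trace ?Y \<sigma> ({..<Suc d} - set l) = index_trace ?W \<sigma> ({..<Suc d} - set l)"
  proof (rule index_trace_cong)
    fix p assume "p \<in> {..<Suc d} - set l"
    hence "p < d" by (auto simp: zs)
    thus "?Y p = ?W p" by (simp add: letter_def)
  qed auto
  finally show ?thesis
    unfolding phi_def Phi_single_entry tr l_def[symmetric] l(3)[symmetric] by (simp add: mult.commute)
qed

text \<open>The entry (u, v) prescribes the indices at the marker position, row index v and column
  index u. What remains is the matrix of a place permutation on d + 1 positions, paired with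
  monomials on the d letters.\<close>

lemma Phi_lphi:
  assumes s: "\<sigma> permutes {..<Suc d}"
  shows "(Phi (lphi d k \<sigma>) $ u $ v :: ('a::comm_ring_1, 'n::finite) cpoly)
    = (\<Sum>i\<in>tuples d. \<Sum>j\<in>tuples d. if j(d := u) = i(d := v) \<circ> \<sigma> then mon d (zip3 d k i j) else 0)"
proof -
  let ?E = "\<lambda>a b. if a = v \<and> b = u then 1 else (0 :: ('a, 'n) cpoly)"
  let ?Y = "\<lambda>p. if p < d then generic (k p) else (\<chi> a b. ?E a b)"
  have "Phi (lphi d k \<sigma>) $ u $ v = (\<Sum>i\<in>tuples d. \<Sum>x\<in>UNIV. \<Prod>p\<in>insert d {..<d}. ?Y p $ (i(d := x)) p $ (i(d := x)) (\<sigma> p))"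
    unfolding Phi_lphi_index_trace[OF s] unfolding index_trace_def lessThan_Suc by (rule sum_PiE_insert) simp
  also have "\<dots> = (\<Sum>i\<in>tuples d. \<Sum>j\<in>tuples d. if j(d := u) = i(d := v) \<circ> \<sigma> then mon d (zip3 d k i j) else 0)"
  proof (rule sum.cong[OF refl])
    fix i :: "nat \<Rightarrow> 'n" assume i: "i \<in> tuples d"
    define i' where "i' = i(d := v)"
    have i': "i' \<in> tuples (Suc d)" using i by (auto simp: i'_def PiE_def extensional_def)
    define j0 where "j0 = restrict (i' \<circ> \<sigma>) {..<d}"
    have "(\<Sum>x\<in>UNIV. \<Prod>p\<in>insert d {..<d}. ?Y p $ (i(d := x)) p $ (i(d := x)) (\<sigma> p))
       = (\<Sum>x\<in>UNIV. if x = v then (if i' (\<sigma> d) = u then \<Prod>p<d. pvar (k p, i p, i' (\<sigma> p)) else 0) else 0)"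
    proof (rule sum.cong[OF refl])
      fix x
      have "(\<Prod>p<d. ?Y p $ (i(d := x)) p $ (i(d := x)) (\<sigma> p)) = (\<Prod>p<d. pvar (k p, i p, (i(d := x)) (\<sigma> p)))"
        by (rule prod.cong[OF refl]) (simp add: generic_def cvar_pvar)
      thus "(\<Prod>p\<in>insert d {..<d}. ?Y p $ (i(d := x)) p $ (i(d := x)) (\<sigma> p))
        = (if x = v then (if i' (\<sigma> d) = u then \<Prod>p<d. pvar (k p, i p, i' (\<sigma> p)) else 0) else 0)"
        by (simp add: i'_def del: fun_upd_apply) (simp add: i'_def)
    qed
    also have "\<dots> = (if i' (\<sigma> d) = u then \<Prod>p<d. pvar (k p, i p, i' (\<sigma> p)) else 0)" by simp
    also have "(\<Prod>p<d. pvar (k p, i p, i' (\<sigma> p))) = (mon d (zip3 d k i j0) :: ('a, 'n) cpoly)"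
      unfolding mon_def by (rule prod.cong[OF refl]) (simp add: zip3_def j0_def)
    also have "(if i' (\<sigma> d) = u then mon d (zip3 d k i j0) else 0)
      = (\<Sum>j\<in>tuples d. if j = j0 then (if i' (\<sigma> d) = u then mon d (zip3 d k i j0) else 0) else (0 :: ('a, 'n) cpoly))"
      by (subst sum.delta) (auto simp: j0_def)
    also have "\<dots> = (\<Sum>j\<in>tuples d. if j(d := u) = i' \<circ> \<sigma> then mon d (zip3 d k i j) else 0)"
    proof (rule sum.cong[OF refl])
      fix j :: "nat \<Rightarrow> 'n" assume j: "j \<in> tuples d"
      have "j(d := u) = i' \<circ> \<sigma> \<longleftrightarrow> j = j0 \<and> i' (\<sigma> d) = u"
      proof
        assume eq: "j(d := u) = i' \<circ> \<sigma>"
        have "j p = j0 p" for p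
          using fun_cong[OF eq, of p] j by (cases "p < d") (auto simp: j0_def PiE_def extensional_def)
        thus "j = j0 \<and> i' (\<sigma> d) = u" using fun_cong[OF eq, of d] by auto
      next
        assume *: "j = j0 \<and> i' (\<sigma> d) = u"
        have mem: "i' \<circ> \<sigma> \<in> tuples (Suc d)" by (rule PiE_comp_perm[OF i' s])
        show "j(d := u) = i' \<circ> \<sigma>"
        proof
          fix p show "(j(d := u)) p = (i' \<circ> \<sigma>) p"
          proof (cases "p < Suc d")
            case True
            thus ?thesis using * by (auto simp: j0_def less_Suc_eq)
          next
            case False
            thus ?thesis using * PiE_arb[OF mem, of p] by (auto simp: j0_def)
          qed
        qed
      qed
      thus "(if j = j0 then (if i' (\<sigma> d) = u then mon d (zip3 d k i j0) else 0) else (0 :: ('a, 'n) cpoly))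
        = (if j(d := u) = i' \<circ> \<sigma> then mon d (zip3 d k i j) else 0)" by auto
    qed
    finally show "(\<Sum>x\<in>UNIV. \<Prod>p\<in>insert d {..<d}. ?Y p $ (i(d := x)) p $ (i(d := x)) (\<sigma> p))
       = (\<Sum>j\<in>tuples d. if j(d := u) = i(d := v) \<circ> \<sigma> then mon d (zip3 d k i j) else 0)" by (simp add: i'_def)
  qed
  finally show ?thesis .
qed

text \<open>Renaming the letter positions while the marker stays in place; this is the ambiguity in
  writing a quasi-polynomial by letters and a permutation.\<close>

lemma lphi_conj:
  assumes "\<rho> permutes {..<d}" "\<sigma> permutes {..<Suc d}"
  shows "(lphi d k (\<rho> \<circ> \<sigma> \<circ> inv \<rho>) :: ('a::comm_ring_1, 'n::finite) qpoly) = lphi d (k \<circ> \<rho>) \<sigma>"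
proof -
  have p: "permutation \<rho>" "permutation \<sigma>" using assms permutes_imp_permutation by blast+
  have r: "\<rho> permutes {..<Suc d}" using permutes_subset[OF assms(1)] by auto
  have "\<rho> d = d" using assms(1) by (auto simp: permutes_def)
  moreover have "\<rho> ` {..<Suc d} = {..<Suc d}" by (rule permutes_image[OF r])
  moreover have "letter d k \<circ> \<rho> = letter d (k \<circ> \<rho>)"
  proof
    fix x show "(letter d k \<circ> \<rho>) x = letter d (k \<circ> \<rho>) x"
      using permutes_in_image[OF assms(1), of x] by (simp add: letter_def)
  qed
  ultimately show ?thesis using phi_conj[OF p, of "{..<Suc d}" d "letter d k"] by simp
qed

lemma conj_perms_sum:
  assumes "\<rho> permutes {..<N}"
  shows "(\<Sum>\<sigma>\<in>perms N. F (inv \<rho> \<circ> \<sigma> \<circ> \<rho>) \<sigma>) = (\<Sum>\<sigma>\<in>perms N. F \<sigma> (\<rho> \<circ> \<sigma> \<circ> inv \<rho>))"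
proof (rule sum.reindex_bij_witness[of _ "\<lambda>\<sigma>. \<rho> \<circ> \<sigma> \<circ> inv \<rho>" "\<lambda>\<sigma>. inv \<rho> \<circ> \<sigma> \<circ> \<rho>"])
  have c: "\<rho> \<circ> inv \<rho> = id" "inv \<rho> \<circ> \<rho> = id" using permutes_inv_o[OF assms] by auto
  have c': "\<rho> \<circ> (inv \<rho> \<circ> f) = f" "inv \<rho> \<circ> (\<rho> \<circ> f) = f" for f :: "nat \<Rightarrow> nat"
    using c by (simp_all flip: comp_assoc)
  fix \<sigma> assume "\<sigma> \<in> perms N"
  hence s: "\<sigma> permutes {..<N}" by simp
  show e: "\<rho> \<circ> (inv \<rho> \<circ> \<sigma> \<circ> \<rho>) \<circ> inv \<rho> = \<sigma>" by (simp add: comp_assoc c c')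
  show "inv \<rho> \<circ> (\<rho> \<circ> \<sigma> \<circ> inv \<rho>) \<circ> \<rho> = \<sigma>" by (simp add: comp_assoc c c')
  show "inv \<rho> \<circ> \<sigma> \<circ> \<rho> \<in> perms N" using s assms permutes_inv[OF assms] by (auto intro!: permutes_compose)
  show "\<rho> \<circ> \<sigma> \<circ> inv \<rho> \<in> perms N" using s assms permutes_inv[OF assms] by (auto intro!: permutes_compose)
  show "F (inv \<rho> \<circ> \<sigma> \<circ> \<rho>) (\<rho> \<circ> (inv \<rho> \<circ> \<sigma> \<circ> \<rho>) \<circ> inv \<rho>) = F (inv \<rho> \<circ> \<sigma> \<circ> \<rho>) \<sigma>" by (simp only: e)
qed

lemma zip3_perm: "\<rho> permutes {..<d} \<Longrightarrow> zip3 d k i j \<circ> \<rho> = zip3 d (k \<circ> \<rho>) (i \<circ> \<rho>) (j \<circ> \<rho>)"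
proof
  fix p assume r: "\<rho> permutes {..<d}"
  show "(zip3 d k i j \<circ> \<rho>) p = zip3 d (k \<circ> \<rho>) (i \<circ> \<rho>) (j \<circ> \<rho>) p"
    using permutes_in_image[OF r, of p] by (auto simp: zip3_def)
qed

lemma qscale_qscale: "qscale a (qscale b p) = qscale (a * b) p"
proof -
  have "qscale a (qscale b (\<Sum>w\<in>Poly_Mapping.keys p. Poly_Mapping.single w (Poly_Mapping.lookup p w)))
    = qscale (a * b) (\<Sum>w\<in>Poly_Mapping.keys p. Poly_Mapping.single w (Poly_Mapping.lookup p w))"
    by (simp add: qmul_sum_right qmul_single mult.assoc)
  thus ?thesis by (simp flip: poly_mapping_sum_singles)
qed

lemma qscale_1: "qscale 1 p = p"
proof -
  have "qscale 1 (\<Sum>w\<in>Poly_Mapping.keys p. Poly_Mapping.single w (Poly_Mapping.lookup p w))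
    = (\<Sum>w\<in>Poly_Mapping.keys p. Poly_Mapping.single w (Poly_Mapping.lookup p w))"
    by (simp add: qmul_sum_right qmul_single)
  thus ?thesis by (simp flip: poly_mapping_sum_singles)
qed

lemma sum_const_qpoly:
  assumes "finite X"
  shows "(\<Sum>x\<in>X. p) = qscale (pconst (of_nat (card X))) p"
  using assms
proof (induction X rule: finite_induct)
  case empty
  thus ?case by (simp add: is_homD(1)[OF is_hom_pconst])
next
  case (insert x X)
  thus ?case by (simp add: is_homD[OF is_hom_pconst] single_add qmul_add_left qscale_1)
qed

text \<open>Several pairs of letters k and permutations give the same quasi-polynomial, so the
  coefficients c are first symmetrised to ct under renaming of positions. Then the vanishing of all
  entries of \<open>Phi R\<close> says that each \<open>ct d k\<close> acts as zero on d + 1 tensor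
  places. It is therefore a combination of alternating sums, which lie in the ideal.\<close>

lemma trace_identity_in_ideal:
  fixes c :: "nat \<Rightarrow> (nat \<Rightarrow> nat) \<Rightarrow> (nat \<Rightarrow> nat) \<Rightarrow> 'a::field_char_0"
    and I :: "('a, 'n::finite) qpoly set"
  assumes I: "T_ideal I" "Qn \<in> I" and K: "finite K"
    and R: "R = (\<Sum>d\<le>D. \<Sum>k\<in>PiE {..<d} (\<lambda>_. K). \<Sum>\<sigma>\<in>perms (Suc d). qscale (pconst (c d k \<sigma>)) (lphi d k \<sigma>))"
    and zero: "Phi R = 0"
  shows "R \<in> I"
proof -
  define ct where "ct = (\<lambda>d k \<sigma>. \<Sum>\<rho>\<in>perms d. c d (k \<circ> \<rho>) (inv \<rho> \<circ> \<sigma> \<circ> \<rho>))"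
  have sub: "\<rho> permutes {..<Suc d}" if "\<rho> permutes {..<d}" for \<rho> d using permutes_subset[OF that] by auto
  have ker: "in_perm_kernel TYPE('n) (Suc d) (ct d k)" if d: "d \<le> D" and k: "k \<in> PiE {..<d} (\<lambda>_. K)" for d k
    unfolding in_perm_kernel_def
  proof (intro ballI)
    fix i' j' :: "nat \<Rightarrow> 'n" assume ij': "i' \<in> tuples (Suc d)" "j' \<in> tuples (Suc d)"
    \<comment> \<open>The indices at position d select which entry (u, v) of \<open>Phi R\<close> is
      exploited; the remaining ones form tuples on the letter positions.\<close>
    define v where "v = i' d"
    define u where "u = j' d"
    define i where "i = restrict i' {..<d}"
    define j where "j = restrict j' {..<d}"
    have ij: "i \<in> tuples d" "j \<in> tuples d" by (auto simp: i_def j_def)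
    have i': "i' = i(d := v)" using ij'(1) by (auto simp: fun_eq_iff i_def v_def PiE_def extensional_def)
    have j': "j' = j(d := u)" using ij'(2) by (auto simp: fun_eq_iff j_def u_def PiE_def extensional_def)
    \<comment> \<open>The coefficient tensor of the entry (u, v) of \<open>Phi R\<close>; letters,
      rows and columns are recovered from the tuple w of variables.\<close>
    define b where "b = (\<lambda>(d::nat) (w :: nat \<Rightarrow> nat \<times> 'n \<times> 'n). \<Sum>\<sigma>\<in>perms (Suc d). c d (restrict (fst \<circ> w) {..<d}) \<sigma> *
       (if (restrict (snd \<circ> snd \<circ> w) {..<d})(d := u) = (restrict (fst \<circ> snd \<circ> w) {..<d})(d := v) \<circ> \<sigma> then 1 else (0::'a)))"
    have bz: "b d (zip3 d k i j) = (\<Sum>\<sigma>\<in>perms (Suc d). c d k \<sigma> * (if j(d := u) = i(d := v) \<circ> \<sigma> then 1 else 0))"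
      if "k \<in> PiE {..<d} (\<lambda>_. K)" "i \<in> tuples d" "j \<in> tuples d" for d k i j
    proof -
      have 1: "restrict (fst \<circ> zip3 d k i j) {..<d} = k"
        using that(1) by (auto simp: fun_eq_iff zip3_def PiE_def extensional_def)
      have 2: "restrict (fst \<circ> snd \<circ> zip3 d k i j) {..<d} = i"
        using that(2) by (auto simp: fun_eq_iff zip3_def PiE_def extensional_def)
      have 3: "restrict (snd \<circ> snd \<circ> zip3 d k i j) {..<d} = j"
        using that(3) by (auto simp: fun_eq_iff zip3_def PiE_def extensional_def)
      show ?thesis unfolding b_def 1 2 3 ..
    qed
    have "0 = Phi R $ u $ v" using zero by simp
    also have "\<dots> = (\<Sum>d\<le>D. \<Sum>k\<in>PiE {..<d} (\<lambda>_. K). \<Sum>\<sigma>\<in>perms (Suc d). pconst (c d k \<sigma>) *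
        (\<Sum>i\<in>tuples d. \<Sum>j\<in>tuples d. if j(d := u) = i(d := v) \<circ> \<sigma> then mon d (zip3 d k i j) else 0))"
      unfolding R Phi_sum Phi_qscale_phi by (intro sum.cong refl) (simp add: Phi_lphi)
    also have "\<dots> = (\<Sum>d\<le>D. \<Sum>k\<in>PiE {..<d} (\<lambda>_. K). \<Sum>i\<in>tuples d. \<Sum>j\<in>tuples d. pconst (b d (zip3 d k i j)) * mon d (zip3 d k i j))"
    proof (rule sum.cong[OF refl], rule sum.cong[OF refl])
      fix d :: nat and k assume k: "k \<in> PiE {..<d} (\<lambda>_. K)"
      have "(\<Sum>\<sigma>\<in>perms (Suc d). pconst (c d k \<sigma>) * (\<Sum>i\<in>tuples d. \<Sum>j\<in>tuples d. if j(d := u) = i(d := v) \<circ> \<sigma> then mon d (zip3 d k i j) else (0 :: ('a, 'n) cpoly)))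
        = (\<Sum>i\<in>tuples d. \<Sum>j\<in>tuples d. \<Sum>\<sigma>\<in>perms (Suc d). pconst (c d k \<sigma>) * (if j(d := u) = i(d := v) \<circ> \<sigma> then mon d (zip3 d k i j) else 0))"
        unfolding sum_distrib_left by (rule sum_swap3[symmetric])
      also have "\<dots> = (\<Sum>i\<in>tuples d. \<Sum>j\<in>tuples d. pconst (b d (zip3 d k i j)) * mon d (zip3 d k i j))"
      proof (rule sum.cong[OF refl], rule sum.cong[OF refl])
        fix i j :: "nat \<Rightarrow> 'n" assume "i \<in> tuples d" "j \<in> tuples d"
        thus "(\<Sum>\<sigma>\<in>perms (Suc d). pconst (c d k \<sigma>) * (if j(d := u) = i(d := v) \<circ> \<sigma> then mon d (zip3 d k i j) else 0))
          = pconst (b d (zip3 d k i j)) * (mon d (zip3 d k i j) :: ('a, 'n) cpoly)"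
          unfolding bz[OF k \<open>i \<in> tuples d\<close> \<open>j \<in> tuples d\<close>] is_hom_sum[OF is_hom_pconst] sum_distrib_right
          by (intro sum.cong refl) simp
      qed
      finally show "(\<Sum>\<sigma>\<in>perms (Suc d). pconst (c d k \<sigma>) * (\<Sum>i\<in>tuples d. \<Sum>j\<in>tuples d. if j(d := u) = i(d := v) \<circ> \<sigma> then mon d (zip3 d k i j) else (0 :: ('a, 'n) cpoly)))
        = (\<Sum>i\<in>tuples d. \<Sum>j\<in>tuples d. pconst (b d (zip3 d k i j)) * mon d (zip3 d k i j))" .
    qed
    also have "\<dots> = (\<Sum>d\<le>D. \<Sum>w\<in>PiE {..<d} (\<lambda>_. K \<times> UNIV). pconst (b d w) * mon d w)"
      by (rule sum.cong[OF refl], rule sum_zip3[symmetric])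
    finally have "(\<Sum>d\<le>D. \<Sum>w\<in>PiE {..<d} (\<lambda>_. K \<times> UNIV). pconst (b d w) * (mon d w :: ('a, 'n) cpoly)) = 0" by simp
    moreover have "zip3 d k i j \<in> PiE {..<d} (\<lambda>_. K \<times> UNIV)" using k by (auto simp: zip3_def)
    ultimately have "(\<Sum>\<rho>\<in>perms d. b d (zip3 d k i j \<circ> \<rho>)) = 0"
      using K d by (intro tensor_sum_eq_0[where b = b and D = D and V = "K \<times> UNIV"]) auto
    hence "0 = (\<Sum>\<rho>\<in>perms d. b d (zip3 d k i j \<circ> \<rho>))" by simp
    also have "\<dots> = (\<Sum>\<rho>\<in>perms d. \<Sum>\<sigma>\<in>perms (Suc d). c d (k \<circ> \<rho>) (inv \<rho> \<circ> \<sigma> \<circ> \<rho>) * (if j' = i' \<circ> \<sigma> then 1 else 0))"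
    proof (rule sum.cong[OF refl])
      fix \<rho> assume "\<rho> \<in> perms d"
      hence r: "\<rho> permutes {..<d}" by simp
      have rd: "\<rho> x = d \<longleftrightarrow> x = d" for x
      proof -
        have "\<rho> d = d" using r by (auto simp: permutes_def)
        thus ?thesis using permutes_inj[OF r] by (metis injD)
      qed
      have upd: "(f \<circ> \<rho>)(d := x) = f(d := x) \<circ> \<rho>" for f :: "nat \<Rightarrow> 'n" and x
        using rd by (auto simp: fun_eq_iff)
      have "b d (zip3 d k i j \<circ> \<rho>) = (\<Sum>\<sigma>\<in>perms (Suc d). c d (k \<circ> \<rho>) \<sigma> * (if (j \<circ> \<rho>)(d := u) = (i \<circ> \<rho>)(d := v) \<circ> \<sigma> then 1 else 0))"
        unfolding zip3_perm[OF r] using PiE_comp_perm[OF k r] PiE_comp_perm[OF ij(1) r] PiE_comp_perm[OF ij(2) r] by (rule bz)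
      also have "\<dots> = (\<Sum>\<sigma>\<in>perms (Suc d). c d (k \<circ> \<rho>) \<sigma> * (if j' = i' \<circ> (\<rho> \<circ> \<sigma> \<circ> inv \<rho>) then 1 else 0))"
      proof (rule sum.cong[OF refl])
        fix \<sigma>
        have inv: "inv \<rho> \<circ> \<rho> = id" using permutes_inv_o[OF r] by simp
        have "j' = i' \<circ> (\<rho> \<circ> \<sigma> \<circ> inv \<rho>) \<longleftrightarrow> j' \<circ> \<rho> = (i' \<circ> (\<rho> \<circ> \<sigma> \<circ> inv \<rho>)) \<circ> \<rho>"
          using comp_perm_cancel[OF r] by metis
        also have "(i' \<circ> (\<rho> \<circ> \<sigma> \<circ> inv \<rho>)) \<circ> \<rho> = i' \<circ> \<rho> \<circ> \<sigma>" by (simp add: comp_assoc inv)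
        finally have "((j \<circ> \<rho>)(d := u) = (i \<circ> \<rho>)(d := v) \<circ> \<sigma>) = (j' = i' \<circ> (\<rho> \<circ> \<sigma> \<circ> inv \<rho>))"
          unfolding upd i'[symmetric] j'[symmetric] by (rule sym)
        thus "c d (k \<circ> \<rho>) \<sigma> * (if (j \<circ> \<rho>)(d := u) = (i \<circ> \<rho>)(d := v) \<circ> \<sigma> then 1 else 0)
          = c d (k \<circ> \<rho>) \<sigma> * (if j' = i' \<circ> (\<rho> \<circ> \<sigma> \<circ> inv \<rho>) then 1 else 0)" by (simp only:)
      qed
      also have "\<dots> = (\<Sum>\<sigma>\<in>perms (Suc d). c d (k \<circ> \<rho>) (inv \<rho> \<circ> \<sigma> \<circ> \<rho>) * (if j' = i' \<circ> \<sigma> then 1 else 0))"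
        by (rule conj_perms_sum[OF sub[OF r], where F = "\<lambda>\<sigma> \<tau>. c d (k \<circ> \<rho>) \<sigma> * (if j' = i' \<circ> \<tau> then 1 else 0)", symmetric])
      finally show "b d (zip3 d k i j \<circ> \<rho>) = (\<Sum>\<sigma>\<in>perms (Suc d). c d (k \<circ> \<rho>) (inv \<rho> \<circ> \<sigma> \<circ> \<rho>) * (if j' = i' \<circ> \<sigma> then 1 else 0))" .
    qed
    also have "\<dots> = (\<Sum>\<sigma>\<in>perms (Suc d). ct d k \<sigma> * (if j' = i' \<circ> \<sigma> then 1 else 0))"
      unfolding ct_def sum_distrib_right by (rule sum.swap)
    finally show "(\<Sum>\<sigma>\<in>perms (Suc d). ct d k \<sigma> * (if j' = i' \<circ> \<sigma> then 1 else 0)) = 0" by simp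
  qed
  have inI: "(\<Sum>\<sigma>\<in>perms (Suc d). qscale (pconst (ct d k \<sigma>)) (lphi d k \<sigma>)) \<in> I"
    if d: "d \<le> D" and k: "k \<in> PiE {..<d} (\<lambda>_. K)" for d k
  proof -
    obtain e where e: "\<And>\<sigma>. \<sigma> \<in> perms (Suc d) \<Longrightarrow> ct d k \<sigma> = alt_combination CARD('n) (Suc d) e \<sigma>"
      using perm_kernel[OF ker[OF d k]] by blast
    have alt: "pconst (alt_coeff S \<tau> \<sigma>) = (alt_coeff S \<tau> \<sigma> :: ('a, 'n) cpoly)" for S \<tau> \<sigma>
      unfolding alt_coeff_def is_hom_sum[OF is_hom_pconst] is_homD(4)[OF is_hom_pconst] is_hom_of_int[OF is_hom_pconst]
      by (intro sum.cong refl) simp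
    have "(\<Sum>\<sigma>\<in>perms (Suc d). qscale (pconst (ct d k \<sigma>)) (lphi d k \<sigma>) :: ('a, 'n) qpoly)
      = (\<Sum>\<sigma>\<in>perms (Suc d). \<Sum>S\<in>alt_sets CARD('n) (Suc d). \<Sum>\<tau>\<in>perms (Suc d). qscale (pconst (e S \<tau>)) (qscale (alt_coeff S \<tau> \<sigma>) (lphi d k \<sigma>)))"
    proof (rule sum.cong[OF refl])
      fix \<sigma> assume "\<sigma> \<in> perms (Suc d)"
      thus "(qscale (pconst (ct d k \<sigma>)) (lphi d k \<sigma>) :: ('a, 'n) qpoly)
        = (\<Sum>S\<in>alt_sets CARD('n) (Suc d). \<Sum>\<tau>\<in>perms (Suc d). qscale (pconst (e S \<tau>)) (qscale (alt_coeff S \<tau> \<sigma>) (lphi d k \<sigma>)))"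
        unfolding e[OF \<open>\<sigma> \<in> perms (Suc d)\<close>] alt_combination_def is_hom_sum[OF is_hom_pconst] is_homD(4)[OF is_hom_pconst] alt qscale_sum
        by (simp add: phi_def qmul_single mult.assoc)
    qed
    also have "\<dots> = (\<Sum>S\<in>alt_sets CARD('n) (Suc d). \<Sum>\<tau>\<in>perms (Suc d). qscale (pconst (e S \<tau>)) (\<Sum>\<sigma>\<in>perms (Suc d). qscale (alt_coeff S \<tau> \<sigma>) (lphi d k \<sigma>)))"
      unfolding qmul_sum_right by (rule sum_swap3[symmetric])
    also have "\<dots> \<in> I"
    proof (rule T_ideal_sum[OF I(1)], rule T_ideal_sum[OF I(1)], rule T_ideal_scale[OF I(1)])
      fix S \<tau> assume "S \<in> alt_sets CARD('n) (Suc d)" "\<tau> \<in> perms (Suc d)"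
      hence S: "S \<subseteq> {..<Suc d}" "card S = Suc CARD('n)" and t: "\<tau> permutes {..<Suc d}" by (auto simp: alt_sets_def)
      have "(\<Sum>\<sigma>\<in>perms (Suc d). qscale (alt_coeff S \<tau> \<sigma>) (lphi d k \<sigma>) :: ('a, 'n) qpoly)
        = (\<Sum>\<pi> | \<pi> permutes S. qscale (of_int (sign \<pi>)) (lphi d k (\<pi> \<circ> \<tau>)))"
      proof -
        have "(\<Sum>\<sigma>\<in>perms (Suc d). qscale (alt_coeff S \<tau> \<sigma>) (lphi d k \<sigma>) :: ('a, 'n) qpoly)
          = (\<Sum>\<sigma>\<in>perms (Suc d). \<Sum>\<pi> | \<pi> permutes S. if \<sigma> = \<pi> \<circ> \<tau> then qscale (of_int (sign \<pi>)) (lphi d k (\<pi> \<circ> \<tau>)) else 0)"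
          unfolding alt_coeff_def qscale_sum by (intro sum.cong refl) simp
        also have "\<dots> = (\<Sum>\<pi> | \<pi> permutes S. \<Sum>\<sigma>\<in>perms (Suc d). if \<sigma> = \<pi> \<circ> \<tau> then qscale (of_int (sign \<pi>)) (lphi d k (\<pi> \<circ> \<tau>)) else 0)"
          by (rule sum.swap)
        also have "\<dots> = (\<Sum>\<pi> | \<pi> permutes S. qscale (of_int (sign \<pi>)) (lphi d k (\<pi> \<circ> \<tau>)))"
        proof (rule sum.cong[OF refl])
          fix \<pi> assume "\<pi> \<in> {\<pi>. \<pi> permutes S}"
          hence "\<pi> \<circ> \<tau> permutes {..<Suc d}" using permutes_subset[of \<pi> S] S(1) by (intro permutes_compose t) auto
          thus "(\<Sum>\<sigma>\<in>perms (Suc d). if \<sigma> = \<pi> \<circ> \<tau> then qscale (of_int (sign \<pi>)) (lphi d k (\<pi> \<circ> \<tau>)) else 0)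
            = (qscale (of_int (sign \<pi>)) (lphi d k (\<pi> \<circ> \<tau>)) :: ('a, 'n) qpoly)" by simp
        qed
        finally show ?thesis .
      qed
      also have "\<dots> \<in> I" using S t by (intro alternating_phi_in_ideal[OF I]) auto
      finally show "(\<Sum>\<sigma>\<in>perms (Suc d). qscale (alt_coeff S \<tau> \<sigma>) (lphi d k \<sigma>)) \<in> I" .
    qed
    finally show ?thesis .
  qed
  have "(\<Sum>k\<in>PiE {..<d} (\<lambda>_. K). \<Sum>\<sigma>\<in>perms (Suc d). qscale (pconst (c d k \<sigma>)) (lphi d k \<sigma>)) \<in> I" if d: "d \<le> D" for d
  proof -
    let ?P = "PiE {..<d} (\<lambda>_. K)"
    \<comment> \<open>The part of R of degree d. Summed over all letters, each renaming reproduces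
      it, so the symmetrised sum is \<open>card (perms d)\<close> times this part, and the factor is
      invertible in characteristic 0.\<close>
    define Rd :: "('a, 'n) qpoly" where "Rd = (\<Sum>k\<in>?P. \<Sum>\<sigma>\<in>perms (Suc d). qscale (pconst (c d k \<sigma>)) (lphi d k \<sigma>))"
    have "(\<Sum>k\<in>?P. \<Sum>\<sigma>\<in>perms (Suc d). qscale (pconst (ct d k \<sigma>)) (lphi d k \<sigma>) :: ('a, 'n) qpoly)
      = (\<Sum>k\<in>?P. \<Sum>\<sigma>\<in>perms (Suc d). \<Sum>\<rho>\<in>perms d. qscale (pconst (c d (k \<circ> \<rho>) (inv \<rho> \<circ> \<sigma> \<circ> \<rho>))) (lphi d k \<sigma>))"
      unfolding ct_def is_hom_sum[OF is_hom_pconst] qscale_sum ..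
    also have "\<dots> = (\<Sum>\<rho>\<in>perms d. \<Sum>k\<in>?P. \<Sum>\<sigma>\<in>perms (Suc d). qscale (pconst (c d (k \<circ> \<rho>) (inv \<rho> \<circ> \<sigma> \<circ> \<rho>))) (lphi d k \<sigma>))"
      by (rule sum_swap3)
    also have "\<dots> = (\<Sum>\<rho>\<in>perms d. Rd)"
    proof (rule sum.cong[OF refl])
      fix \<rho> assume "\<rho> \<in> perms d"
      hence r: "\<rho> permutes {..<d}" and ri: "inv \<rho> permutes {..<d}" by (auto intro: permutes_inv)
      have c: "\<rho> \<circ> inv \<rho> = id" "inv \<rho> \<circ> \<rho> = id" using permutes_inv_o[OF r] by auto
      have "(\<Sum>k\<in>?P. \<Sum>\<sigma>\<in>perms (Suc d). qscale (pconst (c d (k \<circ> \<rho>) (inv \<rho> \<circ> \<sigma> \<circ> \<rho>))) (lphi d k \<sigma>) :: ('a, 'n) qpoly)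
        = (\<Sum>k\<in>?P. \<Sum>\<sigma>\<in>perms (Suc d). qscale (pconst (c d (k \<circ> \<rho>) \<sigma>)) (lphi d (k \<circ> \<rho>) \<sigma>))"
      proof (rule sum.cong[OF refl])
        fix k
        have "(\<Sum>\<sigma>\<in>perms (Suc d). qscale (pconst (c d (k \<circ> \<rho>) (inv \<rho> \<circ> \<sigma> \<circ> \<rho>))) (lphi d k \<sigma>) :: ('a, 'n) qpoly)
          = (\<Sum>\<sigma>\<in>perms (Suc d). qscale (pconst (c d (k \<circ> \<rho>) \<sigma>)) (lphi d k (\<rho> \<circ> \<sigma> \<circ> inv \<rho>)))"
          by (rule conj_perms_sum[OF sub[OF r], where F = "\<lambda>\<sigma> \<tau>. qscale (pconst (c d (k \<circ> \<rho>) \<sigma>)) (lphi d k \<tau>)"])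
        also have "\<dots> = (\<Sum>\<sigma>\<in>perms (Suc d). qscale (pconst (c d (k \<circ> \<rho>) \<sigma>)) (lphi d (k \<circ> \<rho>) \<sigma>))"
          by (rule sum.cong[OF refl]) (simp add: lphi_conj[OF r])
        finally show "(\<Sum>\<sigma>\<in>perms (Suc d). qscale (pconst (c d (k \<circ> \<rho>) (inv \<rho> \<circ> \<sigma> \<circ> \<rho>))) (lphi d k \<sigma>) :: ('a, 'n) qpoly)
          = (\<Sum>\<sigma>\<in>perms (Suc d). qscale (pconst (c d (k \<circ> \<rho>) \<sigma>)) (lphi d (k \<circ> \<rho>) \<sigma>))" .
      qed
      also have "\<dots> = Rd" unfolding Rd_def
        by (rule sum.reindex_bij_witness[of _ "\<lambda>k. k \<circ> inv \<rho>" "\<lambda>k. k \<circ> \<rho>"])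
          (simp_all add: comp_assoc c PiE_comp_perm[OF _ r] PiE_comp_perm[OF _ ri])
      finally show "(\<Sum>k\<in>?P. \<Sum>\<sigma>\<in>perms (Suc d). qscale (pconst (c d (k \<circ> \<rho>) (inv \<rho> \<circ> \<sigma> \<circ> \<rho>))) (lphi d k \<sigma>)) = Rd" .
    qed
    also have "\<dots> = qscale (pconst (of_nat (card (perms d)))) Rd"
      by (rule sum_const_qpoly) (simp add: finite_permutations)
    finally have eq: "(\<Sum>k\<in>?P. \<Sum>\<sigma>\<in>perms (Suc d). qscale (pconst (ct d k \<sigma>)) (lphi d k \<sigma>)) = qscale (pconst (of_nat (card (perms d)))) Rd" .
    have "card (perms d) \<noteq> 0" using card_permutations[of "{..<d}" d] by simp
    hence "pconst (inverse (of_nat (card (perms d)) :: 'a)) * pconst (of_nat (card (perms d))) = (1 :: ('a, 'n) cpoly)"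
      by (simp add: is_homD(2)[OF is_hom_pconst] flip: is_homD(4)[OF is_hom_pconst])
    hence "Rd = qscale (pconst (inverse (of_nat (card (perms d))))) (qscale (pconst (of_nat (card (perms d)))) Rd)"
      by (simp add: qscale_qscale qscale_1)
    also have "\<dots> \<in> I" unfolding eq[symmetric] using d by (intro T_ideal_scale[OF I(1)] T_ideal_sum[OF I(1), OF inI]) auto
    finally show ?thesis unfolding Rd_def .
  qed
  thus ?thesis unfolding R using T_ideal_sum[OF I(1), of "{..D}"] by auto
qed

text \<open>The letters of w are put at the positions r to d - 1, and the root cycle runs from d
  through them back to d. The cycles of \<sigma> below r keep the traces. For empty w the marker d
  equals r and is a fixed point.\<close>

lemma single_trace_mon:
  fixes w :: "nat list" and r :: nat and k \<sigma> :: "nat \<Rightarrow> nat"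
  assumes s: "\<sigma> permutes {..<r}"
  defines "d \<equiv> r + length w"
  defines "k' \<equiv> restrict (\<lambda>p. if p < r then k p else w ! (p - r)) {..<d}"
  defines "\<sigma>' \<equiv> \<lambda>p. if p < r then \<sigma> p else if p < d then Suc p else if p = d then r else p"
  shows "\<sigma>' permutes {..<Suc d}"
    and "(Poly_Mapping.single w (trace_mon r k \<sigma>) :: ('a::comm_ring_1, 'n::finite) qpoly) = lphi d k' \<sigma>'"
proof -
  have sr: "\<sigma> p < r \<longleftrightarrow> p < r" for p using permutes_in_image[OF s, of p] by simp
  have inj: "inj_on \<sigma>' {..<Suc d}"
  proof (rule inj_onI)
    fix x y assume "x \<in> {..<Suc d}" "y \<in> {..<Suc d}" "\<sigma>' x = \<sigma>' y"
    thus "x = y"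
      using sr[of x] sr[of y] permutes_inj[OF s] by (auto simp: \<sigma>'_def d_def split: if_splits dest: injD)
  qed
  have "\<sigma>' ` {..<Suc d} \<subseteq> {..<Suc d}" using sr by (force simp: \<sigma>'_def d_def less_Suc_eq trans_less_add1)
  hence "bij_betw \<sigma>' {..<Suc d} {..<Suc d}" using inj endo_inj_surj[of "{..<Suc d}" \<sigma>'] by (auto simp: bij_betw_def)
  thus "\<sigma>' permutes {..<Suc d}" by (rule bij_imp_permutes) (auto simp: \<sigma>'_def d_def)
  have cyc: "is_cyc \<sigma>' (d # [r..<d])"
  proof -
    have "\<sigma>' ((d # [r..<Suc d]) ! i) = (d # [r..<Suc d]) ! Suc i" if "Suc i < length (d # [r..<Suc d])" for i
      using that by (cases i) (auto simp: \<sigma>'_def d_def nth_Cons simp del: upt_Suc)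
    hence "successively (\<lambda>a b. \<sigma>' a = b) (d # [r..<Suc d])" unfolding successively_conv_nth by blast
    moreover have "d # [r..<Suc d] = (d # [r..<d]) @ [d]" by (simp add: d_def)
    ultimately show ?thesis unfolding is_cyc_def by (simp del: upt_Suc)
  qed
  have c: "cycword \<sigma>' d = d # [r..<d]" "orb \<sigma>' d = insert d {r..<d}"
    using is_cyc_cycword[OF cyc] is_cyc_orb[OF cyc] by auto
  have "concat (map (letter d k') [r..<d]) = map k' [r..<d]"
  proof -
    have eq: "map (letter d k') [r..<d] = map (\<lambda>p. [k' p]) [r..<d]" by (auto simp: letter_def)
    show ?thesis unfolding eq by simp
  qed
  also have "\<dots> = w" by (rule nth_equalityI) (auto simp: k'_def d_def)
  finally have w: "concat (map (letter d k') (cycword \<sigma>' d)) = w" by (simp add: c letter_def[of d k' d])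
  have B: "{..<Suc d} - orb \<sigma>' d = {..<r}" unfolding c(2) by (auto simp: d_def)
  have "trace_mon r k \<sigma> = (index_trace (\<lambda>p. wordmat generic (letter d k' p)) \<sigma>' {..<r} :: ('a, 'n) cpoly)"
    unfolding trace_mon_def index_trace_def
    by (rule sum.cong[OF refl], rule prod.cong[OF refl])
      (simp add: letter_def k'_def d_def \<sigma>'_def generic_def cvar_pvar)
  thus "(Poly_Mapping.single w (trace_mon r k \<sigma>) :: ('a, 'n) qpoly) = lphi d k' \<sigma>'"
    unfolding phi_def w B by simp
qed

section \<open>Quasi-polynomials with invariant coefficients\<close>

abbreviation lphi' :: "nat \<times> (nat \<Rightarrow> nat) \<times> (nat \<Rightarrow> nat) \<Rightarrow> ('a::comm_ring_1, 'n::finite) qpoly" where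
  "lphi' x \<equiv> lphi (fst x) (fst (snd x)) (snd (snd x))"

abbreviation triples :: "(nat \<times> (nat \<Rightarrow> nat) \<times> (nat \<Rightarrow> nat)) set" where
  "triples \<equiv> (SIGMA d:UNIV. PiE {..<d} (\<lambda>_. UNIV) \<times> perms (Suc d))"

text \<open>Finite support is expressed by an arbitrary finite set of triples, which makes closure
  under sums easy; the sums over full ranges of degrees and letters are restored when an identity is
  treated.\<close>

definition trace_qpolys :: "('a::comm_ring_1, 'n::finite) qpoly set" where
  "trace_qpolys = {\<Sum>x\<in>S. qscale (pconst (c x)) (lphi' x) | S c. finite S \<and> S \<subseteq> triples}"

lemma trace_qpolys_add:
  assumes "p \<in> trace_qpolys" "q \<in> trace_qpolys"
  shows "p + q \<in> trace_qpolys"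
proof -
  obtain S c where p: "p = (\<Sum>x\<in>S. qscale (pconst (c x)) (lphi' x))" "finite S" "S \<subseteq> triples"
    using assms(1) by (auto simp: trace_qpolys_def)
  obtain T e where q: "q = (\<Sum>x\<in>T. qscale (pconst (e x)) (lphi' x))" "finite T" "T \<subseteq> triples"
    using assms(2) by (auto simp: trace_qpolys_def)
  define c' where "c' = (\<lambda>x. if x \<in> S then c x else 0)"
  define e' where "e' = (\<lambda>x. if x \<in> T then e x else 0)"
  have "p = (\<Sum>x\<in>S \<union> T. qscale (pconst (c' x)) (lphi' x))"
    unfolding p(1) using p(2) q(2) by (intro sum.mono_neutral_cong_left) (auto simp: c'_def)
  moreover have "q = (\<Sum>x\<in>S \<union> T. qscale (pconst (e' x)) (lphi' x))"
    unfolding q(1) using p(2) q(2) by (intro sum.mono_neutral_cong_left) (auto simp: e'_def)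
  ultimately have "p + q = (\<Sum>x\<in>S \<union> T. qscale (pconst (c' x + e' x)) (lphi' x))"
    by (simp add: sum.distrib is_homD(3)[OF is_hom_pconst] single_add qmul_add_left)
  moreover have "finite (S \<union> T)" "S \<union> T \<subseteq> triples" using p(2,3) q(2,3) by auto
  ultimately show ?thesis unfolding trace_qpolys_def
    by (intro CollectI exI[of _ "S \<union> T"] exI[of _ "\<lambda>x. c' x + e' x"]) simp
qed

lemma trace_qpolys_sum: "(\<And>x. x \<in> X \<Longrightarrow> f x \<in> trace_qpolys) \<Longrightarrow> (\<Sum>x\<in>X. f x) \<in> trace_qpolys"
proof -
  have "0 \<in> trace_qpolys" unfolding trace_qpolys_def by (intro CollectI exI[of _ "{}"]) simp
  thus "(\<And>x. x \<in> X \<Longrightarrow> f x \<in> trace_qpolys) \<Longrightarrow> (\<Sum>x\<in>X. f x) \<in> trace_qpolys"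
    by (induction X rule: infinite_finite_induct) (auto intro: trace_qpolys_add)
qed

lemma trace_qpolys_lphi:
  assumes "k \<in> PiE {..<d} (\<lambda>_. UNIV)" "\<sigma> permutes {..<Suc d}"
  shows "qscale (pconst a) (lphi d k \<sigma>) \<in> trace_qpolys"
  unfolding trace_qpolys_def using assms
  by (intro CollectI exI[of _ "{(d, k, \<sigma>)}"] exI[of _ "\<lambda>_. a"]) simp

lemma trace_qpoly_identity_in_ideal:
  fixes I :: "('a::field_char_0, 'n::finite) qpoly set"
  assumes I: "T_ideal I" "Qn \<in> I" and R: "R \<in> trace_qpolys" and zero: "Phi R = 0"
  shows "R \<in> I"
proof -
  obtain S c where S: "R = (\<Sum>x\<in>S. qscale (pconst (c x)) (lphi' x))" "finite S" "S \<subseteq> triples"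
    using R by (auto simp: trace_qpolys_def)
  \<comment> \<open>A degree bound and a finite set of letters that enclose all triples of S;
    coefficients outside S are set to zero.\<close>
  define D where "D = Max (insert 0 (fst ` S))"
  define K where "K = (\<Union>x\<in>S. fst (snd x) ` {..<fst x})"
  define e where "e = (\<lambda>d k \<sigma>. if (d, k, \<sigma>) \<in> S then c (d, k, \<sigma>) else 0)"
  let ?T = "SIGMA d:{..D}. PiE {..<d} (\<lambda>_. K) \<times> perms (Suc d)"
  have finK: "finite K" using S(2) by (auto simp: K_def)
  have fin: "finite (PiE {..<d} (\<lambda>_. K))" "finite (perms d)" for d :: nat
    using finK by (auto intro: finite_PiE finite_permutations)
  have sub: "S \<subseteq> ?T"
  proof
    fix x assume x: "x \<in> S"
    obtain d k \<sigma> where dk: "x = (d, k, \<sigma>)" by (cases x)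
    have "d \<le> D" using x S(2) by (force simp: D_def dk intro: Max_ge)
    moreover have "k \<in> PiE {..<d} (\<lambda>_. UNIV)" "\<sigma> permutes {..<Suc d}" using x S(3) by (auto simp: dk)
    moreover have "k p \<in> K" if "p < d" for p using x that by (force simp: K_def dk)
    ultimately show "x \<in> ?T" by (auto simp: dk PiE_iff)
  qed
  have "R = (\<Sum>x\<in>?T. qscale (pconst (e (fst x) (fst (snd x)) (snd (snd x)))) (lphi' x))"
    unfolding S(1) using sub fin by (intro sum.mono_neutral_cong_left) (auto simp: e_def)
  also have "\<dots> = (\<Sum>d\<le>D. \<Sum>k\<in>PiE {..<d} (\<lambda>_. K). \<Sum>\<sigma>\<in>perms (Suc d). qscale (pconst (e d k \<sigma>)) (lphi d k \<sigma>))"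
    unfolding sum.cartesian_product using fin by (subst sum.Sigma) (auto simp: split_beta)
  finally show ?thesis by (rule trace_identity_in_ideal[OF I finK _ zero])
qed

lemma single_invariant_trace_qpoly:
  fixes f :: "('a::field_char_0, 'n::finite) cpoly"
  assumes "\<And>u v. ad (unit_mat u v) f = 0"
  shows "Poly_Mapping.single w f \<in> trace_qpolys"
proof -
  obtain D K c where f: "f = (\<Sum>r\<le>D. \<Sum>k\<in>PiE {..<r} (\<lambda>_. K). \<Sum>\<sigma>\<in>perms r. pconst (c r k \<sigma>) * trace_mon r k \<sigma>)"
    using invariants_are_trace_polynomials[OF assms] by blast
  have "Poly_Mapping.single w (pconst a * trace_mon r k \<sigma> :: ('a, 'n) cpoly) \<in> trace_qpolys"
    if "\<sigma> permutes {..<r}" for a r k \<sigma>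
  proof -
    have "Poly_Mapping.single w (pconst a * trace_mon r k \<sigma> :: ('a, 'n) cpoly)
      = qscale (pconst a) (Poly_Mapping.single w (trace_mon r k \<sigma>))" by (simp add: qmul_single)
    also have "\<dots> \<in> trace_qpolys"
      unfolding single_trace_mon(2)[OF that] by (intro trace_qpolys_lphi single_trace_mon(1)[OF that]) auto
    finally show ?thesis .
  qed
  thus ?thesis unfolding f single_sum by (intro trace_qpolys_sum) auto
qed

theorem mainTheorem15:
  fixes lam :: "nat \<Rightarrow> ('a::field_char_0, 'n::finite) cpoly"
    and M :: "nat \<Rightarrow> nat list"
    and t :: nat
    and P :: "('a, 'n) qpoly"
  assumes "P = (\<Sum>i\<in>{0..t}. Poly_Mapping.single (M i) (lam i))"
    and "quasi_identity P"
    and "loc_lin_indep TYPE('n) t M TYPE('a)"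
  shows "P \<in> T_ideal_gen (Qn :: ('a, 'n) qpoly)"
  unfolding T_ideal_gen_def
proof (intro InterI, clarify)
  fix I :: "('a, 'n) qpoly set" assume I: "T_ideal I" "Qn \<in> I"
  have rel: "is_relation t M lam" using quasi_identity_imp_relation assms(1,2) by blast
  show "P \<in> I"
  proof (cases "lam 0 = 0")
    case True
    \<comment> \<open>Without the term of \<open>M 0\<close> the relation concerns independent words
      only, so all coefficients vanish.\<close>
    hence "P = 0" unfolding assms(1) using relation_trivial[OF rel assms(3) True] by (intro sum.neutral) auto
    thus ?thesis using I(1) by (simp add: T_ideal_def)
  next
    case False
    obtain \<mu> :: "nat \<Rightarrow> ('a, 'n) cpoly" and h where \<mu>: "is_relation t M \<mu>" "\<And>s. s \<in> {0..t} \<Longrightarrow> lam s = h * \<mu> s"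
      "\<And>a b s. s \<in> {0..t} \<Longrightarrow> ad (unit_mat a b) (\<mu> s) = 0"
      by (rule invariant_relation_generator[OF rel assms(3) False]) blast
    define R where "R = (\<Sum>s\<in>{0..t}. Poly_Mapping.single (M s) (\<mu> s))"
    have "R \<in> trace_qpolys"
      unfolding R_def by (intro trace_qpolys_sum single_invariant_trace_qpoly \<mu>(3))
    moreover have "Phi R = 0"
      using \<mu>(1) by (simp add: vec_eq_iff R_def Phi_sum Phi_single_entry is_relation_def)
    ultimately have "qscale h R \<in> I" by (rule T_ideal_scale[OF I(1) trace_qpoly_identity_in_ideal[OF I]])
    moreover have "P = qscale h R" using \<mu>(2) by (simp add: assms(1) R_def qmul_sum_right qmul_single)
    ultimately show ?thesis by simp
  qed
qed

end
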